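(* Let $\mathcal{S}$ be a $k$-to-$d$ polytopal cut and project scheme of codimension $n=k-d$ (possibly with a polytopal labelling partition of its window). Then $\mathcal{S}$ has property C (low complexity) if and only if $\sum_{V\in f}\mathrm{rk}(V)=k(n-1)$ for each flag $f\in\mathscr{F}_0$.
   Context: SCHEMES. A ($k$-to-$d$) polytopal cut and project scheme $\mathcal{S}$ consists of a $k$-dimensional real vector space $\mathbb{E}$, complementary subspaces $\mathbb{E}_\vee$ (physical space, dimension $d\ge 1$) and $\mathbb{E}_<$ (internal space, dimension $n=k-d\ge 1$) with $\mathbb{E}=\mathbb{E}_\vee\oplus\mathbb{E}_<$, a lattice $\Gamma<\mathbb{E}$ and a (non-empty) polytopal window $W\subset\mathbb{E}_<$. The projections to $\mathbb{E}_\vee,\mathbb{E}_<$ are written $x\mapsto x_\vee$, $x\mapsto x_<$ (also for subsets). A set $W$ is polytopal if it is compact, the closure of its interior, and $\partial W$ is contained in the union of a finite set $\mathscr{H}$ of properly supporting hyperplanes (affine, codimension 1); $H$ is properly supporting if there are $w_H\in H$, an open neighbourhood $U_H$ of $w_H$ and a closed half-space $H^+$ of $H$ with $W\cap U_H=H^+\cap U_H$. (Equivalently $W$ is a finite union of convex polytopes with non-empty interior; $\mathscr H$ is then exactly the set of properly supporting hyperplanes.) The window may carry a labelling $W=\bigcup_i W_i$ with each $W_i$ polytopal and distinct $W_i$ meeting at most on their boundaries; then $\mathscr{H}$ denotes the union of the sets of supporting hyperplanes of the $W_i$. For $H\in\mathscr H$, $V(H)=H-H$; $\mathscr{H}_0=\{V(H):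 H\in\mathscr{H}\}$. Standing assumptions: both projections are injective on $\Gamma$; $\Gamma_<$ is dense in $\mathbb{E}_<$; the scheme is non-singular, i.e. $\gamma_<\notin\partial W$ (resp. $\notin\partial W_i$ for all $i$) for all $\gamma\in\Gamma$. For $x=\gamma_\vee\in\Gamma_\vee$ put $x^\star=\gamma_<$. The cut and project set is $\Lambda=\{x\in\Gamma_\vee: x^\star\in W\}$, where $x$ has label $i$ if $x^\star\in W_i$ in the labelled case. COMPLEXITY. Fix a norm on $\mathbb{E}_\vee$. For $x\in\Lambda$ the $r$-patch $P_r(x)$ is $\Lambda\cap B_r(x)$ (closed ball, with labels) with marked centre $x$; $r$-patches are identified if they agree up to a translation taking centre to centre. $p(r)$ is the number of distinct $r$-patches. Property C: there is $C>0$ with $p(r)\le Cr^d$ for all sufficiently large $r$. FLAGS AND STABILISERS. $\mathscr{F}_0$ is the set of flags in $\mathscr H_0$, i.e. $f\subseteq\mathscr{H}_0$ with exactly $n$ elements and $\bigcap_{V\in f}V=\{0\}$. For $V\in\mathscr{H}_0$, $\Gamma^V=\{\gamma\in\Gamma:\gamma_<\in V\}$ and $\mathrm{rk}(V)=\mathrm{rk}(\Gamma^V)$ (rank as a free Abelian group). *)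

theory Defs
  imports "HOL-Analysis.Analysis"
begin

section \<open>Free Abelian groups and lattices\<close>

abbreviation zscale :: "int \<Rightarrow> 'a::real_vector \<Rightarrow> 'a"
  where "zscale m x \<equiv> of_int m *\<^sub>R x"

global_interpretation zmod: module "zscale :: int \<Rightarrow> 'a::real_vector \<Rightarrow> 'a"
  by unfold_locales (simp_all add: algebra_simps)

definition z_basis :: "'a::real_vector set \<Rightarrow> 'a set \<Rightarrow> bool"
  where "z_basis B G \<longleftrightarrow> zmod.independent B \<and> zmod.span B = G"

text \<open>Only meaningful for free Abelian groups of finite rank. Every subgroup of a lattice is one.\<close>
definition free_rank :: "'a::real_vector set \<Rightarrow> nat"
  where "free_rank G = card (SOME B. z_basis B G)"

definition full_lattice :: "'a::euclidean_space set \<Rightarrow> bool"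
  where "full_lattice G \<longleftrightarrow> (\<exists>B. independent B \<and> span B = UNIV \<and> zmod.span B = G)"

section \<open>Polytopal sets in a subspace\<close>

text \<open>
  Below, \<open>E\<close> is a linear subspace of a Euclidean space; interior, closure and boundary of subsets
  of \<open>E\<close> are relative to \<open>E\<close>. The ambient inner product only serves to write down the hyperplanes
  and half-spaces of \<open>E\<close>; the opposite half-space arises by negating both \<open>a\<close> and \<open>b\<close>.
\<close>

definition properly_supporting :: "'a::euclidean_space set \<Rightarrow> 'a set \<Rightarrow> 'a set \<Rightarrow> bool"
  where "properly_supporting E W H \<longleftrightarrow>
    (\<exists>a b. a \<in> E \<and> a \<noteq> 0 \<and> H = {x \<in> E. a \<bullet> x = b} \<and>
      (\<exists>w\<in>H. \<exists>U. openin (top_of_set E) U \<and> w \<in> U \<and> W \<inter> U = {x \<in> E. a \<bullet> x \<ge> b} \<inter> U))"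

definition polytopal :: "'a::euclidean_space set \<Rightarrow> 'a set \<Rightarrow> bool"
  where "polytopal E W \<longleftrightarrow>
    W \<subseteq> E \<and> compact W \<and>
    W = top_of_set E closure_of (top_of_set E interior_of W) \<and>
    (\<exists>\<H>. finite \<H> \<and> (\<forall>H\<in>\<H>. properly_supporting E W H) \<and>
          top_of_set E frontier_of W \<subseteq> \<Union>\<H>)"

section \<open>Cut and project schemes\<close>

text \<open>
  The window is \<open>window S\<close>, partitioned into \<open>cell S i\<close> for \<open>i \<in> labels S\<close>.
  An unlabelled scheme is one with a single label, whose cell is the whole window.
\<close>

record ('e, 'l) scheme =
  phys :: "'e set"
  intl :: "'e set"
  lat :: "'e set"
  window :: "'e set"
  labels :: "'l set"
  cell :: "'l \<Rightarrow> 'e set"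

definition proj :: "'a::real_vector set \<Rightarrow> 'a set \<Rightarrow> 'a \<Rightarrow> 'a"
  \<comment> \<open>projection onto \<open>A\<close> along the complementary subspace \<open>B\<close>\<close>
  where "proj A B x = (THE a. a \<in> A \<and> x - a \<in> B)"

definition pr_phys :: "('e::euclidean_space, 'l) scheme \<Rightarrow> 'e \<Rightarrow> 'e"
  where "pr_phys S = proj (phys S) (intl S)"

definition pr_intl :: "('e::euclidean_space, 'l) scheme \<Rightarrow> 'e \<Rightarrow> 'e"
  where "pr_intl S = proj (intl S) (phys S)"

definition polytopal_scheme :: "('e::euclidean_space, 'l) scheme \<Rightarrow> bool"
  where "polytopal_scheme S \<longleftrightarrow>
    subspace (phys S) \<and> subspace (intl S) \<and>
    phys S \<inter> intl S = {0} \<and> {x + y |x y. x \<in> phys S \<and> y \<in> intl S} = UNIV \<and>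
    dim (phys S) \<ge> 1 \<and> dim (intl S) \<ge> 1 \<and>
    full_lattice (lat S) \<and>
    window S \<noteq> {} \<and> polytopal (intl S) (window S) \<and>
    finite (labels S) \<and> window S = (\<Union>i\<in>labels S. cell S i) \<and>
    (\<forall>i\<in>labels S. polytopal (intl S) (cell S i)) \<and>
    (\<forall>i\<in>labels S. \<forall>j\<in>labels S. i \<noteq> j \<longrightarrow>
       cell S i \<inter> cell S j \<subseteq>
         top_of_set (intl S) frontier_of cell S i \<inter> top_of_set (intl S) frontier_of cell S j) \<and>
    inj_on (pr_phys S) (lat S) \<and> inj_on (pr_intl S) (lat S) \<and>
    closure (pr_intl S ` lat S) = intl S \<and>
    (\<forall>g\<in>lat S. \<forall>i\<in>labels S. pr_intl S g \<notin> top_of_set (intl S) frontier_of cell S i)"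

definition star :: "('e::euclidean_space, 'l) scheme \<Rightarrow> 'e \<Rightarrow> 'e"
  where "star S x = pr_intl S (THE g. g \<in> lat S \<and> pr_phys S g = x)"

definition cp_set :: "('e::euclidean_space, 'l) scheme \<Rightarrow> 'e set"
  where "cp_set S = {x \<in> pr_phys S ` lat S. star S x \<in> window S}"

section \<open>Complexity\<close>

definition norm_on :: "'a::real_vector set \<Rightarrow> ('a \<Rightarrow> real) \<Rightarrow> bool"
  where "norm_on E N \<longleftrightarrow>
    (\<forall>x\<in>E. N x \<ge> 0 \<and> (N x = 0 \<longleftrightarrow> x = 0)) \<and>
    (\<forall>x\<in>E. \<forall>c. N (c *\<^sub>R x) = \<bar>c\<bar> * N x) \<and>
    (\<forall>x\<in>E. \<forall>y\<in>E. N (x + y) \<le> N x + N y)"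

definition patch ::
  "('e::euclidean_space, 'l) scheme \<Rightarrow> ('e \<Rightarrow> real) \<Rightarrow> real \<Rightarrow> 'e \<Rightarrow> ('e \<times> 'l) set"
  where "patch S N r x =
    {(y, i). y \<in> cp_set S \<and> N (y - x) \<le> r \<and> i \<in> labels S \<and> star S y \<in> cell S i}"

definition patch_rel ::
  "('e::euclidean_space, 'l) scheme \<Rightarrow> ('e \<Rightarrow> real) \<Rightarrow> real \<Rightarrow> ('e \<times> 'e) set"
  where "patch_rel S N r =
    {(x, y). x \<in> cp_set S \<and> y \<in> cp_set S \<and>
       (\<lambda>(z, i). (z + (y - x), i)) ` patch S N r x = patch S N r y}"

definition patch_classes ::
  "('e::euclidean_space, 'l) scheme \<Rightarrow> ('e \<Rightarrow> real) \<Rightarrow> real \<Rightarrow> 'e set set"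
  where "patch_classes S N r = cp_set S // patch_rel S N r"

text \<open>
  The complexity \<open>p(r)\<close> is the cardinality of \<open>patch_classes S N r\<close>. Finiteness is part of the
  bound, since \<open>card\<close> of an infinite set is \<open>0\<close>.
\<close>
definition property_C :: "('e::euclidean_space, 'l) scheme \<Rightarrow> ('e \<Rightarrow> real) \<Rightarrow> bool"
  where "property_C S N \<longleftrightarrow>
    (\<exists>C>0. \<forall>\<^sub>F r in at_top.
       finite (patch_classes S N r) \<and>
       real (card (patch_classes S N r)) \<le> C * r ^ dim (phys S))"

section \<open>Flags and stabilisers\<close>

definition hyperplanes :: "('e::euclidean_space, 'l) scheme \<Rightarrow> 'e set set"
  where "hyperplanes S = (\<Union>i\<in>labels S. {H. properly_supporting (intl S) (cell S i) H})"

definition hyperplanes0 :: "('e::euclidean_space, 'l) scheme \<Rightarrow> 'e set set"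
  where "hyperplanes0 S = (\<lambda>H. {x - y |x y. x \<in> H \<and> y \<in> H}) ` hyperplanes S"

definition flags0 :: "('e::euclidean_space, 'l) scheme \<Rightarrow> 'e set set set"
  where "flags0 S = {f. f \<subseteq> hyperplanes0 S \<and> finite f \<and> card f = dim (intl S) \<and> \<Inter>f = {0}}"

definition stabiliser :: "('e::euclidean_space, 'l) scheme \<Rightarrow> 'e set \<Rightarrow> 'e set"
  where "stabiliser S V = {g \<in> lat S. pr_intl S g \<in> V}"

definition rk :: "('e::euclidean_space, 'l) scheme \<Rightarrow> 'e set \<Rightarrow> nat"
  where "rk S V = free_rank (stabiliser S V)"

end

theory Submission
  imports Defs
begin

text \<open>
  Write \<open>d\<close> and \<open>n\<close> for the dimensions of physical and internal space, \<open>k = d + n\<close>.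

  If the rank condition holds, the lattice points of a sublattice \<open>\<Gamma>\<^sup>V\<close> in a box that is large in the
  physical and bounded in the internal direction number at least \<open>c r\<^sup>m\<close> with
  \<open>m \<ge> rk V - (n - 1)\<close>, so the relevant translates of a hyperplane parallel to \<open>V\<close> number at most
  \<open>C r\<^sup>e\<close> with \<open>e \<le> k - 1 - rk V\<close>. A patch is determined by the side of each of these translates on
  which its centre lies, after moving the centre slightly to a generic position. By Pajor's lemma the
  number of such sign patterns is at most the number of subfamilies of translates with independent
  normals; each of these extends to a flag, and summing the exponents over a flag gives at most \<open>d\<close>.

  Conversely, for a flag \<open>f\<close> the patches separate the boxes of a grid whose walls are
  small translates of the members of \<open>f\<close>, so property C bounds the size of the grid by \<open>C r\<^sup>d\<close>.
  Since \<open>\<Gamma>\<close> embeds diagonally into the grid positions and already contributes \<open>c r\<^sup>d\<close> of them, the pigeonhole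
  principle shows that \<open>\<Gamma>\<close> has torsion cokernel in the product of the groups \<open>\<Gamma> / \<Gamma>\<^sup>V\<close>. Comparing ranks,
  the sum of \<open>k - rk V\<close> over \<open>f\<close> equals \<open>k\<close>.
\<close>

section \<open>Counting points of sublattices\<close>

text \<open>The obstacle is that the internal projection of \<open>\<Gamma>\<^sup>V\<close> is in
  general not discrete in V, so its rank cannot be read off from V. All groups are therefore kept
  inside the ambient lattice, where the rank of a subgroup is the real dimension of its span, and
  ranks are compared with the growth exponents of point counts in slabs. The rank condition is
  exactly borderline: over a flag, the bounds k - 1 - rk V add up to nk - n - k(n - 1) = d. For the
  converse, the sum of k - rk V over a flag is at least k even without property C, because
  \<open>\<Gamma>\<close> embeds in the product of the quotients; property C supplies the reverse
  inequality. The pigeonhole step reaches only lattice vectors with small internal part. Density of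
  the internal projection carries its conclusion to all of \<open>\<Gamma>\<close>, and torsion of
  the cokernel is used in linear form: certain spans of subgroups add up to the whole space.\<close>

lemma zspan_subset_span: "zmod.span B \<subseteq> span (B::'a::real_vector set)"
proof
  fix x assume "x \<in> zmod.span B"
  then show "x \<in> span B"
    by (induction rule: zmod.span_induct_alt) (auto intro: span_add span_scale span_base span_zero)
qed

lemma zspan_finiteE:
  assumes "finite B" "x \<in> zmod.span (B::'a::real_vector set)"
  obtains u where "x = (\<Sum>b\<in>B. of_int (u b) *\<^sub>R b)"
  using assms zmod.span_finite[of B] by auto

lemma zspan_sumI:
  "(\<Sum>b\<in>B. of_int (u b) *\<^sub>R b) \<in> zmod.span (B::'a::real_vector set)"
  by (intro zmod.span_sum zmod.span_scale zmod.span_base)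

text \<open>The coordinate functionals dual to \<open>B\<close> are bounded, so a norm bound leaves
  only finitely many integer coefficients.\<close>

lemma finite_zspan_ball:
  fixes B :: "'a::euclidean_space set"
  assumes "independent B"
  shows "finite {x \<in> zmod.span B. norm x \<le> r}"
proof -
  have finB: "finite B" using assms by (rule independent_imp_finite)
  have "\<exists>f. linear f \<and> (\<forall>b'\<in>B. f b' = (if b' = b then 1 else 0 :: real))" for b
    using linear_independent_extend[OF assms, of "\<lambda>b'. if b' = b then 1 else 0 :: real"] by blast
  then obtain f where lin: "\<And>b. linear (f b)"
    and f: "\<And>b b'. b' \<in> B \<Longrightarrow> f b b' = (if b' = b then 1 else 0 :: real)" by metis
  have "\<exists>C. \<forall>x. norm (f b x) \<le> C * norm x" for b
    using linear_bounded[OF lin] by blast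
  then obtain C where C: "\<And>b x. norm (f b x) \<le> C b * norm x" by metis
  have "{x \<in> zmod.span B. norm x \<le> r} \<subseteq>
     (\<lambda>u. \<Sum>b\<in>B. of_int (u b) *\<^sub>R b) ` (PiE B (\<lambda>b. {-\<lceil>\<bar>C b\<bar> * \<bar>r\<bar>\<rceil>..\<lceil>\<bar>C b\<bar> * \<bar>r\<bar>\<rceil>}))"
  proof
    fix x assume "x \<in> {x \<in> zmod.span B. norm x \<le> r}"
    then have x: "x \<in> zmod.span B" "norm x \<le> r" by auto
    obtain u where u: "x = (\<Sum>b\<in>B. of_int (u b) *\<^sub>R b)" using zspan_finiteE[OF finB x(1)] by blast
    have fu: "f b x = of_int (u b)" if "b \<in> B" for b
    proof -
      have "f b x = (\<Sum>b'\<in>B. of_int (u b') * f b b')"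
        unfolding u linear_sum[OF lin] by (simp add: linear_cmul[OF lin])
      also have "\<dots> = (\<Sum>b'\<in>B. if b' = b then of_int (u b) else 0)"
        by (rule sum.cong) (auto simp: f)
      finally show ?thesis using that finB by simp
    qed
    have *: "\<bar>of_int (u b)\<bar> \<le> \<bar>C b\<bar> * \<bar>r\<bar>" if "b \<in> B" for b
    proof -
      have "\<bar>of_int (u b)\<bar> = norm (f b x)" using fu[OF that] by simp
      also have "\<dots> \<le> C b * norm x" by (rule C)
      also have "\<dots> \<le> \<bar>C b\<bar> * \<bar>r\<bar>" using x(2) by (intro mult_mono) auto
      finally show ?thesis by simp
    qed
    have "u b \<in> {-\<lceil>\<bar>C b\<bar> * \<bar>r\<bar>\<rceil>..\<lceil>\<bar>C b\<bar> * \<bar>r\<bar>\<rceil>}" if "b \<in> B" for b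
      using that[THEN *] unfolding atLeastAtMost_iff abs_le_iff by linarith
    then have "restrict u B \<in> PiE B (\<lambda>b. {-\<lceil>\<bar>C b\<bar> * \<bar>r\<bar>\<rceil>..\<lceil>\<bar>C b\<bar> * \<bar>r\<bar>\<rceil>})"
      by auto
    moreover have "x = (\<Sum>b\<in>B. of_int (restrict u B b) *\<^sub>R b)" unfolding u by (rule sum.cong) auto
    ultimately show "x \<in> (\<lambda>u. \<Sum>b\<in>B. of_int (u b) *\<^sub>R b) ` (PiE B (\<lambda>b. {-\<lceil>\<bar>C b\<bar> * \<bar>r\<bar>\<rceil>..\<lceil>\<bar>C b\<bar> * \<bar>r\<bar>\<rceil>}))"
      by blast
  qed
  then show ?thesis by (rule finite_subset) (intro finite_imageI finite_PiE finB; simp)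
qed

lemma card_le_fibre_bound:
  assumes "finite X" "finite Y" "f ` X \<subseteq> Y"
    and "\<And>y. y \<in> Y \<Longrightarrow> card {x \<in> X. f x = y} \<le> M"
  shows "card X \<le> M * card Y"
proof -
  have "card X = (\<Sum>y\<in>Y. card {x \<in> X. f x = y})"
    using sum.group[OF assms(1,2,3), of "\<lambda>_. 1::nat"] by simp
  also have "\<dots> \<le> (\<Sum>y\<in>Y. M)" by (rule sum_mono) (rule assms(4))
  finally show ?thesis by (simp add: mult.commute)
qed

text \<open>In the slab only the directions of \<open>span B\<close> killed by \<open>T\<close> are
  unbounded, so only they contribute to the growth. Points are sorted by the integer parts of their
  coordinates in these directions; each class has bounded diameter and hence boundedly many lattice
  points.\<close>

lemma count_upper:
  fixes B :: "'a::euclidean_space set" and T :: "'a \<Rightarrow> 'b::euclidean_space"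
  assumes "independent B" "linear T"
  shows "\<exists>C>0. \<forall>r\<ge>1. real (card {x \<in> zmod.span B. norm x \<le> r \<and> norm (T x) \<le> c})
     \<le> C * r ^ dim (span B \<inter> {x. T x = 0})"
proof -
  define K where "K = span B \<inter> {x. T x = 0}"
  have sub: "subspace K" unfolding K_def
    by (intro subspace_inter subspace_span linear_subspace_kernel assms)
  obtain Q where Q: "Q \<subseteq> K" "pairwise orthogonal Q" "\<And>x. x \<in> Q \<Longrightarrow> norm x = 1"
    "independent Q" "card Q = dim K" "span Q = K"
    using orthonormal_basis_subspace[OF sub] by metis
  have finO: "finite Q" using Q(4) by (rule independent_imp_finite)
  \<comment> \<open>\<open>F\<close> is the orthogonal projection onto \<open>K\<close>. A vector of
    \<open>span B\<close> killed by \<open>T\<close> lies in \<open>K\<close>, so \<open>F\<close>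
    and \<open>T\<close> together are injective on \<open>span B\<close> and bounded below
    there.\<close>
  define F where "F x = (\<Sum>v\<in>Q. (x \<bullet> v) *\<^sub>R v)" for x
  have linF: "linear F" unfolding F_def
    by (rule linearI) (simp_all add: inner_add_left scaleR_add_left sum.distrib scaleR_sum_right)
  have "bounded_linear (\<lambda>x. (F x, T x))"
    using linF assms(2) by (intro bounded_linear_Pair) (auto simp: linear_conv_bounded_linear)
  moreover have "x = 0" if "x \<in> span B" "(F x, T x) = 0" for x
  proof -
    have FT: "F x = 0" "T x = 0" using that(2) by (auto simp: zero_prod_def)
    have "0 = F x \<bullet> x" using FT by simp
    also have "\<dots> = (\<Sum>v\<in>Q. (x \<bullet> v)\<^sup>2)"
      unfolding F_def inner_sum_left by (simp add: inner_commute power2_eq_square)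
    finally have "\<forall>v\<in>Q. (x \<bullet> v)\<^sup>2 = 0"
      using finO by (simp add: sum_nonneg_eq_0_iff)
    then have *: "\<And>v. v \<in> Q \<Longrightarrow> orthogonal x v" by (auto simp: orthogonal_def)
    have "x \<in> span Q" using that FT Q(6) K_def by auto
    then have "orthogonal x x" using * orthogonal_to_span by blast
    then show "x = 0" by (simp add: orthogonal_def)
  qed
  ultimately obtain e where e: "e > 0" "\<And>x. x \<in> span B \<Longrightarrow> norm (F x, T x) \<ge> e * norm x"
    using injective_imp_isometric[of "span B" "\<lambda>x. (F x, T x)"] closed_subspace[OF subspace_span, of B]
      subspace_span by metis
  \<comment> \<open>In one class each coordinate along \<open>K\<close> varies by at most 1 and
    \<open>T\<close> by at most \<open>2 * \<bar>c\<bar>\<close>; dividing by the lower bound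
    \<open>e\<close> gives the diameter.\<close>
  define R where "R = (real (card Q) + 2 * \<bar>c\<bar>) / e"
  define M where "M = card {x \<in> zmod.span B. norm x \<le> R}"
  have close: "norm (x - y) \<le> R"
    if "x \<in> zmod.span B" "y \<in> zmod.span B" "norm (T x) \<le> c" "norm (T y) \<le> c"
      "\<And>v. v \<in> Q \<Longrightarrow> \<lfloor>x \<bullet> v\<rfloor> = \<lfloor>y \<bullet> v\<rfloor>" for x y
  proof -
    have "norm (F (x - y)) \<le> (\<Sum>v\<in>Q. norm (((x - y) \<bullet> v) *\<^sub>R v))"
      unfolding F_def by (rule norm_sum)
    also have "\<dots> \<le> (\<Sum>v\<in>Q. 1)"
    proof (rule sum_mono)
      fix v assume v: "v \<in> Q"
      have "\<bar>x \<bullet> v - y \<bullet> v\<bar> \<le> 1" using that(5)[OF v] by linarith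
      then show "norm (((x - y) \<bullet> v) *\<^sub>R v) \<le> 1" using Q(3)[OF v] by (simp add: inner_diff_left)
    qed
    finally have 1: "norm (F (x - y)) \<le> real (card Q)" by simp
    have 2: "norm (T (x - y)) \<le> 2 * \<bar>c\<bar>"
      using that(3,4) norm_triangle_ineq4[of "T x" "T y"] by (simp add: linear_diff[OF assms(2)])
    have "x - y \<in> span B" using that(1,2) zspan_subset_span[of B] by (blast intro: span_diff)
    then have "e * norm (x - y) \<le> norm (F (x - y), T (x - y))" by (rule e(2))
    also have "\<dots> \<le> norm (F (x - y)) + norm (T (x - y))" by (rule norm_Pair_le)
    finally have "e * norm (x - y) \<le> real (card Q) + 2 * \<bar>c\<bar>" using 1 2 by linarith
    then show ?thesis unfolding R_def using e(1) by (simp add: field_simps)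
  qed
  have main: "real (card {x \<in> zmod.span B. norm x \<le> r \<and> norm (T x) \<le> c}) \<le> (real M * 5 ^ dim K) * r ^ dim K"
    if r: "r \<ge> 1" for r
  proof -
    define X where "X = {x \<in> zmod.span B. norm x \<le> r \<and> norm (T x) \<le> c}"
    define key where "key x = restrict (\<lambda>v. \<lfloor>x \<bullet> v\<rfloor>) Q" for x
    define Y where "Y = PiE Q (\<lambda>_. {-\<lceil>r\<rceil>..\<lceil>r\<rceil>})"
    have finX: "finite X" unfolding X_def
      by (rule finite_subset[OF _ finite_zspan_ball[OF assms(1), of r]]) auto
    have finY: "finite Y" unfolding Y_def by (rule finite_PiE[OF finO]) simp
    have "key x \<in> Y" if "x \<in> X" for x
    proof -
      have "\<lfloor>x \<bullet> v\<rfloor> \<in> {-\<lceil>r\<rceil>..\<lceil>r\<rceil>}" if v: "v \<in> Q" for v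
      proof -
        have "\<bar>x \<bullet> v\<bar> \<le> r"
          using Cauchy_Schwarz_ineq2[of x v] Q(3)[OF v] \<open>x \<in> X\<close> unfolding X_def by simp
        then have "- r \<le> x \<bullet> v" "x \<bullet> v \<le> r" by auto
        then show ?thesis
          unfolding atLeastAtMost_iff by linarith
      qed
      then show ?thesis unfolding Y_def key_def by auto
    qed
    then have sub: "key ` X \<subseteq> Y" by blast
    have fib: "card {x \<in> X. key x = y} \<le> M" for y
    proof (cases "{x \<in> X. key x = y} = {}")
      case False
      then obtain z where z: "z \<in> X" "key z = y" by blast
      have "(\<lambda>x. x - z) ` {x \<in> X. key x = y} \<subseteq> {x \<in> zmod.span B. norm x \<le> R}"
      proof safe
        fix x assume x: "x \<in> X" "y = key x"
        show "x - z \<in> zmod.span B" using x z zmod.span_diff unfolding X_def by auto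
        have "key x = key z" using x z by simp
        then have "\<And>v. v \<in> Q \<Longrightarrow> \<lfloor>x \<bullet> v\<rfloor> = \<lfloor>z \<bullet> v\<rfloor>" unfolding key_def by (metis restrict_apply')
        then show "norm (x - z) \<le> R" using x z close[of x z] unfolding X_def by auto
      qed
      then show ?thesis unfolding M_def
        by (rule card_inj_on_le[rotated]) (auto intro: finite_zspan_ball[OF assms(1)] inj_onI)
    next
      case True
      then show ?thesis by (simp only: card.empty le0)
    qed
    have "card X \<le> M * card Y" by (rule card_le_fibre_bound[OF finX finY sub fib])
    also have "card Y = nat (2 * \<lceil>r\<rceil> + 1) ^ dim K"
      unfolding Y_def by (simp add: card_PiE[OF finO] Q(5) algebra_simps)
    finally have "real (card X) \<le> real M * real (nat (2 * \<lceil>r\<rceil> + 1)) ^ dim K"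
      by (metis of_nat_le_iff of_nat_mult of_nat_power)
    also have "\<dots> \<le> real M * (5 * r) ^ dim K"
    proof -
      \<comment> \<open>The 5 comes from 2 \<lceil>r\<rceil> + 1 \<le> 2 r + 3 \<le> 5 r for r \<ge>
        1.\<close>
      have "real (nat (2 * \<lceil>r\<rceil> + 1)) \<le> 5 * r" using r by linarith
      then show ?thesis by (intro mult_left_mono power_mono) auto
    qed
    finally show ?thesis unfolding X_def by (simp add: power_mult_distrib mult_ac)
  qed
  show ?thesis
  proof (intro exI conjI allI impI)
    show "real M * 5 ^ dim K + 1 > 0" by (simp add: add_nonneg_pos)
    fix r :: real assume r: "r \<ge> 1"
    have "real (card {x \<in> zmod.span B. norm x \<le> r \<and> norm (T x) \<le> c}) \<le> (real M * 5 ^ dim K) * r ^ dim K"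
      by (rule main[OF r])
    also have "\<dots> \<le> (real M * 5 ^ dim K + 1) * r ^ dim K" using r by (intro mult_right_mono) auto
    finally show "real (card {x \<in> zmod.span B. norm x \<le> r \<and> norm (T x) \<le> c})
      \<le> (real M * 5 ^ dim K + 1) * r ^ dim (span B \<inter> {x. T x = 0})" unfolding K_def .
  qed
qed

lemma zspan_round:
  fixes B :: "'a::real_normed_vector set"
  assumes "finite B" "x \<in> span B"
  obtains g where "g \<in> zmod.span B" "norm (x - g) \<le> (\<Sum>b\<in>B. norm b)"
proof -
  obtain u where u: "x = (\<Sum>b\<in>B. u b *\<^sub>R b)" using assms span_finite[of B] by auto
  define g where "g = (\<Sum>b\<in>B. of_int \<lfloor>u b\<rfloor> *\<^sub>R b)"
  have "norm (x - g) = norm (\<Sum>b\<in>B. frac (u b) *\<^sub>R b)"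
    unfolding u g_def frac_def by (simp add: scaleR_diff_left sum_subtractf)
  also have "\<dots> \<le> (\<Sum>b\<in>B. norm (frac (u b) *\<^sub>R b))" by (rule norm_sum)
  also have "\<dots> \<le> (\<Sum>b\<in>B. norm b)"
  proof (rule sum_mono)
    fix b
    have "\<bar>frac (u b)\<bar> \<le> 1" using frac_ge_0[of "u b"] frac_lt_1[of "u b"] by linarith
    then show "norm (frac (u b) *\<^sub>R b) \<le> norm b" by (simp add: mult_left_le_one_le)
  qed
  finally show ?thesis using that[of g] zspan_sumI g_def by metis
qed

text \<open>Points of a coarse cubic grid in the kernel directions are rounded to lattice points.
  Rounding moves a point by at most \<open>D\<close>, so a spacing above \<open>2 * D\<close> keeps
  the images distinct, while \<open>T\<close>, zero on the grid, stays bounded on them. The slab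
  width is an output of the argument; \<open>count_lower_small\<close> makes it arbitrary.\<close>

lemma count_lower:
  fixes B :: "'a::euclidean_space set" and T :: "'a \<Rightarrow> 'b::euclidean_space"
  assumes "independent B" "linear T"
  shows "\<exists>c C r0. C > 0 \<and> (\<forall>r\<ge>r0. C * r ^ dim (span B \<inter> {x. T x = 0}) \<le>
     real (card {x \<in> zmod.span B. norm x \<le> r \<and> norm (T x) \<le> c}))"
proof -
  define K where "K = span B \<inter> {x. T x = 0}"
  have sub: "subspace K" unfolding K_def
    by (intro subspace_inter subspace_span linear_subspace_kernel assms)
  obtain Q where Q: "Q \<subseteq> K" "pairwise orthogonal Q" "\<And>x. x \<in> Q \<Longrightarrow> norm x = 1"
    "independent Q" "card Q = dim K" "span Q = K"
    using orthonormal_basis_subspace[OF sub] by metis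
  have finQ: "finite Q" using Q(4) by (rule independent_imp_finite)
  have finB: "finite B" using assms(1) by (rule independent_imp_finite)
  define D where "D = (\<Sum>b\<in>B. norm b)"
  have D0: "D \<ge> 0" unfolding D_def by (simp add: sum_nonneg)
  have "\<exists>g. x \<in> span B \<longrightarrow> g \<in> zmod.span B \<and> norm (x - g) \<le> D" for x
    unfolding D_def using zspan_round[OF finB] by metis
  then obtain \<rho> where \<rho>: "\<And>x. x \<in> span B \<Longrightarrow> \<rho> x \<in> zmod.span B"
    "\<And>x. x \<in> span B \<Longrightarrow> norm (x - \<rho> x) \<le> D" by metis
  obtain CT where CT: "CT > 0" "\<And>x. norm (T x) \<le> norm x * CT"
    using bounded_linear.pos_bounded[of T] assms(2) by (auto simp: linear_conv_bounded_linear)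
  define s where "s = 2 * D + 1"
  have s: "s > 0" "s > 2 * D" using D0 unfolding s_def by auto
  define pt where "pt u = (\<Sum>v\<in>Q. (s * real (u v)) *\<^sub>R v)" for u :: "'a \<Rightarrow> nat"
  have ptK: "pt u \<in> K" for u
    unfolding pt_def by (intro subspace_sum subspace_scale sub) (use Q(1) in auto)
  have inner: "pt u \<bullet> v = s * real (u v)" if v: "v \<in> Q" for u v
  proof -
    have "pt u \<bullet> v = (\<Sum>w\<in>Q. s * real (u w) * (w \<bullet> v))" unfolding pt_def by (simp add: inner_sum_left)
    also have "\<dots> = (\<Sum>w\<in>Q. if w = v then s * real (u v) else 0)"
    proof (rule sum.cong[OF refl])
      fix w assume w: "w \<in> Q"
      show "s * real (u w) * (w \<bullet> v) = (if w = v then s * real (u v) else 0)"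
        using Q(2) Q(3)[OF v] v w unfolding pairwise_def orthogonal_def
        by (auto simp: dot_square_norm)
    qed
    also have "\<dots> = s * real (u v)" using v finQ by simp
    finally show ?thesis .
  qed
  \<comment> \<open>Grid points with \<open>n\<close> steps per direction have norm at most
    \<open>n * s * dim K\<close>; the extra 1 keeps \<open>a\<close> positive when \<open>K\<close>
    is trivial.\<close>
  define a where "a = s * (real (dim K) + 1)"
  have a: "a > 0" unfolding a_def using s by simp
  have main: "(1 / (2 * a)) ^ dim K * r ^ dim K \<le>
     real (card {x \<in> zmod.span B. norm x \<le> r \<and> norm (T x) \<le> D * CT})"
    if r: "r \<ge> 2 * (D + a)" for r
  proof -
    have "0 \<le> 2 * (D + a)" using D0 a by simp
    then have r0: "r \<ge> 0" using r by linarith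
    \<comment> \<open>For \<open>r \<ge> 2 * (D + a)\<close>, subtracting \<open>D\<close> and
      rounding down together cost at most half, so \<open>n \<ge> r / (2 * a)\<close>.\<close>
    define n where "n = nat \<lfloor>(r - D) / a\<rfloor>"
    have rD: "(r - D) / a \<ge> 0" using r D0 a by simp
    have n1: "real n \<le> (r - D) / a" unfolding n_def using rD by simp
    have "real n \<ge> (r - D) / a - 1" unfolding n_def using rD by linarith
    moreover have "(r - D) / a - 1 \<ge> r / (2 * a)" using r a by (simp add: field_simps)
    ultimately have n2: "real n \<ge> r / (2 * a)" by linarith
    have na: "real n * a \<le> r - D" using n1 a by (simp add: field_simps)
    define U where "U = PiE Q (\<lambda>_. {..<n})"
    have inj: "inj_on (\<lambda>u. \<rho> (pt u)) U"
    proof (rule inj_onI, rule ccontr)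
      fix u u' assume u: "u \<in> U" "u' \<in> U" "\<rho> (pt u) = \<rho> (pt u')" "u \<noteq> u'"
      then obtain v where v: "v \<in> Q" "u v \<noteq> u' v" unfolding U_def by (meson PiE_ext)
      have "pt u \<in> span B" "pt u' \<in> span B" using ptK K_def by auto
      then have "norm (pt u - \<rho> (pt u)) \<le> D" "norm (pt u' - \<rho> (pt u)) \<le> D"
        using \<rho>(2)[of "pt u"] \<rho>(2)[of "pt u'"] u(3) by auto
      then have "norm (pt u - pt u') \<le> 2 * D"
        using norm_triangle_ineq4[of "pt u - \<rho> (pt u)" "pt u' - \<rho> (pt u)"] by simp
      moreover have "\<bar>(pt u - pt u') \<bullet> v\<bar> \<le> norm (pt u - pt u')"
        using Cauchy_Schwarz_ineq2[of "pt u - pt u'" v] Q(3)[OF v(1)] by simp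
      moreover have "(pt u - pt u') \<bullet> v = s * (real (u v) - real (u' v))"
        using inner[OF v(1)] by (simp add: inner_diff_left right_diff_distrib)
      moreover have "s * 1 \<le> s * \<bar>real (u v) - real (u' v)\<bar>"
        using s(1) v(2) by (intro mult_left_mono) linarith+
      ultimately show False using s by (simp add: abs_mult)
    qed
    have sub: "(\<lambda>u. \<rho> (pt u)) ` U \<subseteq> {x \<in> zmod.span B. norm x \<le> r \<and> norm (T x) \<le> D * CT}"
    proof safe
      fix u assume u: "u \<in> U"
      have ps: "pt u \<in> span B" "T (pt u) = 0" using ptK[of u] K_def by auto
      show "\<rho> (pt u) \<in> zmod.span B" using \<rho>(1) ps by simp
      have d: "norm (pt u - \<rho> (pt u)) \<le> D" using \<rho>(2) ps by simp
      have "norm (pt u) \<le> (\<Sum>v\<in>Q. norm ((s * real (u v)) *\<^sub>R v))" unfolding pt_def by (rule norm_sum)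
      also have "\<dots> \<le> (\<Sum>v\<in>Q. s * real n)"
      proof (rule sum_mono)
        fix v assume v: "v \<in> Q"
        have "u v < n" using u v unfolding U_def by auto
        then show "norm ((s * real (u v)) *\<^sub>R v) \<le> s * real n" using Q(3)[OF v] s(1) by simp
      qed
      also have "\<dots> = real n * (s * real (dim K))" using Q(5) by simp
      also have "\<dots> \<le> real n * a" unfolding a_def using s(1) by (intro mult_left_mono) auto
      finally have "norm (pt u) \<le> r - D" using na by linarith
      then show "norm (\<rho> (pt u)) \<le> r" using d norm_triangle_ineq4[of "pt u" "pt u - \<rho> (pt u)"] by simp
      have "T (\<rho> (pt u)) = - T (pt u - \<rho> (pt u))" using ps by (simp add: linear_diff[OF assms(2)])
      then have "norm (T (\<rho> (pt u))) \<le> norm (pt u - \<rho> (pt u)) * CT" using CT(2) by (metis norm_minus_cancel)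
      also have "\<dots> \<le> D * CT" using d CT(1) by (intro mult_right_mono) auto
      finally show "norm (T (\<rho> (pt u))) \<le> D * CT" .
    qed
    have "card U \<le> card {x \<in> zmod.span B. norm x \<le> r \<and> norm (T x) \<le> D * CT}"
      by (rule card_inj_on_le[OF inj sub])
        (rule finite_subset[OF _ finite_zspan_ball[OF assms(1), of r]], auto)
    moreover have "card U = n ^ dim K" unfolding U_def by (simp add: card_PiE[OF finQ] Q(5))
    ultimately have "n ^ dim K \<le> card {x \<in> zmod.span B. norm x \<le> r \<and> norm (T x) \<le> D * CT}"
      by simp
    then have "real (n ^ dim K) \<le> real (card {x \<in> zmod.span B. norm x \<le> r \<and> norm (T x) \<le> D * CT})"
      by (rule of_nat_mono)
    then have "real n ^ dim K \<le> real (card {x \<in> zmod.span B. norm x \<le> r \<and> norm (T x) \<le> D * CT})"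
      by (simp only: of_nat_power)
    moreover have "(r / (2 * a)) ^ dim K \<le> real n ^ dim K"
      using n2 r0 a by (intro power_mono) auto
    ultimately have "(r / (2 * a)) ^ dim K \<le>
        real (card {x \<in> zmod.span B. norm x \<le> r \<and> norm (T x) \<le> D * CT})"
      by (rule order_trans[rotated])
    moreover have "(1 / (2 * a)) ^ dim K * r ^ dim K = (r / (2 * a)) ^ dim K"
      by (simp flip: power_mult_distrib)
    ultimately show ?thesis by (simp only:)
  qed
  have "(1 / (2 * a)) ^ dim K > 0" using a by simp
  then show ?thesis unfolding K_def[symmetric] using main by blast
qed

text \<open>Pigeonhole on differences: the values of \<open>T\<close> on a wide slab fall into
  finitely many balls of radius \<open>\<epsilon> / 2\<close>, and subtracting a fixed point
  belonging to the same ball leads into the narrow slab. The wide slab has radius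
  \<open>r / 2\<close> so that differences have norm at most \<open>r\<close>.\<close>

lemma count_lower_small:
  fixes B :: "'a::euclidean_space set" and T :: "'a \<Rightarrow> 'b::euclidean_space"
  assumes "independent B" "linear T" "\<epsilon> > 0"
  shows "\<exists>C r0. C > 0 \<and> (\<forall>r\<ge>r0. C * r ^ dim (span B \<inter> {x. T x = 0}) \<le>
     real (card {x \<in> zmod.span B. norm x \<le> r \<and> norm (T x) \<le> \<epsilon>}))"
proof -
  define m where "m = dim (span B \<inter> {x. T x = 0})"
  obtain c C r0 where C: "C > 0" "\<And>r. r \<ge> r0 \<Longrightarrow> C * r ^ m \<le>
     real (card {x \<in> zmod.span B. norm x \<le> r \<and> norm (T x) \<le> c})"
    using count_lower[OF assms(1,2)] unfolding m_def by blast
  have "\<forall>e>0. \<exists>F. finite F \<and> cball (0::'b) c \<subseteq> (\<Union>y\<in>F. ball y e)"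
    using compact_cball[of "0::'b" c] unfolding compact_eq_totally_bounded by (rule conjunct2)
  then have "\<exists>F. finite F \<and> cball (0::'b) c \<subseteq> (\<Union>y\<in>F. ball y (\<epsilon> / 2))"
    using half_gt_zero[OF assms(3)] by simp
  then obtain F where F: "finite F" "cball (0::'b) c \<subseteq> (\<Union>y\<in>F. ball y (\<epsilon> / 2))"
    by (elim exE conjE)
  have fin: "finite {x \<in> zmod.span B. norm x \<le> r \<and> P x}" for r P
    by (rule finite_subset[OF _ finite_zspan_ball[OF assms(1), of r]]) auto
  have main: "C / (2 ^ m * real (card F + 1)) * r ^ m \<le>
     real (card {x \<in> zmod.span B. norm x \<le> r \<and> norm (T x) \<le> \<epsilon>})" if r: "r \<ge> 2 * r0" for r
  proof -
    define Z where "Z = {x \<in> zmod.span B. norm x \<le> r \<and> norm (T x) \<le> \<epsilon>}"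
    define X where "X = {x \<in> zmod.span B. norm x \<le> r / 2 \<and> norm (T x) \<le> c}"
    define Xy where "Xy y = {x \<in> X. T x \<in> ball y (\<epsilon> / 2)}" for y
    have "card (Xy y) \<le> card Z" for y
    proof (cases "Xy y = {}")
      case False
      then obtain z where z: "z \<in> Xy y" by blast
      have "(\<lambda>x. x - z) ` Xy y \<subseteq> Z"
      proof safe
        fix x assume x: "x \<in> Xy y"
        have "norm (x - z) \<le> norm x + norm z" by (rule norm_triangle_ineq4)
        moreover have "norm x \<le> r / 2" "norm z \<le> r / 2" using x z unfolding Xy_def X_def by auto
        moreover have "dist (T x) (T z) < \<epsilon>"
          using x z dist_triangle_half_r[of y "T x" \<epsilon> "T z"] unfolding Xy_def by auto
        moreover have "x - z \<in> zmod.span B"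
          using x z unfolding Xy_def X_def by (auto intro: zmod.span_diff)
        ultimately show "x - z \<in> Z" unfolding Z_def by (simp add: linear_diff[OF assms(2)] dist_norm)
      qed
      then show ?thesis
        by (rule card_inj_on_le[rotated]) (auto simp: Z_def intro: fin inj_onI)
    next
      case True
      then show ?thesis by (simp only: card.empty le0)
    qed
    then have "(\<Sum>y\<in>F. card (Xy y)) \<le> (\<Sum>y\<in>F. card Z)" by (intro sum_mono) simp
    then have "(\<Sum>y\<in>F. card (Xy y)) \<le> card F * card Z" by simp
    moreover have "card X \<le> card (\<Union>y\<in>F. Xy y)"
    proof (rule card_mono)
      show "finite (\<Union>y\<in>F. Xy y)" unfolding Xy_def X_def using fin[of "r/2"] F(1) by auto
      show "X \<subseteq> (\<Union>y\<in>F. Xy y)"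
      proof
        fix x assume x: "x \<in> X"
        then have "T x \<in> cball 0 c" unfolding X_def by auto
        then show "x \<in> (\<Union>y\<in>F. Xy y)" using F(2) x unfolding Xy_def by blast
      qed
    qed
    moreover have "card (\<Union>y\<in>F. Xy y) \<le> (\<Sum>y\<in>F. card (Xy y))" by (rule card_UN_le[OF F(1)])
    ultimately have "card X \<le> (card F + 1) * card Z" by simp
    then have "real (card X) \<le> real ((card F + 1) * card Z)" by (rule of_nat_mono)
    then have "real (card X) \<le> real (card F + 1) * real (card Z)" by (simp only: of_nat_mult)
    moreover have "C * (r / 2) ^ m \<le> real (card X)" unfolding X_def using r by (intro C(2)) simp
    ultimately have "C * (r / 2) ^ m \<le> real (card F + 1) * real (card Z)" by linarith
    then have le: "C * r ^ m \<le> real (card Z) * (2 ^ m * real (card F + 1))"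
      by (simp add: power_divide field_simps)
    have "0 < 2 ^ m * real (card F + 1)" by simp
    then have "C * r ^ m / (2 ^ m * real (card F + 1)) \<le> real (card Z)"
      using le by (simp only: pos_divide_le_eq)
    then show ?thesis unfolding Z_def[symmetric] by (simp only: times_divide_eq_left)
  qed
  have "C / (2 ^ m * real (card F + 1)) > 0" using C by simp
  then show ?thesis unfolding m_def[symmetric] using main by blast
qed

text \<open>Adding the slab points of the subgroup to one representative per value of
  \<open>q\<close> gives distinct points of a slab of doubled radius; dividing the upper bound for
  \<open>B\<close> by the lower bound for \<open>B'\<close> leaves the difference of exponents. With
  \<open>T\<close> the internal projection this counts translates of a hyperplane, with
  \<open>T\<close> zero elements of a quotient group.\<close>

lemma count_cosets:
  fixes B :: "'a::euclidean_space set" and T :: "'a \<Rightarrow> 'b::euclidean_space" and q :: "'a \<Rightarrow> 'c"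
  assumes B: "independent B" and T: "linear T" and B': "independent B'"
    and sub: "zmod.span B' \<subseteq> zmod.span B"
    and q: "\<And>x g. x \<in> zmod.span B \<Longrightarrow> g \<in> zmod.span B' \<Longrightarrow> q (x + g) = q x"
  shows "\<exists>C r0. C > 0 \<and> (\<forall>r\<ge>r0. 
     real (card (q ` {x \<in> zmod.span B. norm x \<le> r \<and> norm (T x) \<le> c})) \<le>
     C * r ^ (dim (span B \<inter> {x. T x = 0}) - dim (span B' \<inter> {x. T x = 0})))"
proof -
  define m m' where "m = dim (span B \<inter> {x. T x = 0})" and "m' = dim (span B' \<inter> {x. T x = 0})"
  have "span B' \<subseteq> span B"
    by (metis sub zspan_subset_span span_minimal subspace_span zmod.span_superset order_trans)
  then have mm: "m' \<le> m" unfolding m_def m'_def by (intro dim_subset) auto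
  obtain c0 C1 r1 where C1: "C1 > 0" "\<And>r. r \<ge> r1 \<Longrightarrow> C1 * r ^ m' \<le>
     real (card {x \<in> zmod.span B'. norm x \<le> r \<and> norm (T x) \<le> c0})"
    using count_lower[OF B' T] unfolding m'_def by blast
  obtain C2 where C2: "C2 > 0" "\<And>r. r \<ge> 1 \<Longrightarrow>
     real (card {x \<in> zmod.span B. norm x \<le> r \<and> norm (T x) \<le> c + c0}) \<le> C2 * r ^ m"
    using count_upper[OF B T] unfolding m_def by blast
  have main: "real (card (q ` {x \<in> zmod.span B. norm x \<le> r \<and> norm (T x) \<le> c})) \<le>
     (C2 * 2 ^ m / C1) * r ^ (m - m')" if r: "r \<ge> max 1 r1" for r
  proof -
    define X where "X = {x \<in> zmod.span B. norm x \<le> r \<and> norm (T x) \<le> c}"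
    define G where "G = {x \<in> zmod.span B'. norm x \<le> r \<and> norm (T x) \<le> c0}"
    define Y where "Y = {x \<in> zmod.span B. norm x \<le> 2 * r \<and> norm (T x) \<le> c + c0}"
    define rep where "rep = inv_into X q"
    have rep: "rep v \<in> X" "q (rep v) = v" if "v \<in> q ` X" for v
      using that unfolding rep_def by (auto intro: inv_into_into f_inv_into_f)
    have finY: "finite Y" unfolding Y_def
      by (rule finite_subset[OF _ finite_zspan_ball[OF B, of "2 * r"]]) auto
    have inj: "inj_on (\<lambda>(v, g). rep v + g) (q ` X \<times> G)"
    proof (rule inj_onI, clarify)
      fix x g x' g' assume *: "x \<in> X" "x' \<in> X" "g \<in> G" "g' \<in> G" "rep (q x) + g = rep (q x') + g'"
      have inv: "q (rep (q y) + h) = q y" if "y \<in> X" "h \<in> G" for y h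
      proof -
        have "rep (q y) \<in> X" "q (rep (q y)) = q y" using rep that by blast+
        moreover have "h \<in> zmod.span B'" using that unfolding G_def by simp
        ultimately show ?thesis using q[of "rep (q y)" h] unfolding X_def by simp
      qed
      have "q (rep (q x) + g) = q x" "q (rep (q x') + g') = q x'" using * inv by blast+
      then have "q x = q x'" using *(5) by simp
      then show "q x = q x' \<and> g = g'" using *(5) by simp
    qed
    have "(\<lambda>(v, g). rep v + g) ` (q ` X \<times> G) \<subseteq> Y"
    proof clarify
      fix x g assume *: "x \<in> X" "g \<in> G"
      have x: "rep (q x) \<in> X" using rep * by blast
      have "rep (q x) + g \<in> zmod.span B" using x * sub unfolding X_def G_def
        by (auto intro: zmod.span_add)
      moreover have "norm (rep (q x) + g) \<le> 2 * r"
        using x * norm_triangle_ineq[of "rep (q x)" g] unfolding X_def G_def by auto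
      moreover have "norm (T (rep (q x) + g)) \<le> c + c0"
        using x * norm_triangle_ineq[of "T (rep (q x))" "T g"] unfolding X_def G_def linear_add[OF T] by auto
      ultimately show "rep (q x) + g \<in> Y" unfolding Y_def by auto
    qed
    then have "card (q ` X \<times> G) \<le> card Y" by (rule card_inj_on_le[OF inj _ finY])
    then have "real (card (q ` X \<times> G)) \<le> real (card Y)" by (rule of_nat_mono)
    then have "real (card (q ` X)) * real (card G) \<le> real (card Y)"
      by (simp only: card_cartesian_product of_nat_mult)
    moreover have "real (card (q ` X)) * (C1 * r ^ m') \<le> real (card (q ` X)) * real (card G)"
      unfolding G_def using r by (intro mult_left_mono C1(2)) auto
    moreover have "real (card Y) \<le> C2 * (2 * r) ^ m" unfolding Y_def using r by (intro C2(2)) auto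
    ultimately have le: "real (card (q ` X)) * (C1 * r ^ m') \<le> C2 * (2 * r) ^ m" by linarith
    have "r ^ m = r ^ (m - m') * r ^ m'" using mm by (simp flip: power_add)
    then have "(real (card (q ` X)) * C1) * r ^ m' \<le> (C2 * 2 ^ m * r ^ (m - m')) * r ^ m'"
      using le by (simp add: power_mult_distrib mult_ac)
    moreover have "r ^ m' > 0" using r by simp
    ultimately have "real (card (q ` X)) * C1 \<le> C2 * 2 ^ m * r ^ (m - m')"
      by (rule mult_right_le_imp_le)
    then show ?thesis unfolding X_def[symmetric] using C1(1) by (simp add: field_simps)
  qed
  have pos: "C2 * 2 ^ m / C1 > 0" using C1 C2 by simp
  show ?thesis unfolding m_def[symmetric] m'_def[symmetric]
    by (intro exI conjI allI impI, rule pos, rule main, assumption)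
qed

section \<open>Ranks of sublattices\<close>

lemma power_growth_le:
  fixes c C r0 :: real
  assumes "c > 0" "\<And>r. r \<ge> r0 \<Longrightarrow> c * r ^ a \<le> C * r ^ b"
  shows "a \<le> b"
proof (rule ccontr)
  assume "\<not> a \<le> b"
  then obtain e where e: "a = b + Suc e" using less_iff_Suc_add by (metis add_Suc_right not_le)
  define r where "r = max r0 (max 1 (C / c + 1))"
  have r: "r \<ge> r0" "r \<ge> 1" "r \<ge> C / c + 1" unfolding r_def by auto
  have rb: "r ^ b > 0" using r by simp
  have "(c * r ^ Suc e) * r ^ b \<le> C * r ^ b" using assms(2)[OF r(1)] e by (simp add: power_add mult_ac)
  then have "c * r ^ Suc e \<le> C" using rb by (rule mult_right_le_imp_le)
  moreover have "r * 1 \<le> r ^ Suc e" using r(2) by (simp add: one_le_power)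
  then have "c * r \<le> c * r ^ Suc e" using assms(1) by simp
  moreover have "c * r \<ge> c * (C / c + 1)" using r(3) assms(1) by (intro mult_left_mono) auto
  then have "c * r \<ge> C + c" using assms(1) by (simp add: distrib_left)
  ultimately show False using assms(1) by linarith
qed

text \<open>The classical induction splits off one coordinate. The basis obtained is independent
  over the reals and not only over the integers, which is what turns ranks into real
  dimensions.\<close>

lemma subgroup_zbasis:
  fixes B :: "'a::real_vector set"
  assumes "finite B" "independent B" "G \<subseteq> zmod.span B" "zmod.subspace G"
  shows "\<exists>B'. finite B' \<and> independent B' \<and> zmod.span B' = G"
  using assms
proof (induction B arbitrary: G rule: finite_induct)
  case empty
  then have "G = {0}" using zmod.subspace_0 by auto
  then show ?case using independent_empty by (intro exI[of _ "{}"]) simp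
next
  case (insert b B)
  have ind: "independent B" "b \<notin> span B" using insert.prems(1) insert.hyps by (auto simp: independent_insert)
  define G0 where "G0 = G \<inter> zmod.span B"
  have "zmod.subspace G0" unfolding G0_def by (intro zmod.subspace_inter insert.prems zmod.subspace_span)
  then obtain B0 where B0: "finite B0" "independent B0" "zmod.span B0 = G0"
    using insert.IH[OF ind(1), of G0] unfolding G0_def by blast
  have sB0: "span B0 \<subseteq> span B"
  proof (rule span_minimal)
    show "B0 \<subseteq> span B" using zmod.span_superset[of B0] B0(3) zspan_subset_span[of B] unfolding G0_def by blast
  qed simp
  define P where "P m \<longleftrightarrow> (\<exists>y\<in>zmod.span B. of_int m *\<^sub>R b + y \<in> G)" for m :: int
  have ex: "\<exists>m. \<exists>y\<in>zmod.span B. x = of_int m *\<^sub>R b + y" if "x \<in> G" for x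
  proof -
    have "x \<in> zmod.span (insert b B)" using that insert.prems by blast
    then have "\<exists>m. x - of_int m *\<^sub>R b \<in> zmod.span B" unfolding zmod.span_insert by (rule CollectD)
    then obtain m where "x - of_int m *\<^sub>R b \<in> zmod.span B" by (rule exE)
    then show ?thesis by (intro exI[of _ m] bexI[of _ "x - of_int m *\<^sub>R b"]) auto
  qed
  show ?case
  proof (cases "\<exists>m. P m \<and> m \<noteq> 0")
    case False
    have "G \<subseteq> zmod.span B"
    proof
      fix x assume x: "x \<in> G"
      then obtain m y where my: "y \<in> zmod.span B" "x = of_int m *\<^sub>R b + y" using ex by blast
      then have "P m" using x unfolding P_def by blast
      then have "m = 0" using False by blast
      then show "x \<in> zmod.span B" using my by simp
    qed
    then have "G0 = G" unfolding G0_def by blast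
    then show ?thesis using B0 by blast
  next
    case True
    then obtain m where m: "P m" "m \<noteq> 0" by blast
    have "P (- m)"
    proof -
      obtain y where y: "y \<in> zmod.span B" "of_int m *\<^sub>R b + y \<in> G" using m(1) P_def by blast
      have "- (of_int m *\<^sub>R b + y) \<in> G" using y insert.prems(3) zmod.subspace_neg by blast
      then show ?thesis unfolding P_def using y by (intro bexI[of _ "-y"]) (auto intro: zmod.span_neg)
    qed
    then have "P (int (nat \<bar>m\<bar>)) \<and> nat \<bar>m\<bar> > 0" using m by (auto simp: abs_if)
    then have ex1: "\<exists>d. P (int d) \<and> d > 0" by blast
    \<comment> \<open>\<open>d\<close> generates the group of \<open>b\<close>-coefficients
      occurring in \<open>G\<close>, so division with remainder reduces every element of
      \<open>G\<close> to one of \<open>G0\<close>.\<close>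
    define d where "d = (LEAST d. P (int d) \<and> d > 0)"
    have d: "P (int d)" "d > 0" using LeastI_ex[OF ex1] unfolding d_def by auto
    have dmin: "\<not> P (int e)" if "e > 0" "e < d" for e
      using not_less_Least[of e "\<lambda>d. P (int d) \<and> d > 0"] that unfolding d_def by auto
    obtain y0 where y0: "y0 \<in> zmod.span B" "of_int (int d) *\<^sub>R b + y0 \<in> G" using d(1) unfolding P_def by blast
    define g0 where "g0 = of_int (int d) *\<^sub>R b + y0"
    have g0B: "g0 \<notin> span B"
    proof
      assume "g0 \<in> span B"
      then have "g0 - y0 \<in> span B" using y0 zspan_subset_span[of B] by (blast intro: span_diff)
      then have "real d *\<^sub>R b \<in> span B" unfolding g0_def by simp
      then have "b \<in> span B" using span_scale[of "real d *\<^sub>R b" B "1 / real d"] d(2) by simp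
      then show False using ind by simp
    qed
    have "zmod.span (insert g0 B0) = G"
    proof
      have "B0 \<subseteq> G" using zmod.span_superset[of B0] B0(3) unfolding G0_def by blast
      then show "zmod.span (insert g0 B0) \<subseteq> G"
        using y0 insert.prems(3) by (intro zmod.span_minimal) (auto simp: g0_def)
      show "G \<subseteq> zmod.span (insert g0 B0)"
      proof
        fix x assume x: "x \<in> G"
        then obtain m y where my: "y \<in> zmod.span B" "x = of_int m *\<^sub>R b + y" using ex by blast
        define q s where "q = m div int d" and "s = m mod int d"
        have ms: "m = int d * q + s" unfolding q_def s_def by simp
        have s: "0 \<le> s" "s < int d" unfolding s_def using d by auto
        have "x - of_int q *\<^sub>R g0 \<in> G"
          using x y0 insert.prems(3) unfolding g0_def by (intro zmod.subspace_diff zmod.subspace_scale) auto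
        moreover have e: "x - of_int q *\<^sub>R g0 = of_int s *\<^sub>R b + (y - of_int q *\<^sub>R y0)"
          unfolding my(2) g0_def ms by (simp add: algebra_simps)
        moreover have yq: "y - of_int q *\<^sub>R y0 \<in> zmod.span B"
          using my y0 by (intro zmod.span_diff zmod.span_scale)
        ultimately have "P s" unfolding P_def by (intro bexI[of _ "y - of_int q *\<^sub>R y0"]) simp_all
        moreover have "nat s < d" using s by linarith
        ultimately have "s = 0" using dmin[of "nat s"] s by (cases "s = 0") auto
        then have "x - of_int q *\<^sub>R g0 \<in> zmod.span B0"
          using e yq \<open>x - of_int q *\<^sub>R g0 \<in> G\<close> unfolding B0(3) G0_def by simp
        then show "x \<in> zmod.span (insert g0 B0)" unfolding zmod.span_insert by (intro CollectI exI)
      qed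
    qed
    moreover have "independent (insert g0 B0)"
      using B0(2) g0B sB0 by (auto simp: independent_insert)
    ultimately show ?thesis using B0(1) by blast
  qed
qed

text \<open>Integer independence does not in general give real independence, so real linear algebra
  does not apply directly. Instead, integer combinations of \<open>card B + 1\<close> independent
  elements with coefficients below n would be n^(card B + 1) points in a ball of radius O(n), where
  only O(n^card B) lattice points fit.\<close>

lemma zmod_independent_card_le:
  fixes B :: "'a::euclidean_space set"
  assumes "independent B" "B1 \<subseteq> zmod.span B" "zmod.independent B1"
  shows "finite B1 \<and> card B1 \<le> card B"
proof (rule ccontr)
  assume neg: "\<not> ?thesis"
  have "\<exists>F\<subseteq>B1. finite F \<and> card F = Suc (card B)"
  proof (cases "finite B1")
    case True
    then show ?thesis using neg by (metis not_less_eq_eq obtain_subset_with_card_n)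
  next
    case False
    then show ?thesis by (metis infinite_arbitrarily_large)
  qed
  then obtain F where F: "F \<subseteq> B1" "finite F" "card F = Suc (card B)" by blast
  \<comment> \<open>The summand 1 makes the radius \<open>n * D\<close> at least 1, as
    \<open>count_upper\<close> requires.\<close>
  define D where "D = (\<Sum>b\<in>F. norm b) + 1"
  have D: "D \<ge> 1" unfolding D_def by (simp add: sum_nonneg)
  have dimB: "dim (span B \<inter> {x. (\<lambda>_. 0::real) x = 0}) = card B"
    using assms(1) by (simp add: dim_eq_card_independent)
  obtain C where C: "C > 0" "\<And>r. r \<ge> 1 \<Longrightarrow> real (card {x \<in> zmod.span B. norm x \<le> r \<and> norm (0::real) \<le> 0})
     \<le> C * r ^ card B"
    using count_upper[OF assms(1), of "\<lambda>_. 0::real" 0] unfolding dimB by (auto simp: linear_iff)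
  have "1 * real n ^ Suc (card B) \<le> (C * D ^ card B) * real n ^ card B" if n: "n \<ge> 1" for n :: nat
  proof -
    define pt where "pt u = (\<Sum>b\<in>F. of_int (int (u b)) *\<^sub>R b)" for u :: "'a \<Rightarrow> nat"
    define U where "U = PiE F (\<lambda>_. {..<n})"
    define X where "X = {x \<in> zmod.span B. norm x \<le> real n * D \<and> norm (0::real) \<le> 0}"
    have "inj_on pt U"
    proof (rule inj_onI, rule ccontr)
      fix u u' assume u: "u \<in> U" "u' \<in> U" "pt u = pt u'" "u \<noteq> u'"
      then obtain v where v: "v \<in> F" "u v \<noteq> u' v" unfolding U_def by (meson PiE_ext)
      have "(\<Sum>b\<in>F. of_int (int (u b) - int (u' b)) *\<^sub>R b) = 0"
        using u(3) unfolding pt_def by (simp add: scaleR_diff_left sum_subtractf)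
      moreover have "int (u v) - int (u' v) \<noteq> 0" using v by simp
      ultimately have "zmod.dependent B1"
        unfolding zmod.dependent_explicit using F v by (intro exI[of _ F] exI[of _ "\<lambda>b. int (u b) - int (u' b)"]) auto
      then show False using assms(3) by simp
    qed
    moreover have "pt ` U \<subseteq> X"
    proof safe
      fix u assume u: "u \<in> U"
      have "pt u \<in> zmod.span B1" unfolding pt_def
        using F by (intro zmod.span_sum zmod.span_scale zmod.span_base) auto
      then have z: "pt u \<in> zmod.span B" by (metis assms(2) zmod.span_minimal zmod.subspace_span subsetD)
      have "norm (pt u) \<le> (\<Sum>b\<in>F. norm (of_int (int (u b)) *\<^sub>R b))" unfolding pt_def by (rule norm_sum)
      also have "\<dots> \<le> (\<Sum>b\<in>F. real n * norm b)"
      proof (rule sum_mono)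
        fix b assume "b \<in> F"
        then have "u b < n" using u unfolding U_def by auto
        then show "norm (of_int (int (u b)) *\<^sub>R b) \<le> real n * norm b"
          by (simp add: mult_right_mono)
      qed
      also have "\<dots> \<le> real n * D" unfolding D_def by (simp add: sum_distrib_left algebra_simps)
      finally show "pt u \<in> X" unfolding X_def using z by simp
    qed
    moreover have "finite X" unfolding X_def
      by (rule finite_subset[OF _ finite_zspan_ball[OF assms(1), of "real n * D"]]) auto
    ultimately have "card U \<le> card X" by (rule card_inj_on_le)
    moreover have "card U = n ^ Suc (card B)" unfolding U_def by (simp add: card_PiE[OF F(2)] F(3))
    ultimately have "n ^ Suc (card B) \<le> card X" by simp
    then have "real (n ^ Suc (card B)) \<le> real (card X)" by (rule of_nat_mono)
    also have "\<dots> \<le> C * (real n * D) ^ card B" unfolding X_def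
    proof (rule C(2))
      have "1 * 1 \<le> real n * D" using D n by (intro mult_mono) auto
      then show "1 \<le> real n * D" by simp
    qed
    finally show ?thesis by (simp add: power_mult_distrib mult_ac)
  qed
  note * = this
  define n where "n = nat \<lceil>C * D ^ card B\<rceil> + 1"
  have n: "n \<ge> 1" "real n > C * D ^ card B" unfolding n_def by linarith+
  have "real n ^ card B > 0" using n by simp
  moreover have "real n * real n ^ card B \<le> (C * D ^ card B) * real n ^ card B" using *[OF n(1)] by simp
  ultimately have "real n \<le> C * D ^ card B" using mult_right_le_imp_le by blast
  then show False using n by simp
qed

text \<open>\<open>free_rank\<close> picks an arbitrary integral basis. The counting bound shows
  that it has at most \<open>card B\<close> elements, and it has at least as many because its real
  span contains \<open>B\<close>.\<close>

lemma free_rank_eq_card: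
  fixes B :: "'a::euclidean_space set"
  assumes "independent B"
  shows "free_rank (zmod.span B) = card B"
proof -
  have "zmod.independent B"
  proof
    assume "zmod.dependent B"
    then obtain t u v where "finite t" "t \<subseteq> B" "(\<Sum>b\<in>t. of_int (u b) *\<^sub>R b) = 0" "v \<in> t" "u v \<noteq> (0::int)"
      unfolding zmod.dependent_explicit by blast
    then have "dependent B" unfolding dependent_explicit
      by (intro exI[of _ t] exI[of _ "\<lambda>b. of_int (u b)"]) auto
    then show False using assms by simp
  qed
  then have "z_basis B (zmod.span B)" unfolding z_basis_def by simp
  then have B1: "z_basis (SOME B1. z_basis B1 (zmod.span B)) (zmod.span B)" (is "z_basis ?B1 _") by (rule someI)
  then have "zmod.independent ?B1" "zmod.span ?B1 = zmod.span B" unfolding z_basis_def by auto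
  then have *: "finite ?B1" "card ?B1 \<le> card B"
    using zmod_independent_card_le[OF assms, of ?B1] zmod.span_superset[of ?B1] by auto
  have "B \<subseteq> span ?B1"
    using zmod.span_superset[of B] \<open>zmod.span ?B1 = zmod.span B\<close> zspan_subset_span[of ?B1] by simp
  then have "card B \<le> card ?B1" using independent_span_bound[OF *(1) assms] by blast
  then show ?thesis unfolding free_rank_def using * by simp
qed

text \<open>Compares the growth of the number of lattice points in a ball with that of the images under the \<open>\<phi> i\<close>.\<close>
lemma rank_sum_ge:
  fixes B :: "'a::euclidean_space set" and \<phi> :: "'i \<Rightarrow> 'a \<Rightarrow> real"
  assumes B: "independent B" and I: "finite I" and lin: "\<And>i. i \<in> I \<Longrightarrow> linear (\<phi> i)"
    and inj: "\<And>x. x \<in> zmod.span B \<Longrightarrow> (\<And>i. i \<in> I \<Longrightarrow> \<phi> i x = 0) \<Longrightarrow> x = 0"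
  shows "card B \<le> (\<Sum>i\<in>I. card B - free_rank {x \<in> zmod.span B. \<phi> i x = 0})"
proof -
  have finB: "finite B" using B by (rule independent_imp_finite)
  \<comment> \<open>The constant map 0 in the role of \<open>T\<close> makes the slab condition
    void, so the slab counts become ball counts whose exponents are full ranks.\<close>
  define X where "X r = {x \<in> zmod.span B. norm x \<le> r \<and> norm (0::real) \<le> 1}" for r
  have finX: "finite (X r)" for r unfolding X_def
    by (rule finite_subset[OF _ finite_zspan_ball[OF B, of r]]) auto
  have lin0: "linear (\<lambda>_::'a. 0::real)" by (simp add: linear_iff)
  have dimB: "dim (span B' \<inter> {x. (\<lambda>_. 0::real) x = 0}) = card B'" if "independent B'" for B' :: "'a set"
    using that by (simp add: dim_eq_card_independent)
  have "\<exists>C r0. C > 0 \<and> (\<forall>r\<ge>r0. real (card (\<phi> i ` X r)) \<le> C * r ^ (card B - free_rank {x \<in> zmod.span B. \<phi> i x = 0}))"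
    if i: "i \<in> I" for i
  proof -
    define G where "G = {x \<in> zmod.span B. \<phi> i x = 0}"
    have "zmod.subspace G" unfolding G_def zmod.subspace_def
      by (auto intro: zmod.span_add zmod.span_scale zmod.span_zero
        simp: linear_add[OF lin[OF i]] linear_cmul[OF lin[OF i]] linear_0[OF lin[OF i]])
    then obtain B' where B': "independent B'" "zmod.span B' = G"
      using subgroup_zbasis[OF finB B, of G] unfolding G_def by blast
    have "\<phi> i (x + g) = \<phi> i x" if "g \<in> zmod.span B'" for x g
      using that unfolding B'(2) G_def by (simp add: linear_add[OF lin[OF i]])
    then have "\<exists>C r0. C > 0 \<and> (\<forall>r\<ge>r0. real (card (\<phi> i ` X r)) \<le> C * r ^ (card B - card B'))"
      using count_cosets[OF B lin0 B'(1), of "\<phi> i" 1] B'(2) unfolding dimB[OF B] dimB[OF B'(1)] X_def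
      by (auto simp: G_def)
    moreover have "card B' = free_rank G" using free_rank_eq_card[OF B'(1)] B'(2) by simp
    ultimately show ?thesis unfolding G_def by simp
  qed
  then obtain C r0 where C: "\<And>i. i \<in> I \<Longrightarrow> C i > 0"
    "\<And>i r. i \<in> I \<Longrightarrow> r \<ge> r0 i \<Longrightarrow> real (card (\<phi> i ` X r)) \<le> C i * r ^ (card B - free_rank {x \<in> zmod.span B. \<phi> i x = 0})"
    by metis
  obtain c1 r1 where c1: "c1 > 0" "\<And>r. r \<ge> r1 \<Longrightarrow> c1 * r ^ card B \<le> real (card (X r))"
    using count_lower_small[OF B lin0, of 1] unfolding dimB[OF B] X_def by auto
  show ?thesis
  proof (rule power_growth_le[OF c1(1), of "\<bar>r1\<bar> + (\<Sum>i\<in>I. \<bar>r0 i\<bar>)" _ "\<Prod>i\<in>I. C i"])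
    fix r assume r: "r \<ge> \<bar>r1\<bar> + (\<Sum>i\<in>I. \<bar>r0 i\<bar>)"
    have "(\<Sum>i\<in>I. \<bar>r0 i\<bar>) \<ge> 0" by (simp add: sum_nonneg)
    then have rr1: "r \<ge> r1" using r by linarith
    have rr0: "r \<ge> r0 i" if "i \<in> I" for i
      using member_le_sum[OF that, of "\<lambda>i. \<bar>r0 i\<bar>"] I r by simp
    have "inj_on (\<lambda>x. restrict (\<lambda>i. \<phi> i x) I) (X r)"
    proof (rule inj_onI)
      fix x y assume xy: "x \<in> X r" "y \<in> X r" "restrict (\<lambda>i. \<phi> i x) I = restrict (\<lambda>i. \<phi> i y) I"
      have "\<phi> i (x - y) = 0" if "i \<in> I" for i
        using xy(3) that linear_diff[OF lin[OF that], of x y] by (metis cancel_comm_monoid_add_class.diff_cancel restrict_apply')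
      moreover have "x - y \<in> zmod.span B" using xy unfolding X_def by (auto intro: zmod.span_diff)
      ultimately have "x - y = 0" using inj by blast
      then show "x = y" by simp
    qed
    moreover have "(\<lambda>x. restrict (\<lambda>i. \<phi> i x) I) ` X r \<subseteq> PiE I (\<lambda>i. \<phi> i ` X r)" by auto
    ultimately have "card (X r) \<le> card (PiE I (\<lambda>i. \<phi> i ` X r))"
      by (rule card_inj_on_le) (intro finite_PiE I finite_imageI finX)
    then have "real (card (X r)) \<le> real (\<Prod>i\<in>I. card (\<phi> i ` X r))" unfolding card_PiE[OF I] by (rule of_nat_mono)
    also have "\<dots> \<le> (\<Prod>i\<in>I. C i * r ^ (card B - free_rank {x \<in> zmod.span B. \<phi> i x = 0}))"
      unfolding of_nat_prod using C(2) rr0 by (intro prod_mono) auto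
    finally show "c1 * r ^ card B \<le> (\<Prod>i\<in>I. C i) * r ^ (\<Sum>i\<in>I. card B - free_rank {x \<in> zmod.span B. \<phi> i x = 0})"
      using c1(2)[OF rr1] by (simp add: prod.distrib power_sum)
  qed
qed

section \<open>Sign patterns of hyperplane families\<close>

definition shattered :: "'i set set \<Rightarrow> 'i set \<Rightarrow> bool"
  where "shattered F I \<longleftrightarrow> (\<forall>Z\<subseteq>I. \<exists>A\<in>F. A \<inter> I = Z)"

text \<open>Pajor's lemma.\<close>
lemma card_le_card_shattered:
  assumes "finite X" "F \<subseteq> Pow X"
  shows "card F \<le> card {I \<in> Pow X. shattered F I}"
  using assms
proof (induction X arbitrary: F rule: finite_induct)
  case empty
  show ?case
  proof (cases "F = {}")
    case False
    moreover have "F \<subseteq> {{}}" using empty by simp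
    ultimately have "F = {{}}" by (metis subset_singletonD)
    then have "{I \<in> Pow {}. shattered F I} = {{}}" by (auto simp: shattered_def)
    then show ?thesis using \<open>F = {{}}\<close> by simp
  qed simp
next
  case (insert x X)
  \<comment> \<open>\<open>F0\<close> forgets \<open>x\<close>, and \<open>F1\<close> keeps the sets
    for which both choices at \<open>x\<close> occur; their sizes add up to that of
    \<open>F\<close>. What \<open>F1\<close> shatters remains shattered by \<open>F\<close> after
    \<open>x\<close> is added, so the two inductive bounds count shattered sets without and with
    \<open>x\<close>.\<close>
  define F0 where "F0 = (\<lambda>A. A - {x}) ` F"
  define F1 where "F1 = {A \<in> Pow X. A \<in> F \<and> insert x A \<in> F}"
  define S where "S = {I \<in> Pow (insert x X). shattered F I}"
  define S0 S1 where "S0 = {I \<in> Pow X. shattered F0 I}" and "S1 = {I \<in> Pow X. shattered F1 I}"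
  have finF: "finite F" by (rule finite_subset[OF insert.prems]) (use insert.hyps in simp)
  have sub0: "F0 \<subseteq> Pow X" using insert.prems unfolding F0_def by auto
  have sub1: "F1 \<subseteq> Pow X" unfolding F1_def by auto
  have finS: "finite S"
    by (rule finite_subset[of _ "Pow (insert x X)"]) (use insert.hyps(1) in \<open>auto simp: S_def\<close>)
  have "card F = card {A \<in> F. x \<notin> A} + card {A \<in> F. x \<in> A}"
  proof -
    have "F = {A \<in> F. x \<notin> A} \<union> {A \<in> F. x \<in> A}" by blast
    then have "card F = card ({A \<in> F. x \<notin> A} \<union> {A \<in> F. x \<in> A})" by (rule arg_cong)
    also have "\<dots> = card {A \<in> F. x \<notin> A} + card {A \<in> F. x \<in> A}"
      using finF by (intro card_Un_disjoint) auto
    finally show ?thesis .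
  qed
  also have "card {A \<in> F. x \<in> A} = card ((\<lambda>A. A - {x}) ` {A \<in> F. x \<in> A})"
    by (rule card_image[symmetric]) (auto simp: inj_on_def)
  also have "card {A \<in> F. x \<notin> A} + \<dots> =
      card ({A \<in> F. x \<notin> A} \<union> (\<lambda>A. A - {x}) ` {A \<in> F. x \<in> A}) + card ({A \<in> F. x \<notin> A} \<inter> (\<lambda>A. A - {x}) ` {A \<in> F. x \<in> A})"
    using finF by (intro card_Un_Int) auto
  also have "{A \<in> F. x \<notin> A} \<union> (\<lambda>A. A - {x}) ` {A \<in> F. x \<in> A} = F0"
  proof -
    have "(\<lambda>A. A - {x}) ` {A \<in> F. x \<notin> A} = {A \<in> F. x \<notin> A}"
      by (rule trans[OF image_cong[OF refl, of _ _ "\<lambda>A. A"]]) auto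
    moreover have "F0 = (\<lambda>A. A - {x}) ` ({A \<in> F. x \<notin> A} \<union> {A \<in> F. x \<in> A})"
      unfolding F0_def by (rule image_cong) auto
    ultimately show ?thesis by (simp only: image_Un)
  qed
  also have "{A \<in> F. x \<notin> A} \<inter> (\<lambda>A. A - {x}) ` {A \<in> F. x \<in> A} = F1"
  proof (intro equalityI subsetI)
    fix A assume "A \<in> {A \<in> F. x \<notin> A} \<inter> (\<lambda>A. A - {x}) ` {A \<in> F. x \<in> A}"
    then obtain A' where "A \<in> F" "x \<notin> A" "A' \<in> F" "x \<in> A'" "A = A' - {x}" by blast
    moreover from this have "insert x A = A'" by blast
    ultimately show "A \<in> F1" unfolding F1_def using insert.prems by auto
  next
    fix A assume "A \<in> F1"
    then have "A \<in> F" "insert x A \<in> F" "x \<notin> A" using insert.hyps unfolding F1_def by auto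
    moreover have "A = insert x A - {x}" using \<open>x \<notin> A\<close> by blast
    ultimately show "A \<in> {A \<in> F. x \<notin> A} \<inter> (\<lambda>A. A - {x}) ` {A \<in> F. x \<in> A}" by blast
  qed
  finally have "card F = card F0 + card F1" .
  also have "\<dots> \<le> card S0 + card S1"
    unfolding S0_def S1_def by (intro add_mono insert.IH sub0 sub1)
  also have "card S1 = card (insert x ` S1)"
    by (rule card_image[symmetric]) (use insert.hyps in \<open>auto simp: S1_def inj_on_def\<close>)
  also have "card S0 + \<dots> = card (S0 \<union> insert x ` S1)"
  proof (rule card_Un_disjoint[symmetric])
    have "x \<notin> I" if "I \<in> S0" for I using that insert.hyps unfolding S0_def by blast
    then show "S0 \<inter> insert x ` S1 = {}" by blast
    show "finite S0" by (rule finite_subset[of _ "Pow X"]) (use insert.hyps(1) in \<open>auto simp: S0_def\<close>)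
    have "finite S1" by (rule finite_subset[of _ "Pow X"]) (use insert.hyps(1) in \<open>auto simp: S1_def\<close>)
    then show "finite (insert x ` S1)" by (rule finite_imageI)
  qed
  also have "\<dots> \<le> card S"
  proof (rule card_mono[OF finS], rule subsetI)
    fix I assume "I \<in> S0 \<union> insert x ` S1"
    then show "I \<in> S"
    proof
      assume I: "I \<in> S0"
      have "\<exists>A\<in>F. A \<inter> I = Z" if Z: "Z \<subseteq> I" for Z
      proof -
        obtain A where "A \<in> F" "(A - {x}) \<inter> I = Z"
          using I Z unfolding S0_def shattered_def F0_def by blast
        moreover have "x \<notin> I" using I insert.hyps unfolding S0_def by auto
        ultimately show ?thesis by (intro bexI[of _ A]) auto
      qed
      then show "I \<in> S" using I unfolding S_def S0_def shattered_def by auto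
    next
      assume "I \<in> insert x ` S1"
      then obtain I' where I': "I' \<in> S1" "I = insert x I'" by blast
      have xI': "x \<notin> I'" using I' insert.hyps unfolding S1_def by auto
      have "\<exists>A\<in>F. A \<inter> I = Z" if Z: "Z \<subseteq> I" for Z
      proof -
        have "Z - {x} \<subseteq> I'" using Z I' by auto
        then obtain A where A: "A \<in> F1" "A \<inter> I' = Z - {x}" using I' unfolding S1_def shattered_def by blast
        have xA: "x \<notin> A" "A \<in> F" "insert x A \<in> F" using A insert.hyps unfolding F1_def by auto
        show ?thesis
        proof (cases "x \<in> Z")
          case True
          then have "insert x A \<inter> I = Z" using A I' by auto
          then show ?thesis using xA by blast
        next
          case False
          then have "A \<inter> I = Z" using A I' xA by auto
          then show ?thesis using xA by blast
        qed
      qed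
      then show "I \<in> S" using I' unfolding S_def S1_def shattered_def by auto
    qed
  qed
  finally show ?case unfolding S_def .
qed

text \<open>Two patterns refute a relation \<Sum> c a = 0 with a positive coefficient: strict
  inequalities exactly where c > 0 force \<Sum> c b < 0, and strict inequalities exactly where c < 0
  force \<Sum> c b \<ge> 0. Injectivity is stated separately because independence of the image set
  does not see repeated normals, that is, parallel half-spaces.\<close>

lemma shattered_halfspaces_independent:
  fixes a :: "'i \<Rightarrow> 'a::real_inner" and b :: "'i \<Rightarrow> real"
  assumes "finite J" "I \<subseteq> J" "shattered ((\<lambda>x. {j \<in> J. a j \<bullet> x > b j}) ` X) I"
  shows "inj_on a I \<and> independent (a ` I)"
proof -
  have finI: "finite I" by (rule finite_subset[OF assms(2,1)])
  have sh: "\<exists>x. \<forall>i\<in>I. (a i \<bullet> x > b i \<longleftrightarrow> i \<in> Z)" if Z: "Z \<subseteq> I" for Z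
  proof -
    obtain A where "A \<in> (\<lambda>x. {j \<in> J. a j \<bullet> x > b j}) ` X" "A \<inter> I = Z"
      using assms(3) Z unfolding shattered_def by blast
    then obtain x where x: "{j \<in> J. a j \<bullet> x > b j} \<inter> I = Z" by (elim imageE) simp
    show ?thesis
    proof (intro exI[of _ x] ballI)
      fix i assume "i \<in> I"
      then show "a i \<bullet> x > b i \<longleftrightarrow> i \<in> Z" using x assms(2) by blast
    qed
  qed
  have sumle: "(\<Sum>i\<in>I. c i * b i) < 0" if "(\<Sum>i\<in>I. c i *\<^sub>R a i) = 0" "j \<in> I" "c j > 0" for c j
  proof -
    obtain x where x: "\<And>i. i \<in> I \<Longrightarrow> (a i \<bullet> x > b i) = (i \<in> {i \<in> I. c i > 0})"
      using sh[of "{i \<in> I. c i > 0}"] by blast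
    have "(\<Sum>i\<in>I. c i * b i) < (\<Sum>i\<in>I. c i * (a i \<bullet> x))"
    proof (rule sum_strict_mono_ex1[OF finI])
      show "\<forall>i\<in>I. c i * b i \<le> c i * (a i \<bullet> x)"
      proof
        fix i assume i: "i \<in> I"
        show "c i * b i \<le> c i * (a i \<bullet> x)"
        proof (cases "c i > 0")
          case True
          then show ?thesis using x[OF i] i by simp
        next
          case False
          then show ?thesis using x[OF i] i by (intro mult_left_mono_neg) auto
        qed
      qed
      show "\<exists>i\<in>I. c i * b i < c i * (a i \<bullet> x)" using x[OF that(2)] that by (intro bexI[of _ j]) auto
    qed
    also have "\<dots> = (\<Sum>i\<in>I. c i *\<^sub>R a i) \<bullet> x" by (simp add: inner_sum_left)
    finally show ?thesis using that(1) by simp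
  qed
  have zero: "c j = 0" if c: "(\<Sum>i\<in>I. c i *\<^sub>R a i) = 0" and j: "j \<in> I" for c j
  proof -
    have nonpos: "c' j \<le> 0" if c': "(\<Sum>i\<in>I. c' i *\<^sub>R a i) = 0" for c'
    proof (rule ccontr)
      assume pos: "\<not> c' j \<le> 0"
      then have neg: "(\<Sum>i\<in>I. c' i * b i) < 0" using sumle[OF c' j] by simp
      obtain x where x: "\<And>i. i \<in> I \<Longrightarrow> (a i \<bullet> x > b i) = (i \<in> {i \<in> I. c' i < 0})"
        using sh[of "{i \<in> I. c' i < 0}"] by blast
      have "(\<Sum>i\<in>I. c' i * b i) \<ge> (\<Sum>i\<in>I. c' i * (a i \<bullet> x))"
      proof (rule sum_mono)
        fix i assume i: "i \<in> I"
        show "c' i * (a i \<bullet> x) \<le> c' i * b i"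
        proof (cases "c' i < 0")
          case True
          then show ?thesis using x[OF i] i by (intro mult_left_mono_neg) auto
        next
          case False
          then show ?thesis using x[OF i] i by (intro mult_left_mono) auto
        qed
      qed
      moreover have "(\<Sum>i\<in>I. c' i * (a i \<bullet> x)) = (\<Sum>i\<in>I. c' i *\<^sub>R a i) \<bullet> x" by (simp add: inner_sum_left)
      ultimately show False using c' neg by simp
    qed
    have "(\<Sum>i\<in>I. (- c i) *\<^sub>R a i) = 0" using c by (simp add: sum_negf)
    from nonpos[OF c] nonpos[OF this] show ?thesis by simp
  qed
  have inj: "inj_on a I"
  proof (rule inj_onI, rule ccontr)
    fix i j assume ij: "i \<in> I" "j \<in> I" "a i = a j" "i \<noteq> j"
    define c where "c l = (if l = i then 1 else if l = j then -1 else 0 :: real)" for l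
    have "(\<Sum>l\<in>I. c l *\<^sub>R a l) = (\<Sum>l\<in>{i, j}. c l *\<^sub>R a l)"
      by (rule sum.mono_neutral_right) (use finI ij in \<open>auto simp: c_def\<close>)
    also have "\<dots> = 0" using ij by (simp add: c_def)
    finally show False using zero[of c i] ij by (simp add: c_def)
  qed
  moreover have "independent (a ` I)"
  proof
    assume "dependent (a ` I)"
    then obtain u v where uv: "v \<in> a ` I" "u v \<noteq> 0" "(\<Sum>v\<in>a ` I. u v *\<^sub>R v) = 0"
      using dependent_finite[of "a ` I"] finI by auto
    then obtain j where "j \<in> I" "v = a j" by blast
    moreover have "(\<Sum>i\<in>I. u (a i) *\<^sub>R a i) = 0" using uv(3) by (simp add: sum.reindex[OF inj])
    ultimately show False using zero[of "\<lambda>i. u (a i)" j] uv by simp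
  qed
  ultimately show ?thesis by simp
qed

text \<open>A shattered family has pairwise distinct normals, so it uses each \<open>h\<close> at
  most once and is the graph of a choice of offsets on some \<open>g\<close> with independent
  normals. Pajor's lemma bounds the patterns by the number of such graphs.\<close>

lemma card_halfspace_patterns_le:
  fixes a :: "'i \<Rightarrow> 'a::real_inner" and vals :: "'i \<Rightarrow> real set"
  assumes "finite H" "\<And>h. h \<in> H \<Longrightarrow> finite (vals h)"
  shows "card ((\<lambda>x. {(h, v). h \<in> H \<and> v \<in> vals h \<and> a h \<bullet> x > v}) ` X)
    \<le> (\<Sum>g | g \<subseteq> H \<and> inj_on a g \<and> independent (a ` g). \<Prod>h\<in>g. card (vals h))"
proof -
  define J where "J = (SIGMA h:H. vals h)"
  define F where "F = (\<lambda>x. {j \<in> J. a (fst j) \<bullet> x > snd j}) ` X"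
  define GG where "GG = {g. g \<subseteq> H \<and> inj_on a g \<and> independent (a ` g)}"
  have finJ: "finite J" unfolding J_def using assms by auto
  have finGG: "finite GG" unfolding GG_def by (rule finite_subset[of _ "Pow H"]) (use assms in auto)
  have fing: "finite g" if "g \<in> GG" for g using that assms(1) finite_subset unfolding GG_def by blast
  have fins: "finite (SIGMA g:GG. PiE g vals)"
  proof (rule finite_SigmaI[OF finGG])
    fix g assume g: "g \<in> GG"
    then have "g \<subseteq> H" unfolding GG_def by simp
    then show "finite (PiE g vals)" using assms(2) by (intro finite_PiE fing[OF g]) blast
  qed
  have pat: "(\<lambda>x. {(h, v). h \<in> H \<and> v \<in> vals h \<and> a h \<bullet> x > v}) ` X = F"
    unfolding F_def J_def by (intro image_cong) auto
  have "card F \<le> card {I \<in> Pow J. shattered F I}"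
    by (rule card_le_card_shattered[OF finJ]) (auto simp: F_def)
  also have "\<dots> \<le> card ((\<lambda>(g, w). (\<lambda>h. (h, w h)) ` g) ` (SIGMA g:GG. PiE g vals))"
  proof (rule card_mono)
    show "finite ((\<lambda>(g, w). (\<lambda>h. (h, w h)) ` g) ` (SIGMA g:GG. PiE g vals))"
      by (rule finite_imageI[OF fins])
    show "{I \<in> Pow J. shattered F I} \<subseteq> (\<lambda>(g, w). (\<lambda>h. (h, w h)) ` g) ` (SIGMA g:GG. PiE g vals)"
    proof
      fix I assume "I \<in> {I \<in> Pow J. shattered F I}"
      then have I: "I \<subseteq> J" "shattered F I" by auto
      have ind: "inj_on (\<lambda>j. a (fst j)) I" "independent ((\<lambda>j. a (fst j)) ` I)"
        using shattered_halfspaces_independent[OF finJ I(1), where a = "\<lambda>j. a (fst j)" and b = snd and X = X] I(2) unfolding F_def by auto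
      have injf: "inj_on fst I" using ind(1) by (auto simp: inj_on_def)
      define w where "w = restrict (\<lambda>h. snd (inv_into I fst h)) (fst ` I)"
      have w: "w (fst j) = snd j" if "j \<in> I" for j
      proof -
        have "inv_into I fst (fst j) = j" by (rule inv_into_f_f[OF injf that])
        then show ?thesis unfolding w_def using that by simp
      qed
      have "fst ` I \<subseteq> H" using I(1) unfolding J_def by auto
      moreover have "inj_on a (fst ` I)" using ind(1) by (intro inj_onI) (auto simp: inj_on_def)
      ultimately have "fst ` I \<in> GG" unfolding GG_def using ind(2) by (simp add: image_image)
      moreover have "w \<in> PiE (fst ` I) vals"
      proof (rule PiE_I)
        fix h assume "h \<in> fst ` I"
        then obtain j where "j \<in> I" "h = fst j" by blast
        then show "w h \<in> vals h" using w I(1) unfolding J_def by auto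
      qed (simp add: w_def)
      moreover have "I = (\<lambda>h. (h, w h)) ` (fst ` I)"
      proof -
        have "(\<lambda>h. (h, w h)) ` (fst ` I) = (\<lambda>j. j) ` I"
          unfolding image_image using w by (intro image_cong) auto
        then show ?thesis by simp
      qed
      ultimately show "I \<in> (\<lambda>(g, w). (\<lambda>h. (h, w h)) ` g) ` (SIGMA g:GG. PiE g vals)"
        by (intro image_eqI[of _ _ "(fst ` I, w)"]) auto
    qed
  qed
  also have "\<dots> \<le> card (SIGMA g:GG. PiE g vals)" by (rule card_image_le[OF fins])
  also have "\<dots> = (\<Sum>g\<in>GG. card (PiE g vals))"
  proof (rule card_SigmaI[OF finGG], rule ballI)
    fix g assume g: "g \<in> GG"
    then have "g \<subseteq> H" unfolding GG_def by simp
    then show "finite (PiE g vals)" using assms(2) by (intro finite_PiE fing[OF g]) blast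
  qed
  also have "\<dots> = (\<Sum>g\<in>GG. \<Prod>h\<in>g. card (vals h))" by (intro sum.cong refl card_PiE fing)
  finally show ?thesis unfolding pat GG_def .
qed

section \<open>Polytopal sets and their walls\<close>

definition hyp :: "'a::euclidean_space set \<Rightarrow> 'a \<times> real \<Rightarrow> 'a set"
  where "hyp E h = {x \<in> E. fst h \<bullet> x = snd h}"

text \<open>Hyperplanes are stored as pairs of a normal and an offset to make normals available for
  linear algebra. The sign of the pair is arbitrary: the set may lie on different sides at different
  points of one hyperplane.\<close>

definition walls :: "'a::euclidean_space set \<Rightarrow> 'a set \<Rightarrow> ('a \<times> real) set \<Rightarrow> bool"
  where "walls E W A \<longleftrightarrow> finite A \<and> (\<forall>h\<in>A. fst h \<in> E \<and> fst h \<noteq> 0 \<and> properly_supporting E W (hyp E h)) \<and>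
    top_of_set E frontier_of W \<subseteq> (\<Union>h\<in>A. hyp E h)"

lemma polytopal_walls:
  assumes "polytopal E W"
  shows "\<exists>A. walls E W A"
proof -
  obtain HH where HH: "finite HH" "\<And>H. H \<in> HH \<Longrightarrow> properly_supporting E W H"
    "top_of_set E frontier_of W \<subseteq> \<Union>HH"
    using assms unfolding polytopal_def by blast
  have "\<exists>h. fst h \<in> E \<and> fst h \<noteq> 0 \<and> H = hyp E h" if H: "H \<in> HH" for H
  proof -
    obtain a b where "a \<in> E" "a \<noteq> 0" "H = {x \<in> E. a \<bullet> x = b}"
      using HH(2)[OF H] unfolding properly_supporting_def by blast
    then show ?thesis unfolding hyp_def by (intro exI[of _ "(a, b)"]) simp
  qed
  then obtain \<nu> where \<nu>: "\<And>H. H \<in> HH \<Longrightarrow> fst (\<nu> H) \<in> E \<and> fst (\<nu> H) \<noteq> 0 \<and> H = hyp E (\<nu> H)" by metis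
  have "walls E W (\<nu> ` HH)" unfolding walls_def
  proof (intro conjI ballI)
    show "finite (\<nu> ` HH)" using HH(1) by simp
    show "top_of_set E frontier_of W \<subseteq> (\<Union>h\<in>\<nu> ` HH. hyp E h)" using HH(3) \<nu> by auto
    fix h assume "h \<in> \<nu> ` HH"
    then obtain H where H: "H \<in> HH" "h = \<nu> H" by blast
    then show "fst h \<in> E" "fst h \<noteq> 0" using \<nu> by auto
    show "properly_supporting E W (hyp E h)" using HH(2)[OF H(1)] \<nu>[OF H(1)] H(2) by simp
  qed
  then show ?thesis by blast
qed

text \<open>Otherwise the segment from \<open>p\<close> to \<open>p'\<close> would be connected and
  meet both \<open>W\<close> and its complement, hence the frontier and so a wall; but an affine
  function with the same strict sign at both ends has no zero in between.\<close>

lemma same_side_mem: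
  assumes E: "subspace E" and A: "walls E W A"
    and p: "p \<in> E" "p' \<in> E"
    and side: "\<And>h. h \<in> A \<Longrightarrow> fst h \<bullet> p \<noteq> snd h \<and> fst h \<bullet> p' \<noteq> snd h \<and> (fst h \<bullet> p > snd h \<longleftrightarrow> fst h \<bullet> p' > snd h)"
    and pW: "p \<in> W"
  shows "p' \<in> W"
proof (rule ccontr)
  assume neg: "p' \<notin> W"
  have seg: "closed_segment p p' \<subseteq> E"
    by (rule closed_segment_subset[OF p subspace_imp_convex[OF E]])
  have "connectedin (top_of_set E) (closed_segment p p')"
    using seg by (simp add: connectedin_subtopology)
  moreover have "closed_segment p p' \<inter> W \<noteq> {}" "closed_segment p p' - W \<noteq> {}"
    using pW neg ends_in_segment by blast+
  ultimately have "closed_segment p p' \<inter> top_of_set E frontier_of W \<noteq> {}"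
    by (rule connectedin_Int_frontier_of)
  then obtain z where zF: "z \<in> closed_segment p p'" "z \<in> top_of_set E frontier_of W" by blast
  have "z \<in> (\<Union>h\<in>A. hyp E h)" using A zF(2) unfolding walls_def by blast
  then obtain h where "h \<in> A" "fst h \<bullet> z = snd h" unfolding hyp_def by blast
  note z = zF(1) this
  obtain u where u: "0 \<le> u" "u \<le> 1" "z = (1 - u) *\<^sub>R p + u *\<^sub>R p'"
    using z(1) unfolding closed_segment_def by auto
  define s t where "s = fst h \<bullet> p - snd h" and "t = fst h \<bullet> p' - snd h"
  have st: "s \<noteq> 0" "t \<noteq> 0" "s > 0 \<longleftrightarrow> t > 0" using side[OF z(2)] unfolding s_def t_def by auto
  have "(1 - u) * s + u * t = 0"
    using z(3) u(3) unfolding s_def t_def by (simp add: inner_add_right algebra_simps)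
  moreover have "(1 - u) * s + u * t \<noteq> 0"
  proof (cases "s > 0")
    case True
    then have "(1 - u) * s \<ge> 0" "u * t \<ge> 0" "u = 0 \<or> u * t > 0"
      using st u by (auto simp: zero_less_mult_iff)
    then show ?thesis using True st by (cases "u = 0") auto
  next
    case False
    then have "s < 0" "t < 0" using st by auto
    then have "(1 - u) * s \<le> 0" "u * t \<le> 0" "u = 0 \<or> u * t < 0"
      using u by (auto simp: mult_le_0_iff mult_less_0_iff)
    then show ?thesis using st by (cases "u = 0") auto
  qed
  ultimately show False by simp
qed

text \<open>Walls are avoided one at a time by moving along the normal of the new wall. Each wall
  excludes at most one parameter: the new one because its slope \<open>a \<bullet> a\<close> is
  non-zero, an old one because it is already avoided at parameter 0.\<close>

lemma generic_point:
  assumes E: "subspace E" and A: "finite A" "\<And>h. h \<in> A \<Longrightarrow> fst h \<in> E \<and> fst h \<noteq> 0"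
    and x: "x \<in> E" and e: "e > (0::real)"
  shows "\<exists>y\<in>E. dist y x < e \<and> (\<forall>h\<in>A. fst h \<bullet> y \<noteq> snd h)"
  using A e
proof (induction A arbitrary: e rule: finite_induct)
  case empty
  then show ?case using x by (intro bexI[of _ x]) auto
next
  case (insert h A)
  obtain y where y: "y \<in> E" "dist y x < e / 2" "\<And>h. h \<in> A \<Longrightarrow> fst h \<bullet> y \<noteq> snd h"
    using insert.IH[of "e / 2"] insert.prems by auto
  define a where "a = fst h"
  have a: "a \<in> E" "a \<noteq> 0" using insert.prems unfolding a_def by auto
  define \<delta> where "\<delta> = e / (2 * norm a)"
  have d: "\<delta> > 0" unfolding \<delta>_def using insert.prems a by simp
  define bad where "bad k = {t. fst k \<bullet> (y + t *\<^sub>R a) = snd k}" for k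
  have "finite (bad k)" if k: "k \<in> insert h A" for k
  proof -
    have "bad k \<subseteq> {(snd k - fst k \<bullet> y) / (fst k \<bullet> a)}"
    proof
      fix t assume "t \<in> bad k"
      then have t: "fst k \<bullet> y + t * (fst k \<bullet> a) = snd k" unfolding bad_def by (simp add: inner_add_right)
      have "fst k \<bullet> a \<noteq> 0"
      proof (cases "k = h")
        case True
        then show ?thesis using a unfolding a_def by simp
      next
        case False
        then have "fst k \<bullet> y \<noteq> snd k" using y(3) k by simp
        then show ?thesis using t by auto
      qed
      then show "t \<in> {(snd k - fst k \<bullet> y) / (fst k \<bullet> a)}" using t by (simp add: field_simps)
    qed
    then show ?thesis by (rule finite_subset) simp
  qed
  then have "finite (\<Union>k\<in>insert h A. bad k)" using insert.hyps by blast
  moreover have "infinite {0<..<\<delta>}" using d by simp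
  ultimately have "{0<..<\<delta>} - (\<Union>k\<in>insert h A. bad k) \<noteq> {}" by (metis Diff_infinite_finite finite.emptyI)
  then obtain t where "t \<in> {0<..<\<delta>} - (\<Union>k\<in>insert h A. bad k)" by blast
  then have t: "0 < t" "t < \<delta>" "\<And>k. k \<in> insert h A \<Longrightarrow> t \<notin> bad k" by auto
  show ?case
  proof (intro bexI[of _ "y + t *\<^sub>R a"] conjI ballI)
    show "y + t *\<^sub>R a \<in> E" using y(1) a(1) E by (intro subspace_add subspace_scale)
    have "t * norm a < \<delta> * norm a" using t a by (intro mult_strict_right_mono) auto
    also have "\<dots> = e / 2" unfolding \<delta>_def using a by simp
    finally have "dist (y + t *\<^sub>R a) y < e / 2" using t(1) by (simp add: dist_norm)
    then show "dist (y + t *\<^sub>R a) x < e" using y(2) dist_triangle[of "y + t *\<^sub>R a" x y] by linarith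
    fix k assume "k \<in> insert h A"
    then show "fst k \<bullet> (y + t *\<^sub>R a) \<noteq> snd k" using t(3) unfolding bad_def by blast
  qed
qed

text \<open>A vector orthogonal to all normals could be followed from a generic point of the interior
  without ever crossing a wall, so the set would be unbounded.\<close>
lemma walls_normals_total:
  assumes E: "subspace E" and W: "polytopal E W" "W \<noteq> {}" and A: "walls E W A"
    and v: "v \<in> E" "\<And>h. h \<in> A \<Longrightarrow> fst h \<bullet> v = 0"
  shows "v = 0"
proof (rule ccontr)
  assume nz: "v \<noteq> 0"
  define U where "U = top_of_set E interior_of W"
  have "U \<noteq> {}" using W unfolding polytopal_def U_def by auto
  then obtain x where x: "x \<in> U" by blast
  have "openin (top_of_set E) U" unfolding U_def by simp
  then have UE: "U \<subseteq> E" "\<exists>e>0. \<forall>y\<in>E. dist y x < e \<longrightarrow> y \<in> U"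
    using x unfolding openin_euclidean_subtopology_iff by auto
  then obtain e where e: "e > 0" "\<And>y. y \<in> E \<Longrightarrow> dist y x < e \<Longrightarrow> y \<in> U" by blast
  have xE: "x \<in> E" using x UE by blast
  have A': "finite A" "\<And>h. h \<in> A \<Longrightarrow> fst h \<in> E \<and> fst h \<noteq> 0" using A unfolding walls_def by auto
  obtain w where w: "w \<in> E" "dist w x < e" "\<And>h. h \<in> A \<Longrightarrow> fst h \<bullet> w \<noteq> snd h"
    using generic_point[OF E A' xE e(1)] by blast
  have wW: "w \<in> W" using e(2)[OF w(1,2)] interior_of_subset[of "top_of_set E" W] unfolding U_def by blast
  have "w + t *\<^sub>R v \<in> W" for t
  proof (rule same_side_mem[OF E A w(1) _ _ wW])
    show "w + t *\<^sub>R v \<in> E" using w(1) v(1) E by (intro subspace_add subspace_scale)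
    fix h assume h: "h \<in> A"
    show "fst h \<bullet> w \<noteq> snd h \<and> fst h \<bullet> (w + t *\<^sub>R v) \<noteq> snd h \<and> (fst h \<bullet> w > snd h \<longleftrightarrow> fst h \<bullet> (w + t *\<^sub>R v) > snd h)"
      using w(3)[OF h] v(2)[OF h] by (simp add: inner_add_right)
  qed
  moreover have "bounded W" using W(1) compact_imp_bounded unfolding polytopal_def by blast
  then obtain R where R: "\<And>x. x \<in> W \<Longrightarrow> norm x \<le> R" unfolding bounded_iff by blast
  ultimately have le: "norm (w + t *\<^sub>R v) \<le> R" for t by blast
  define t where "t = (R + norm w + 1) / norm v"
  have "R \<ge> 0" using order_trans[OF norm_ge_zero le] .
  then have "norm (t *\<^sub>R v) = R + norm w + 1" unfolding t_def using nz by simp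
  moreover have "norm (t *\<^sub>R v) \<le> norm (w + t *\<^sub>R v) + norm w"
    using norm_triangle_ineq4[of "w + t *\<^sub>R v" w] by simp
  ultimately show False using le[of t] by linarith
qed

lemma locally_constant_off_frontier:
  assumes "y \<in> E" "y \<notin> top_of_set E frontier_of W"
  shows "\<exists>\<delta>>0. \<forall>y'\<in>E. dist y' y < \<delta> \<longrightarrow> (y' \<in> W \<longleftrightarrow> y \<in> W)"
proof -
  have ball: "\<exists>\<delta>>0. \<forall>y'\<in>E. dist y' y < \<delta> \<longrightarrow> y' \<in> U" if "openin (top_of_set E) U" "y \<in> U" for U
    using that unfolding openin_euclidean_subtopology_iff by blast
  show ?thesis
  proof (cases "y \<in> top_of_set E interior_of W")
    case True
    obtain \<delta> where "\<delta> > 0" "\<forall>y'\<in>E. dist y' y < \<delta> \<longrightarrow> y' \<in> top_of_set E interior_of W"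
      using ball[OF openin_interior_of True] by blast
    then show ?thesis using interior_of_subset[of "top_of_set E" W] True by blast
  next
    case False
    then have "y \<notin> top_of_set E closure_of W" using assms(2) unfolding frontier_of_def by blast
    then have y: "y \<in> E - top_of_set E closure_of W" using assms(1) by blast
    have op: "openin (top_of_set E) (E - top_of_set E closure_of W)"
      using openin_diff[of "top_of_set E" E "top_of_set E closure_of W"] by simp
    obtain \<delta> where "\<delta> > 0" "\<forall>y'\<in>E. dist y' y < \<delta> \<longrightarrow> y' \<in> E - top_of_set E closure_of W"
      using ball[OF op y] by blast
    moreover have "E \<inter> W \<subseteq> top_of_set E closure_of W"
      using closure_of_subset_Int[of "top_of_set E" W] by simp
    ultimately show ?thesis using y by (intro exI[of _ \<delta>]) blast
  qed
qed

lemma card_image_le_if_determined: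
  assumes "finite (G ` A)" "\<And>x y. x \<in> A \<Longrightarrow> y \<in> A \<Longrightarrow> G x = G y \<Longrightarrow> F x = F y"
  shows "finite (F ` A)" "card (F ` A) \<le> card (G ` A)"
proof -
  have "F ` A = (\<lambda>v. F (inv_into A G v)) ` (G ` A)"
  proof -
    have "F (inv_into A G (G x)) = F x" if "x \<in> A" for x
      by (rule assms(2)) (use that in \<open>auto intro: inv_into_into f_inv_into_f\<close>)
    then show ?thesis unfolding image_image by (intro image_cong) auto
  qed
  then show "finite (F ` A)" "card (F ` A) \<le> card (G ` A)"
    using assms(1) card_image_le[OF assms(1)] by (auto simp del: image_image)
qed

section \<open>Patches and sublattices of a scheme\<close>

lemma
  assumes A: "subspace A" and B: "subspace B" and AB: "A \<inter> B = {0}" "{x + y |x y. x \<in> A \<and> y \<in> B} = UNIV"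
  shows proj_in: "proj A B x \<in> A" and proj_diff_in: "x - proj A B x \<in> B"
    and proj_unique: "a \<in> A \<Longrightarrow> x - a \<in> B \<Longrightarrow> proj A B x = a"
proof -
  have uniq: "a = a'" if "a \<in> A" "x - a \<in> B" "a' \<in> A" "x - a' \<in> B" for a a'
  proof -
    have "a - a' \<in> B" using subspace_diff[OF B that(4,2)] by simp
    moreover have "a - a' \<in> A" by (rule subspace_diff[OF A that(1,3)])
    ultimately have "a - a' \<in> {0}" using AB by blast
    then show ?thesis by simp
  qed
  have "x \<in> {x + y |x y. x \<in> A \<and> y \<in> B}" using AB by simp
  then obtain a0 y where "x = a0 + y" "a0 \<in> A" "y \<in> B" by blast
  then have "a0 \<in> A \<and> x - a0 \<in> B" by simp
  then have ex1: "\<exists>!a. a \<in> A \<and> x - a \<in> B" using uniq by blast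
  from theI'[OF ex1] show "proj A B x \<in> A" "x - proj A B x \<in> B" unfolding proj_def by auto
  show "a \<in> A \<Longrightarrow> x - a \<in> B \<Longrightarrow> proj A B x = a" unfolding proj_def by (rule the1_equality[OF ex1]) simp
qed

lemma linear_proj:
  assumes "subspace A" "subspace B" "A \<inter> B = {0}" "{x + y |x y. x \<in> A \<and> y \<in> B} = UNIV"
  shows "linear (proj A B)"
proof (rule linearI)
  fix x y
  show "proj A B (x + y) = proj A B x + proj A B y"
  proof (rule proj_unique[OF assms])
    show "proj A B x + proj A B y \<in> A" using proj_in[OF assms] assms(1) by (intro subspace_add)
    have "(x - proj A B x) + (y - proj A B y) \<in> B" using proj_diff_in[OF assms] assms(2) by (intro subspace_add)
    then show "x + y - (proj A B x + proj A B y) \<in> B" by (simp add: algebra_simps)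
  qed
next
  fix c x
  show "proj A B (c *\<^sub>R x) = c *\<^sub>R proj A B x"
  proof (rule proj_unique[OF assms])
    show "c *\<^sub>R proj A B x \<in> A" using proj_in[OF assms] assms(1) by (intro subspace_scale)
    have "c *\<^sub>R (x - proj A B x) \<in> B" using proj_diff_in[OF assms] assms(2) by (intro subspace_scale)
    then show "c *\<^sub>R x - c *\<^sub>R proj A B x \<in> B" by (simp add: scaleR_diff_right)
  qed
qed

text \<open>\<open>N\<close> is controlled only on \<open>E\<close>, so the usual compactness
  argument is run on the unit sphere of \<open>E\<close>: expansion in an orthonormal basis bounds
  \<open>N\<close> above, which makes it continuous, and its minimum on the sphere is
  positive.\<close>

lemma norm_on_equivalent:
  fixes N :: "'a::euclidean_space \<Rightarrow> real"
  assumes E: "subspace E" and N: "norm_on E N"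
  shows "\<exists>C>0. \<forall>x\<in>E. N x \<le> C * norm x \<and> norm x \<le> C * N x"
proof -
  have N0: "\<And>x. x \<in> E \<Longrightarrow> N x \<ge> 0" and Nz: "\<And>x. x \<in> E \<Longrightarrow> N x = 0 \<longleftrightarrow> x = 0"
    and Ns: "\<And>x c. x \<in> E \<Longrightarrow> N (c *\<^sub>R x) = \<bar>c\<bar> * N x"
    and Nt: "\<And>x y. x \<in> E \<Longrightarrow> y \<in> E \<Longrightarrow> N (x + y) \<le> N x + N y"
    using N unfolding norm_on_def by auto
  obtain Q where Q: "Q \<subseteq> E" "\<And>x. x \<in> Q \<Longrightarrow> norm x = 1" "pairwise orthogonal Q" "independent Q" "span Q = E"
    using orthonormal_basis_subspace[OF E] by metis
  have finQ: "finite Q" using Q(4) by (rule independent_imp_finite)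
  have sumN: "N (\<Sum>v\<in>F. c v *\<^sub>R v) \<le> (\<Sum>v\<in>F. \<bar>c v\<bar> * N v) \<and> (\<Sum>v\<in>F. c v *\<^sub>R v) \<in> E"
    if "finite F" "F \<subseteq> Q" for F c using that
  proof (induction F rule: finite_induct)
    case empty
    have "N 0 = 0" using Nz subspace_0[OF E] by blast
    then show ?case using subspace_0[OF E] by simp
  next
    case (insert v F)
    have v: "v \<in> E" using insert Q by auto
    have cv: "c v *\<^sub>R v \<in> E" using v E by (intro subspace_scale)
    have IH: "N (\<Sum>v\<in>F. c v *\<^sub>R v) \<le> (\<Sum>v\<in>F. \<bar>c v\<bar> * N v)" "(\<Sum>v\<in>F. c v *\<^sub>R v) \<in> E"
      using insert by auto
    have "N (c v *\<^sub>R v + (\<Sum>v\<in>F. c v *\<^sub>R v)) \<le> N (c v *\<^sub>R v) + N (\<Sum>v\<in>F. c v *\<^sub>R v)"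
      by (rule Nt[OF cv IH(2)])
    then show ?case using insert IH Ns[OF v] subspace_add[OF E cv IH(2)] by simp
  qed
  define C where "C = (\<Sum>v\<in>Q. N v) + 1"
  have C: "C > 0" unfolding C_def using N0 Q(1) by (intro add_nonneg_pos sum_nonneg) auto
  have upper: "N x \<le> C * norm x" if x: "x \<in> E" for x
  proof -
    obtain c where c: "x = (\<Sum>v\<in>Q. c v *\<^sub>R v)" using x Q(5) span_finite[OF finQ] by auto
    have cv: "\<bar>c v\<bar> \<le> norm x" if v: "v \<in> Q" for v
    proof -
      have "x \<bullet> v = (\<Sum>w\<in>Q. c w * (w \<bullet> v))" unfolding c by (simp add: inner_sum_left)
      also have "\<dots> = (\<Sum>w\<in>Q. if w = v then c v else 0)"
        using Q(3) Q(2)[OF v] v unfolding pairwise_def orthogonal_def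
        by (intro sum.cong) (auto simp: dot_square_norm)
      finally have "x \<bullet> v = c v" using v finQ by simp
      then show ?thesis using Cauchy_Schwarz_ineq2[of x v] Q(2)[OF v] by simp
    qed
    have "N x \<le> (\<Sum>v\<in>Q. \<bar>c v\<bar> * N v)" unfolding c using sumN[OF finQ] by blast
    also have "\<dots> \<le> (\<Sum>v\<in>Q. norm x * N v)" using cv N0 Q(1) by (intro sum_mono mult_right_mono) auto
    also have "\<dots> = norm x * (\<Sum>v\<in>Q. N v)" by (simp add: sum_distrib_left)
    also have "\<dots> \<le> norm x * C" unfolding C_def by (intro mult_left_mono) auto
    finally show ?thesis by (simp add: mult.commute)
  qed
  define K where "K = E \<inter> sphere 0 1"
  have cont: "continuous_on K N"
    unfolding continuous_on_iff
  proof (intro ballI allI impI)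
    fix x e :: real and y assume "y \<in> K" and e: "(0::real) < e"
    then have y: "y \<in> E" unfolding K_def by simp
    show "\<exists>d>0. \<forall>x'\<in>K. dist x' y < d \<longrightarrow> dist (N x') (N y) < e"
    proof (intro exI[of _ "e / C"] conjI ballI impI)
      show "e / C > 0" using e C by simp
      fix x' assume x': "x' \<in> K" "dist x' y < e / C"
      then have x'E: "x' \<in> E" unfolding K_def by simp
      have d: "x' - y \<in> E" "y - x' \<in> E" using y x'E E by (auto intro: subspace_diff)
      have "N x' \<le> N (x' - y) + N y" "N y \<le> N (y - x') + N x'"
        using Nt[OF d(1) y] Nt[OF d(2) x'E] by auto
      moreover have "C * norm (x' - y) < e" using x'(2) C by (simp add: dist_norm field_simps)
      ultimately show "dist (N x') (N y) < e"
        using upper[OF d(1)] upper[OF d(2)] by (simp add: dist_real_def norm_minus_commute)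
    qed
  qed
  have comp: "compact K" unfolding K_def by (intro closed_Int_compact closed_subspace[OF E]) auto
  have "\<exists>c>0. \<forall>x\<in>K. N x \<ge> c"
  proof (cases "K = {}")
    case False
    obtain z where z: "z \<in> K" "\<forall>x\<in>K. N z \<le> N x"
      using continuous_attains_inf[OF comp False cont] by blast
    then have "z \<in> E" "z \<noteq> 0" unfolding K_def by auto
    then have "N z > 0" using N0 Nz by (metis less_eq_real_def)
    then show ?thesis using z by blast
  qed (auto intro: exI[of _ 1])
  then obtain c where c: "c > 0" "\<And>x. x \<in> K \<Longrightarrow> N x \<ge> c" by blast
  have lower: "c * norm x \<le> N x" if x: "x \<in> E" for x
  proof (cases "x = 0")
    case False
    have "(1 / norm x) *\<^sub>R x \<in> K" unfolding K_def using x False E by (auto intro: subspace_scale)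
    then have "c \<le> N ((1 / norm x) *\<^sub>R x)" by (rule c)
    also have "\<dots> = N x / norm x" using Ns[OF x] by simp
    finally show ?thesis using False by (simp add: field_simps)
  next
    case True
    then have "N x = 0" using Nz x by blast
    then show ?thesis using True by simp
  qed
  show ?thesis
  proof (intro exI[of _ "max C (1 / c)"] conjI ballI)
    show "max C (1 / c) > 0" using C by simp
    fix x assume x: "x \<in> E"
    have "C * norm x \<le> max C (1 / c) * norm x" by (intro mult_right_mono) auto
    then show "N x \<le> max C (1 / c) * norm x" using upper[OF x] by linarith
    have "norm x \<le> (1 / c) * N x" using lower[OF x] c(1) by (simp add: field_simps)
    also have "\<dots> \<le> max C (1 / c) * N x" using N0[OF x] by (intro mult_right_mono) auto
    finally show "norm x \<le> max C (1 / c) * N x" .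
  qed
qed

lemma bij_betw_images:
  assumes "\<And>x y. x \<in> A \<Longrightarrow> y \<in> A \<Longrightarrow> F x = F y \<longleftrightarrow> G x = G y"
  shows "\<exists>h. bij_betw h (F ` A) (G ` A)"
proof
  define h where "h = G \<circ> inv_into A F"
  have h: "h (F x) = G x" if "x \<in> A" for x
  proof -
    have "inv_into A F (F x) \<in> A" "F (inv_into A F (F x)) = F x"
      using that by (auto intro: inv_into_into f_inv_into_f)
    then show ?thesis unfolding h_def comp_def using assms that by blast
  qed
  show "bij_betw h (F ` A) (G ` A)"
    unfolding bij_betw_def inj_on_def using h assms by (auto simp: image_iff)
qed

lemma finite_real_gap:
  assumes "finite (X :: real set)"
  obtains \<delta> where "\<delta> > 0" "\<And>x y. x \<in> X \<Longrightarrow> y \<in> X \<Longrightarrow> x < y \<Longrightarrow> x + \<delta> \<le> y"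
proof -
  define D where "D = insert 1 ((\<lambda>(x, y). y - x) ` {(x, y) \<in> X \<times> X. x < y})"
  have "finite {(x, y) \<in> X \<times> X. x < y}" by (rule finite_subset[of _ "X \<times> X"]) (use assms in auto)
  then have fin: "finite D" unfolding D_def by (intro finite.insertI finite_imageI)
  have "D \<noteq> {}" "\<forall>d\<in>D. d > 0" unfolding D_def by auto
  then have "Min D > 0" using fin by simp
  moreover have "x + Min D \<le> y" if xy: "x \<in> X" "y \<in> X" "x < y" for x y
  proof -
    have "(x, y) \<in> {(x, y) \<in> X \<times> X. x < y}" using xy by simp
    then have "y - x \<in> D" unfolding D_def by force
    then have "Min D \<le> y - x" using fin by simp
    then show ?thesis by simp
  qed
  ultimately show ?thesis by (rule that)
qed

section \<open>The lattice of a fixed scheme, its projections and its patches\<close>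

locale cut_project =
  fixes S :: "('e::euclidean_space, 'l) scheme" and N :: "'e \<Rightarrow> real"
  assumes scheme: "polytopal_scheme S" and norm: "norm_on (phys S) N"
begin

abbreviation "P \<equiv> phys S"
abbreviation "Q \<equiv> intl S"
abbreviation "\<Gamma> \<equiv> lat S"
abbreviation "pP \<equiv> pr_phys S"
abbreviation "pQ \<equiv> pr_intl S"

lemma subspace_P: "subspace P" and subspace_Q: "subspace Q"
  and Int_PQ: "P \<inter> Q = {0}" and sum_PQ: "{x + y |x y. x \<in> P \<and> y \<in> Q} = UNIV"
  and inj_pP: "inj_on pP \<Gamma>" and inj_pQ: "inj_on pQ \<Gamma>"
  and closure_pQ: "closure (pQ ` \<Gamma>) = Q"
  and window_cells: "window S = (\<Union>i\<in>labels S. cell S i)"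
  and finite_labels: "finite (labels S)"
  and full_lattice: "full_lattice \<Gamma>"
  and polytopal_window: "polytopal Q (window S)" and window_nonempty: "window S \<noteq> {}"
  and polytopal_cells: "\<forall>i\<in>labels S. polytopal Q (cell S i)"
  and nonsingular_cells:
    "\<forall>g\<in>\<Gamma>. \<forall>i\<in>labels S. pQ g \<notin> top_of_set Q frontier_of cell S i"
proof -
  note facts = scheme[unfolded polytopal_scheme_def]
  from facts show "subspace P" by (elim conjE)
  from facts show "subspace Q" by (elim conjE)
  from facts show "P \<inter> Q = {0}" by (elim conjE)
  from facts show "{x + y |x y. x \<in> P \<and> y \<in> Q} = UNIV" by (elim conjE)
  from facts show "inj_on pP \<Gamma>" by (elim conjE)
  from facts show "inj_on pQ \<Gamma>" by (elim conjE)
  from facts show "closure (pQ ` \<Gamma>) = Q" by (elim conjE)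
  from facts show "window S = (\<Union>i\<in>labels S. cell S i)" by (elim conjE)
  from facts show "finite (labels S)" by (elim conjE)
  from facts show "full_lattice \<Gamma>" by (elim conjE)
  from facts show "polytopal Q (window S)" by (elim conjE)
  from facts show "window S \<noteq> {}" by (elim conjE)
  from facts show "\<forall>i\<in>labels S. polytopal Q (cell S i)" by (elim conjE)
  from facts show "\<forall>g\<in>\<Gamma>. \<forall>i\<in>labels S. pQ g \<notin> top_of_set Q frontier_of cell S i" by (elim conjE)
qed

lemma polytopal_cell: "i \<in> labels S \<Longrightarrow> polytopal Q (cell S i)"
  using polytopal_cells by simp

lemma nonsingular: "g \<in> \<Gamma> \<Longrightarrow> i \<in> labels S \<Longrightarrow> pQ g \<notin> top_of_set Q frontier_of cell S i"
  using nonsingular_cells by simp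

lemma sum_QP: "{x + y |x y. x \<in> Q \<and> y \<in> P} = UNIV"
proof -
  have "{x + y |x y. x \<in> Q \<and> y \<in> P} = {x + y |x y. x \<in> P \<and> y \<in> Q}"
    by (intro Collect_cong) (blast intro: add.commute)
  then show ?thesis using sum_PQ by simp
qed

lemma Int_QP: "Q \<inter> P = {0}" using Int_PQ by blast

lemmas PQ = subspace_P subspace_Q Int_PQ sum_PQ
lemmas QP = subspace_Q subspace_P Int_QP sum_QP

lemma pP_in: "pP x \<in> P" unfolding pr_phys_def by (rule proj_in[OF PQ])
lemma pQ_in: "pQ x \<in> Q" unfolding pr_intl_def by (rule proj_in[OF QP])
lemma linear_pP: "linear pP" unfolding pr_phys_def by (rule linear_proj[OF PQ])
lemma linear_pQ: "linear pQ" unfolding pr_intl_def by (rule linear_proj[OF QP])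

lemma pP_plus_pQ: "pP x + pQ x = x"
proof -
  have "pQ x = x - pP x" unfolding pr_intl_def pr_phys_def
    using proj_diff_in[OF PQ, of x] proj_in[OF PQ, of x] by (intro proj_unique[OF QP]) auto
  then show ?thesis by simp
qed

lemma pQ_id: "x \<in> Q \<Longrightarrow> pQ x = x"
  unfolding pr_intl_def using subspace_0[OF subspace_P] by (intro proj_unique[OF QP]) auto

lemma pQ_eq_0_iff: "pQ x = 0 \<longleftrightarrow> x \<in> P"
proof
  assume "pQ x = 0"
  then have "pP x = x" using pP_plus_pQ[of x] by simp
  then show "x \<in> P" using pP_in[of x] by simp
next
  assume "x \<in> P"
  then show "pQ x = 0" unfolding pr_intl_def
    using subspace_0[OF subspace_Q] by (intro proj_unique[OF QP]) auto
qed

lemma kernel_pQ: "{x. pQ x = 0} = P" using pQ_eq_0_iff by blast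

lemma dim_plus: "dim P + dim Q = DIM('e)"
  using dim_sums_Int[OF subspace_P subspace_Q] unfolding sum_PQ Int_PQ by simp

lemma dense: 
  assumes "x \<in> Q" "e > 0" obtains g where "g \<in> \<Gamma>" "dist (pQ g) x < e"
  using assms closure_pQ closure_approachable[of x "pQ ` \<Gamma>"] by auto

text \<open>One constant serves to pass between \<open>N\<close>-balls of physical space and
  Euclidean balls of the ambient space, as long as internal parts stay bounded.\<close>

lemma norm_equiv:
  obtains C where "C > 0" "\<And>x. N (pP x) \<le> C * norm x" "\<And>x. norm x \<le> C * N (pP x) + norm (pQ x)"
    "\<And>x. N (pP x) \<ge> 0"
proof -
  obtain C where C: "C > 0" "\<And>x. x \<in> P \<Longrightarrow> N x \<le> C * norm x" "\<And>x. x \<in> P \<Longrightarrow> norm x \<le> C * N x"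
    using norm_on_equivalent[OF subspace_P norm] by blast
  obtain D where D: "D > 0" "\<And>x. norm (pP x) \<le> norm x * D"
    using bounded_linear.pos_bounded[of pP] linear_pP by (auto simp: linear_conv_bounded_linear)
  show ?thesis
  proof (rule that[of "max C (C * D)"])
    show "max C (C * D) > 0" using C by simp
    fix x
    show N0: "N (pP x) \<ge> 0" using norm pP_in unfolding norm_on_def by blast
    have "N (pP x) \<le> C * norm (pP x)" using C(2) pP_in by blast
    also have "\<dots> \<le> C * (norm x * D)" using C D by (intro mult_left_mono) auto
    also have "\<dots> = (C * D) * norm x" by simp
    also have "\<dots> \<le> max C (C * D) * norm x" by (intro mult_right_mono) auto
    finally show "N (pP x) \<le> max C (C * D) * norm x" .
    have "norm x \<le> norm (pP x) + norm (pQ x)" using norm_triangle_ineq[of "pP x" "pQ x"] pP_plus_pQ[of x] by simp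
    moreover have "norm (pP x) \<le> C * N (pP x)" using C(3) pP_in by blast
    moreover have "C * N (pP x) \<le> max C (C * D) * N (pP x)" using N0 by (intro mult_right_mono) auto
    ultimately show "norm x \<le> max C (C * D) * N (pP x) + norm (pQ x)" by linarith
  qed
qed

lemma N_triangle: "N (pP (x + y)) \<le> N (pP x) + N (pP y)"
proof -
  have "\<forall>x\<in>P. \<forall>y\<in>P. N (x + y) \<le> N x + N y" using norm unfolding norm_on_def by (elim conjE)
  then show ?thesis using pP_in by (simp add: linear_add[OF linear_pP])
qed

definition lbasis where "lbasis = (SOME B. independent B \<and> span B = UNIV \<and> zmod.span B = \<Gamma>)"

lemma lbasis: "independent lbasis" "span lbasis = UNIV" "zmod.span lbasis = \<Gamma>"
proof -
  have "\<exists>B. independent B \<and> span B = UNIV \<and> zmod.span B = \<Gamma>"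
    using full_lattice unfolding full_lattice_def .
  from someI_ex[OF this] show "independent lbasis" "span lbasis = UNIV" "zmod.span lbasis = \<Gamma>"
    unfolding lbasis_def by auto
qed

lemma card_lbasis: "card lbasis = DIM('e)"
  using lbasis by (metis dim_UNIV dim_eq_card_independent dim_span)

lemma lat_subgroup: "zmod.subspace \<Gamma>" using lbasis(3) zmod.subspace_span by metis

lemma lat_add: "x \<in> \<Gamma> \<Longrightarrow> y \<in> \<Gamma> \<Longrightarrow> x + y \<in> \<Gamma>" using lat_subgroup zmod.subspace_add by blast
lemma lat_diff: "x \<in> \<Gamma> \<Longrightarrow> y \<in> \<Gamma> \<Longrightarrow> x - y \<in> \<Gamma>" using lat_subgroup zmod.subspace_diff by blast
lemma lat_scale: "x \<in> \<Gamma> \<Longrightarrow> of_int m *\<^sub>R x \<in> \<Gamma>" using lat_subgroup zmod.subspace_scale by blast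
lemma lat_0: "0 \<in> \<Gamma>" using lat_subgroup zmod.subspace_0 by blast

lemma lat_pQ_eq_0: "g \<in> \<Gamma> \<Longrightarrow> pQ g = 0 \<Longrightarrow> g = 0"
  using inj_pQ lat_0 linear_0[OF linear_pQ] by (metis inj_onD)

lemma finite_lat_ball: "finite {g \<in> \<Gamma>. norm g \<le> r}"
  using finite_zspan_ball[OF lbasis(1)] lbasis(3) by simp

text \<open>A patch is recorded by lattice differences from its centre, so that it depends only on
  the internal coordinate of the centre. It makes sense at every point of internal space, which
  allows centres to be moved off the lattice.\<close>

definition local_patch :: "real \<Rightarrow> 'e \<Rightarrow> ('e \<times> 'l) set"
  where "local_patch r x = {(h, i). h \<in> \<Gamma> \<and> N (pP h) \<le> r \<and> i \<in> labels S \<and> x + pQ h \<in> cell S i}"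

definition acc :: "'e set" where "acc = {g \<in> \<Gamma>. pQ g \<in> window S}"

lemma star_pP: "g \<in> \<Gamma> \<Longrightarrow> star S (pP g) = pQ g"
proof -
  assume g: "g \<in> \<Gamma>"
  then have "(THE h. h \<in> \<Gamma> \<and> pP h = pP g) = g" using inj_pP by (auto simp: inj_on_def)
  then show ?thesis unfolding star_def by simp
qed

lemma cp_set_eq: "cp_set S = pP ` acc"
  unfolding cp_set_def acc_def by (auto simp: star_pP)

lemma patch_eq:
  assumes g: "g \<in> \<Gamma>"
  shows "patch S N r (pP g) = (\<lambda>(h, i). (pP (g + h), i)) ` local_patch r (pQ g)"
proof (intro equalityI subsetI)
  fix p assume "p \<in> patch S N r (pP g)"
  then obtain y i where p: "p = (y, i)" "y \<in> cp_set S" "N (y - pP g) \<le> r" "i \<in> labels S" "star S y \<in> cell S i"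
    unfolding patch_def by blast
  then obtain h where h: "h \<in> \<Gamma>" "y = pP h" unfolding cp_set_eq acc_def by blast
  have "(h - g, i) \<in> local_patch r (pQ g)"
    unfolding local_patch_def using p h g lat_diff
    by (auto simp: linear_diff[OF linear_pP] linear_diff[OF linear_pQ] star_pP)
  moreover have "p = (\<lambda>(h, i). (pP (g + h), i)) (h - g, i)" using p h by simp
  ultimately show "p \<in> (\<lambda>(h, i). (pP (g + h), i)) ` local_patch r (pQ g)" by blast
next
  fix p assume "p \<in> (\<lambda>(h, i). (pP (g + h), i)) ` local_patch r (pQ g)"
  then obtain h i where p: "p = (pP (g + h), i)" "h \<in> \<Gamma>" "N (pP h) \<le> r" "i \<in> labels S" "pQ (g + h) \<in> cell S i"
    unfolding local_patch_def by (auto simp: linear_add[OF linear_pQ])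
  have gh: "g + h \<in> \<Gamma>" using g p lat_add by blast
  have "pQ (g + h) \<in> window S" using p window_cells by blast
  then have "pP (g + h) \<in> cp_set S" unfolding cp_set_eq acc_def using gh by blast
  moreover have "pP (g + h) - pP g = pP h" by (simp add: linear_add[OF linear_pP])
  ultimately show "p \<in> patch S N r (pP g)"
    unfolding patch_def using p star_pP[OF gh] by simp
qed

text \<open>Translating one centre to the other leaves lattice differences unchanged, and
  injectivity of \<open>pP\<close> on the lattice recovers these differences from physical
  positions.\<close>

lemma patch_rel_iff:
  assumes g: "g \<in> acc" and g': "g' \<in> acc"
  shows "(pP g, pP g') \<in> patch_rel S N r \<longleftrightarrow> local_patch r (pQ g) = local_patch r (pQ g')"
proof -
  have G: "g \<in> \<Gamma>" "g' \<in> \<Gamma>" using g g' unfolding acc_def by auto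
  define T where "T = (\<lambda>(h, i :: 'l). (pP (g' + h), i))"
  have "(\<lambda>(z, i). (z + (pP g' - pP g), i)) ` patch S N r (pP g) = T ` local_patch r (pQ g)"
    unfolding patch_eq[OF G(1)] image_image T_def
    by (intro image_cong) (auto simp: linear_add[OF linear_pP])
  moreover have "patch S N r (pP g') = T ` local_patch r (pQ g')" unfolding patch_eq[OF G(2)] T_def ..
  moreover have "inj_on T (\<Gamma> \<times> UNIV)"
  proof (rule inj_onI, clarify)
    fix h i h' i' assume h: "h \<in> \<Gamma>" "h' \<in> \<Gamma>" "T (h, i) = T (h', i')"
    then have "g' + h = g' + h'"
      using inj_onD[OF inj_pP _ lat_add[OF G(2) h(1)] lat_add[OF G(2) h(2)]] unfolding T_def by simp
    then show "h = h' \<and> i = i'" using h unfolding T_def by simp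
  qed
  moreover have "local_patch r x \<subseteq> \<Gamma> \<times> UNIV" for x unfolding local_patch_def by auto
  ultimately have "(\<lambda>(z, i). (z + (pP g' - pP g), i)) ` patch S N r (pP g) = patch S N r (pP g')
      \<longleftrightarrow> local_patch r (pQ g) = local_patch r (pQ g')"
    by (simp add: inj_on_image_eq_iff)
  then show ?thesis unfolding patch_rel_def using g g' by (auto simp: cp_set_eq)
qed

lemma patch_classes_bij:
  "\<exists>h. bij_betw h (patch_classes S N r) ((\<lambda>g. local_patch r (pQ g)) ` acc)"
proof -
  have img: "patch_rel S N r `` {pP g} = pP ` {g' \<in> acc. local_patch r (pQ g) = local_patch r (pQ g')}"
    if g: "g \<in> acc" for g
  proof -
    have "patch_rel S N r `` {pP g} \<subseteq> pP ` acc" unfolding patch_rel_def cp_set_eq by auto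
    then show ?thesis using patch_rel_iff[OF g] by auto
  qed
  have "patch_classes S N r = (\<lambda>g. patch_rel S N r `` {pP g}) ` acc"
    unfolding patch_classes_def quotient_def cp_set_eq by auto
  moreover have "\<exists>h. bij_betw h ((\<lambda>g. patch_rel S N r `` {pP g}) ` acc) ((\<lambda>g. local_patch r (pQ g)) ` acc)"
  proof (rule bij_betw_images)
    fix g g' assume g: "g \<in> acc" "g' \<in> acc"
    show "patch_rel S N r `` {pP g} = patch_rel S N r `` {pP g'} \<longleftrightarrow> local_patch r (pQ g) = local_patch r (pQ g')"
    proof
      assume "patch_rel S N r `` {pP g} = patch_rel S N r `` {pP g'}"
      moreover have "(pP g', pP g') \<in> patch_rel S N r" using patch_rel_iff[OF g(2,2)] by simp
      ultimately have "(pP g, pP g') \<in> patch_rel S N r" by blast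
      then show "local_patch r (pQ g) = local_patch r (pQ g')" using patch_rel_iff[OF g] by simp
    qed (simp add: img g)
  qed
  ultimately show ?thesis by simp
qed

lemma card_patch_classes:
  "finite (patch_classes S N r) \<longleftrightarrow> finite ((\<lambda>g. local_patch r (pQ g)) ` acc)"
  "card (patch_classes S N r) = card ((\<lambda>g. local_patch r (pQ g)) ` acc)"
  using patch_classes_bij[of r] bij_betw_finite bij_betw_same_card by blast+

section \<open>Stabilisers of hyperplane directions and their ranks\<close>

definition stab :: "'e \<Rightarrow> 'e set" where "stab a = {g \<in> \<Gamma>. a \<bullet> pQ g = 0}"

lemma linear_inner_pQ: "linear (\<lambda>x. a \<bullet> pQ x)"
  by (rule linearI) (simp_all add: linear_add[OF linear_pQ] linear_cmul[OF linear_pQ] inner_add_right)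

lemma stab_subgroup: "zmod.subspace (stab a)"
  unfolding stab_def zmod.subspace_def
  using linear_inner_pQ[of a] by (auto simp: lat_0 lat_add lat_scale linear_0[OF linear_inner_pQ]
    linear_add[OF linear_inner_pQ] linear_cmul[OF linear_inner_pQ])

lemma subgroup_basis:
  assumes "zmod.subspace G" "G \<subseteq> \<Gamma>"
  obtains B where "independent B" "zmod.span B = G" "card B = free_rank G" "span B = span G"
proof -
  obtain B where B: "independent B" "zmod.span B = G"
    using subgroup_zbasis[OF independent_imp_finite[OF lbasis(1)] lbasis(1), of G] assms lbasis(3) by auto
  have "span B = span G"
  proof
    show "span B \<subseteq> span G" using B(2) zmod.span_superset[of B] by (intro span_mono) simp
    show "span G \<subseteq> span B" using B(2) zspan_subset_span[of B] by (intro span_minimal) auto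
  qed
  then show ?thesis using that[of B] B free_rank_eq_card[OF B(1)] by simp
qed

lemma free_rank_eq_dim:
  assumes "zmod.subspace G" "G \<subseteq> \<Gamma>"
  shows "free_rank G = dim (span G)"
  using subgroup_basis[OF assms] by (metis dim_eq_card_independent dim_span)

lemma rk_hyperplane: "rk S {x \<in> Q. a \<bullet> x = 0} = free_rank (stab a)"
  unfolding rk_def stabiliser_def stab_def using pQ_in by simp

text \<open>A lattice vector on which all functionals vanish has internal part 0 and is therefore 0,
  as \<open>pQ\<close> is injective on the lattice; so \<open>rank_sum_ge\<close> applies. This is
  the half of the rank equation that holds without property C.\<close>

lemma normal_rank_ge:
  assumes "finite I" "\<And>x. x \<in> Q \<Longrightarrow> (\<And>i. i \<in> I \<Longrightarrow> a i \<bullet> x = 0) \<Longrightarrow> x = 0"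
  shows "DIM('e) \<le> (\<Sum>i\<in>I. DIM('e) - free_rank (stab (a i)))"
proof -
  have "x = 0" if "x \<in> zmod.span lbasis" "\<And>i. i \<in> I \<Longrightarrow> a i \<bullet> pQ x = 0" for x
    using assms(2)[of "pQ x"] pQ_in that lat_pQ_eq_0 unfolding lbasis(3) by blast
  from rank_sum_ge[OF lbasis(1) assms(1), of "\<lambda>i x. a i \<bullet> pQ x", OF linear_inner_pQ this]
  show ?thesis unfolding card_lbasis lbasis(3) stab_def .
qed

lemma hyperplane_differences:
  assumes "w \<in> Q" "a \<bullet> w = b"
  shows "{x - y |x y. x \<in> {x \<in> Q. a \<bullet> x = b} \<and> y \<in> {x \<in> Q. a \<bullet> x = b}} = {x \<in> Q. a \<bullet> x = 0}"
proof (intro equalityI subsetI)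
  fix z assume "z \<in> {x - y |x y. x \<in> {x \<in> Q. a \<bullet> x = b} \<and> y \<in> {x \<in> Q. a \<bullet> x = b}}"
  then show "z \<in> {x \<in> Q. a \<bullet> x = 0}" using subspace_diff[OF subspace_Q] by (auto simp: inner_diff_right)
next
  fix z assume "z \<in> {x \<in> Q. a \<bullet> x = 0}"
  then have "z = (z + w) - w" "z + w \<in> {x \<in> Q. a \<bullet> x = b}" "w \<in> {x \<in> Q. a \<bullet> x = b}"
    using assms subspace_add[OF subspace_Q] by (auto simp: inner_add_right)
  then show "z \<in> {x - y |x y. x \<in> {x \<in> Q. a \<bullet> x = b} \<and> y \<in> {x \<in> Q. a \<bullet> x = b}}" by blast
qed

section \<open>The rank condition bounds the complexity\<close>

lemma dim_Q_pos: "dim Q \<ge> 1"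
  using scheme unfolding polytopal_scheme_def by (elim conjE)

lemma bounded_window: "bounded (window S)"
proof (rule compact_imp_bounded)
  show "compact (window S)" using polytopal_window unfolding polytopal_def by (elim conjE)
qed

text \<open>Growth exponent for the relevant translates of a hyperplane with normal
  \<open>a\<close>: in slabs of bounded internal width, the lattice grows with exponent
  \<open>dim P\<close> and \<open>stab a\<close> with exponent
  \<open>dim (span (stab a) \<inter> P)\<close>.\<close>

definition exponent :: "'e \<Rightarrow> nat"
  where "exponent a = dim P - dim (span (stab a) \<inter> P)"

lemma stab_subset: "stab a \<subseteq> \<Gamma>" unfolding stab_def by auto

text \<open>Physical space and \<open>span (stab a)\<close> both lie in the kernel of the non-zero
  functional x \<mapsto> a \<bullet> pQ x, so their sum has dimension at most k - 1. The dimension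
  formula for sums turns this into the claim.\<close>

lemma exponent_bound:
  assumes "a \<in> Q" "a \<noteq> 0"
  shows "exponent a + free_rank (stab a) + 1 \<le> DIM('e)"
proof -
  define L where "L = span (stab a)"
  define H where "H = {x. a \<bullet> pQ x = 0}"
  have subL: "subspace L" unfolding L_def by simp
  have subH: "subspace H" unfolding H_def by (rule linear_subspace_kernel[OF linear_inner_pQ])
  have "{x + y |x y. x \<in> L \<and> y \<in> P} \<subseteq> H"
  proof -
    have "L \<subseteq> H" unfolding L_def by (rule span_minimal[OF _ subH]) (auto simp: H_def stab_def)
    moreover have "P \<subseteq> H"
      using pQ_eq_0_iff inner_zero_right unfolding H_def by (metis (mono_tags) mem_Collect_eq subsetI)
    ultimately show ?thesis using subspace_add[OF subH] by blast
  qed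
  then have "dim {x + y |x y. x \<in> L \<and> y \<in> P} \<le> dim H" by (rule dim_subset)
  moreover have "dim H < DIM('e)"
  proof -
    have "a \<notin> H" unfolding H_def using assms pQ_id by simp
    then have "span H \<noteq> UNIV" using span_eq_iff subH by (metis UNIV_I)
    then have "dim H \<noteq> DIM('e)" by (simp add: dim_eq_full)
    then show ?thesis using dim_subset_UNIV[of H] by simp
  qed
  moreover have "dim {x + y |x y. x \<in> L \<and> y \<in> P} + dim (L \<inter> P) = dim L + dim P"
    by (rule dim_sums_Int[OF subL subspace_P])
  moreover have "dim L = free_rank (stab a)"
    unfolding L_def by (simp add: free_rank_eq_dim[OF stab_subgroup stab_subset])
  moreover have "dim (L \<inter> P) \<le> dim P" by (rule dim_subset) auto
  ultimately show ?thesis unfolding exponent_def L_def by linarith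
qed

text \<open>The values are constant on cosets of \<open>stab a\<close>, and the kernel of
  \<open>pQ\<close> is physical space, so \<open>count_cosets\<close> yields precisely this
  exponent.\<close>

lemma count_values:
  "\<exists>C r0. C > 0 \<and> (\<forall>r\<ge>r0. real (card ((\<lambda>x. a \<bullet> pQ x) ` {x \<in> \<Gamma>. norm x \<le> r \<and> norm (pQ x) \<le> c}))
    \<le> C * r ^ exponent a)"
proof -
  obtain B where B: "independent B" "zmod.span B = stab a" "span B = span (stab a)"
    using subgroup_basis[OF stab_subgroup stab_subset] by metis
  have "a \<bullet> pQ (x + g) = a \<bullet> pQ x" if "g \<in> zmod.span B" for x g
    using that unfolding B(2) stab_def by (simp add: linear_add[OF linear_pQ] inner_add_right)
  then show ?thesis
    using count_cosets[OF lbasis(1) linear_pQ B(1), of "\<lambda>x. a \<bullet> pQ x" c]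
    unfolding B(2,3) lbasis(2,3) kernel_pQ exponent_def using stab_subset by simp
qed

definition perp :: "'e \<Rightarrow> 'e set" where "perp a = {x \<in> Q. a \<bullet> x = 0}"

text \<open>A flag needs \<open>dim Q\<close> different hyperplanes. If
  \<open>perp a = perp a'\<close>, the component of \<open>a'\<close> orthogonal to \<open>a\<close>
  is orthogonal to \<open>a'\<close> as well and hence 0, which contradicts independence.\<close>

lemma normals_flag:
  assumes B: "independent B" "B \<subseteq> Q" "Q \<subseteq> span B"
    and sup: "\<And>a. a \<in> B \<Longrightarrow> perp a \<in> hyperplanes0 S"
  shows "perp ` B \<in> flags0 S" "inj_on perp B"
proof -
  show inj: "inj_on perp B"
  proof (rule inj_onI, rule ccontr)
    fix a a' assume a: "a \<in> B" "a' \<in> B" "perp a = perp a'" "a \<noteq> a'"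
    have nz: "a \<noteq> 0" using B(1) a(1) dependent_zero by blast
    define x where "x = a' - ((a \<bullet> a') / (a \<bullet> a)) *\<^sub>R a"
    have "x \<in> Q" unfolding x_def using a B(2) subspace_Q by (intro subspace_diff subspace_scale) auto
    moreover have ax: "a \<bullet> x = 0" unfolding x_def using nz by (simp add: inner_diff_right)
    ultimately have "x \<in> perp a'" using a(3) unfolding perp_def by auto
    then have "a' \<bullet> x = 0" unfolding perp_def by simp
    then have "x \<bullet> x = 0" using ax by (subst (1) x_def) (simp add: inner_diff_left)
    then have "a' = ((a \<bullet> a') / (a \<bullet> a)) *\<^sub>R a" unfolding x_def by simp
    then have "a' \<in> span {a}" by (metis span_base span_scale singletonI)
    then have "a' \<in> span (B - {a'})" using a span_mono[of "{a}" "B - {a'}"] by blast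
    then show False using B(1) a(2) unfolding dependent_def by blast
  qed
  have finB: "finite B" using B(1) by (rule independent_imp_finite)
  have "card B = dim Q" using B by (intro basis_card_eq_dim) auto
  moreover have "\<Inter> (perp ` B) = {0}"
  proof -
    \<comment> \<open>The intersection of no sets is the whole type, so here the positive dimension
      of internal space matters.\<close>
    have "B \<noteq> {}"
    proof
      assume "B = {}"
      then have "dim Q = 0" using \<open>card B = dim Q\<close> by simp
      then show False using dim_Q_pos by linarith
    qed
    moreover have "x = 0" if x: "\<forall>a\<in>B. x \<in> perp a" "x \<in> Q" for x
    proof -
      have "orthogonal x x"
        by (rule orthogonal_to_span[of x B]) (use x B(3) in \<open>auto simp: perp_def orthogonal_def inner_commute\<close>)
      then show ?thesis by (simp add: orthogonal_def)
    qed
    moreover have "0 \<in> perp a" for a unfolding perp_def using subspace_0[OF subspace_Q] by simp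
    ultimately show ?thesis unfolding perp_def by auto
  qed
  ultimately show "perp ` B \<in> flags0 S"
    unfolding flags0_def using sup finB card_image[OF inj] by auto
qed

lemma perp_in_hyperplanes0:
  assumes "i \<in> labels S" "properly_supporting Q (cell S i) (hyp Q h)"
  shows "perp (fst h) \<in> hyperplanes0 S"
proof -
  obtain w where w: "w \<in> hyp Q h" using assms(2) unfolding properly_supporting_def by blast
  then have w': "w \<in> Q" "fst h \<bullet> w = snd h" unfolding hyp_def by auto
  have "{x - y |x y. x \<in> hyp Q h \<and> y \<in> hyp Q h} = perp (fst h)"
    using hyperplane_differences[OF w'] unfolding hyp_def perp_def .
  then show ?thesis using assms unfolding hyperplanes0_def hyperplanes_def by blast
qed

lemma property_C_if_flags:
  assumes flags: "\<And>f. f \<in> flags0 S \<Longrightarrow> (\<Sum>V\<in>f. rk S V) = DIM('e) * (dim Q - 1)"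
  shows "property_C S N"
proof -
  have "\<exists>A. walls Q (cell S i) A" if "i \<in> labels S" for i
    using polytopal_walls[OF polytopal_cell[OF that]] .
  then obtain \<A> where \<A>: "\<And>i. i \<in> labels S \<Longrightarrow> walls Q (cell S i) (\<A> i)" by metis
  define A where "A = (\<Union>i\<in>labels S. \<A> i)"
  have finA: "finite A" unfolding A_def using finite_labels \<A> unfolding walls_def by blast
  have normA: "fst h \<in> Q" "fst h \<noteq> 0" "perp (fst h) \<in> hyperplanes0 S" if "h \<in> A" for h
  proof -
    obtain i where i: "i \<in> labels S" "h \<in> \<A> i" using \<open>h \<in> A\<close> unfolding A_def by blast
    then show "fst h \<in> Q" "fst h \<noteq> 0" using \<A>[OF i(1)] unfolding walls_def by auto
    have "properly_supporting Q (cell S i) (hyp Q h)" using \<A>[OF i(1)] i(2) unfolding walls_def by blast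
    then show "perp (fst h) \<in> hyperplanes0 S" by (rule perp_in_hyperplanes0[OF i(1)])
  qed
  have total: "v = 0" if v: "v \<in> Q" "\<And>h. h \<in> A \<Longrightarrow> fst h \<bullet> v = 0" for v
  proof -
    obtain i where i: "i \<in> labels S" "cell S i \<noteq> {}" using window_nonempty window_cells by blast
    show ?thesis
      by (rule walls_normals_total[OF subspace_Q polytopal_cell[OF i(1)] i(2) \<A>[OF i(1)] v(1)])
        (use v(2) i(1) in \<open>auto simp: A_def\<close>)
  qed
  \<comment> \<open>A vector of \<open>Q\<close> orthogonal to all normals vanishes since the window
    is bounded; hence every independent set of normals extends to a basis of normals, that is, to a
    flag.\<close>
  have spanM: "span (fst ` A) = Q"
  proof (rule ccontr)
    assume neq: "span (fst ` A) \<noteq> Q"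
    have "fst ` A \<subseteq> Q" using normA(1) by blast
    then have "span (fst ` A) \<subseteq> Q" using subspace_Q by (rule span_minimal)
    then have "span (fst ` A) \<subset> span Q" using neq span_eq_iff subspace_Q by (metis psubsetI)
    then obtain x where x: "x \<noteq> 0" "x \<in> span Q" "\<And>y. y \<in> span (fst ` A) \<Longrightarrow> orthogonal x y"
      using orthogonal_to_subspace_exists_gen by blast
    have "x \<in> Q" using x(2) span_eq_iff subspace_Q by metis
    moreover have "fst h \<bullet> x = 0" if h: "h \<in> A" for h
      using x(3)[of "fst h"] span_base[of "fst h" "fst ` A"] h by (simp add: orthogonal_def inner_commute)
    ultimately show False using total x(1) by blast
  qed
  \<comment> \<open>Over a basis of normals, \<open>exponent_bound\<close> and the flag hypothesis
    give at most nk - n - k(n - 1) = k - n = dim P. The vectors added to complete the basis have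
    exponents at least 0.\<close>
  have expsum: "(\<Sum>a\<in>fst ` g. exponent a) \<le> dim P" if g: "g \<subseteq> A" "independent (fst ` g)" for g
  proof -
    obtain B where B: "fst ` g \<subseteq> B" "B \<subseteq> fst ` A" "independent B" "fst ` A \<subseteq> span B"
      using maximal_independent_subset_extend[of "fst ` g" "fst ` A"] g by blast
    have finB: "finite B" using B(3) by (rule independent_imp_finite)
    have BQ: "B \<subseteq> Q" using B(2) normA(1) by blast
    have QB: "Q \<subseteq> span B" using spanM B(4) by (metis span_minimal subspace_span)
    have pB: "perp a \<in> hyperplanes0 S" if "a \<in> B" for a using that B(2) normA(3) by blast
    have fl: "perp ` B \<in> flags0 S" "inj_on perp B" using normals_flag[OF B(3) BQ QB pB] by blast+
    have cardB: "card B = dim Q" using B(3) BQ QB by (intro basis_card_eq_dim) auto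
    have "(\<Sum>a\<in>B. free_rank (stab a)) = (\<Sum>V\<in>perp ` B. rk S V)"
      unfolding sum.reindex[OF fl(2)] comp_def perp_def rk_hyperplane ..
    also have "\<dots> = DIM('e) * (dim Q - 1)" by (rule flags[OF fl(1)])
    finally have rks: "(\<Sum>a\<in>B. free_rank (stab a)) = DIM('e) * (dim Q - 1)" .
    have "(\<Sum>a\<in>B. exponent a + free_rank (stab a) + 1) \<le> (\<Sum>a\<in>B. DIM('e))"
    proof (rule sum_mono)
      fix a assume "a \<in> B"
      then obtain h where "h \<in> A" "a = fst h" using B(2) by blast
      then have "a \<in> Q" "a \<noteq> 0" using normA by simp_all
      then show "exponent a + free_rank (stab a) + 1 \<le> DIM('e)" by (rule exponent_bound)
    qed
    then have "(\<Sum>a\<in>B. exponent a) + DIM('e) * (dim Q - 1) + dim Q \<le> dim Q * DIM('e)"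
      by (simp only: sum.distrib rks) (simp add: cardB)
    moreover have "dim Q * DIM('e) = DIM('e) * (dim Q - 1) + DIM('e)"
      using dim_Q_pos by (cases "dim Q") auto
    ultimately have "(\<Sum>a\<in>B. exponent a) \<le> dim P" using dim_plus by linarith
    moreover have "(\<Sum>a\<in>fst ` g. exponent a) \<le> (\<Sum>a\<in>B. exponent a)"
      by (rule sum_mono2[OF finB B(1)]) simp
    ultimately show ?thesis by linarith
  qed
  obtain R where R: "\<And>x. x \<in> window S \<Longrightarrow> norm x \<le> R"
    using bounded_window unfolding bounded_iff by blast
  obtain K where K: "K > 0" "\<And>x. N (pP x) \<le> K * norm x" "\<And>x. norm x \<le> K * N (pP x) + norm (pQ x)"
    "\<And>x. N (pP x) \<ge> 0"
    by (rule norm_equiv) (rule that; assumption)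
  \<comment> \<open>Two points of a window of radius \<open>R\<close> differ by at most
    \<open>2 * R\<close>, so only these lattice differences can occur in a patch around an accepted
    point, whatever its centre.\<close>
  define Rel where "Rel r = {h \<in> \<Gamma>. N (pP h) \<le> r \<and> norm (pQ h) \<le> 2 * R}" for r
  \<comment> \<open>The condition \<open>r \<ge> 2 * R\<close> lets the extra 1 in
    \<open>K + 1\<close> absorb the internal part.\<close>
  have Relsub: "Rel r \<subseteq> {h \<in> \<Gamma>. norm h \<le> (K + 1) * r \<and> norm (pQ h) \<le> 2 * R}" if r: "r \<ge> 2 * R" for r
  proof
    fix h assume h: "h \<in> Rel r"
    then have "K * N (pP h) \<le> K * r" using K(1) unfolding Rel_def by simp
    then have "norm h \<le> (K + 1) * r" using K(3)[of h] h r unfolding Rel_def by (auto simp: distrib_right)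
    then show "h \<in> {h \<in> \<Gamma>. norm h \<le> (K + 1) * r \<and> norm (pQ h) \<le> 2 * R}" using h unfolding Rel_def by simp
  qed
  have finRel: "finite (Rel r)" if "r \<ge> 2 * R" for r
    by (rule finite_subset[OF Relsub[OF that]]) (rule finite_subset[OF _ finite_lat_ball[of "(K + 1) * r"]], blast)
  define LP where "LP r x = {(h, i). h \<in> Rel r \<and> i \<in> labels S \<and> x + pQ h \<in> cell S i}" for r x
  have local_LP: "local_patch r (pQ g) = LP r (pQ g)" if g: "g \<in> acc" for r g
  proof -
    have "norm (pQ h) \<le> 2 * R" if "i \<in> labels S" "pQ g + pQ h \<in> cell S i" for h i
    proof -
      have "pQ g + pQ h \<in> window S" using that window_cells by blast
      then have "norm (pQ g + pQ h) \<le> R" by (rule R)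
      moreover have "norm (pQ g) \<le> R" using g R unfolding acc_def by blast
      ultimately show ?thesis using norm_triangle_ineq4[of "pQ g + pQ h" "pQ g"] by simp
    qed
    then show ?thesis unfolding local_patch_def LP_def Rel_def by blast
  qed
  define Gen where "Gen r = {x \<in> Q. \<forall>k\<in>A. \<forall>h\<in>Rel r. fst k \<bullet> (x + pQ h) \<noteq> snd k}" for r
  \<comment> \<open>Non-singularity keeps \<open>pQ (g + h)\<close> off the frontiers of the cells,
    but it may still lie on a wall hyperplane away from the frontier. Only finitely many memberships
    are involved, and each is locally constant, so a small shift to a generic point preserves all of
    them.\<close>
  have perturb: "LP r (pQ g) \<in> LP r ` Gen r" if g: "g \<in> acc" and r: "r \<ge> 2 * R" for g r
  proof -
    have gl: "g \<in> \<Gamma>" using g unfolding acc_def by simp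
    have "\<exists>\<delta>>0. \<forall>y'\<in>Q. dist y' (pQ (g + h)) < \<delta> \<longrightarrow> (y' \<in> cell S i \<longleftrightarrow> pQ (g + h) \<in> cell S i)"
      if "h \<in> Rel r" "i \<in> labels S" for h i
      using that gl lat_add unfolding Rel_def
      by (intro locally_constant_off_frontier pQ_in nonsingular) auto
    then obtain \<delta> where \<delta>: "\<And>h i. h \<in> Rel r \<Longrightarrow> i \<in> labels S \<Longrightarrow> \<delta> h i > 0"
      "\<And>h i y'. h \<in> Rel r \<Longrightarrow> i \<in> labels S \<Longrightarrow> y' \<in> Q \<Longrightarrow> dist y' (pQ (g + h)) < \<delta> h i \<Longrightarrow>
         (y' \<in> cell S i \<longleftrightarrow> pQ (g + h) \<in> cell S i)" by metis
    define D where "D = insert 1 ((\<lambda>(h, i). \<delta> h i) ` (Rel r \<times> labels S))"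
    have finD: "finite D" unfolding D_def using finRel[OF r] finite_labels by blast
    have D0: "Min D > 0"
    proof -
      have "D \<noteq> {}" unfolding D_def by simp
      moreover have "\<forall>d\<in>D. d > 0" unfolding D_def using \<delta>(1) by auto
      ultimately show ?thesis using finD by simp
    qed
    \<comment> \<open>\<open>x + pQ h\<close> lies on the wall \<open>k\<close> exactly when
      \<open>x\<close> lies on the translate of that wall by \<open>- pQ h\<close>.\<close>
    define A' where "A' = (\<lambda>(k, h). (fst k, snd k - fst k \<bullet> pQ h)) ` (A \<times> Rel r)"
    have A': "finite A'" "\<And>k. k \<in> A' \<Longrightarrow> fst k \<in> Q \<and> fst k \<noteq> 0"
      unfolding A'_def using finA finRel[OF r] normA by auto
    obtain x where x: "x \<in> Q" "dist x (pQ g) < Min D" "\<And>k. k \<in> A' \<Longrightarrow> fst k \<bullet> x \<noteq> snd k"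
      using generic_point[OF subspace_Q A' pQ_in D0] by blast
    have "x \<in> Gen r" unfolding Gen_def
    proof (intro CollectI conjI ballI x(1))
      fix k h assume kh: "k \<in> A" "h \<in> Rel r"
      then have "(fst k, snd k - fst k \<bullet> pQ h) \<in> A'" unfolding A'_def by force
      then have "fst k \<bullet> x \<noteq> snd k - fst k \<bullet> pQ h" using x(3) by fastforce
      then show "fst k \<bullet> (x + pQ h) \<noteq> snd k" by (simp add: inner_add_right)
    qed
    moreover have "LP r x = LP r (pQ g)"
    proof -
      have "x + pQ h \<in> cell S i \<longleftrightarrow> pQ g + pQ h \<in> cell S i" if hi: "h \<in> Rel r" "i \<in> labels S" for h i
      proof -
        have "\<delta> h i \<in> D" unfolding D_def using hi by force
        then have "Min D \<le> \<delta> h i" using finD by simp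
        then have "dist (x + pQ h) (pQ (g + h)) < \<delta> h i"
          using x(2) by (simp add: linear_add[OF linear_pQ] dist_norm)
        moreover have "x + pQ h \<in> Q" using x(1) pQ_in subspace_Q by (intro subspace_add)
        ultimately show ?thesis using \<delta>(2)[OF hi] by (simp add: linear_add[OF linear_pQ])
      qed
      then show ?thesis unfolding LP_def by blast
    qed
    ultimately show ?thesis by (metis imageI)
  qed
  \<comment> \<open>Differences \<open>h\<close> that give the same translate of a wall are
    identified here; this is where large stabilisers lower the count.\<close>
  define vals where "vals r k = (\<lambda>h. snd k - fst k \<bullet> pQ h) ` Rel r" for r k
  define pat where "pat r x = {(k, v). k \<in> A \<and> v \<in> vals r k \<and> fst k \<bullet> x > v}" for r x
  have det: "LP r x \<subseteq> LP r x'" if xx: "x \<in> Gen r" "x' \<in> Gen r" "pat r x = pat r x'" for r x x'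
  proof (clarsimp simp: LP_def)
    fix h i assume hi: "h \<in> Rel r" "i \<in> labels S" "x + pQ h \<in> cell S i"
    show "x' + pQ h \<in> cell S i"
    proof (rule same_side_mem[OF subspace_Q \<A>[OF hi(2)] _ _ _ hi(3)])
      show "x + pQ h \<in> Q" "x' + pQ h \<in> Q"
        using xx pQ_in subspace_Q unfolding Gen_def by (auto intro: subspace_add)
      fix k assume "k \<in> \<A> i"
      then have k: "k \<in> A" unfolding A_def using hi(2) by blast
      have "snd k - fst k \<bullet> pQ h \<in> vals r k" unfolding vals_def using hi(1) by blast
      then have "(k, snd k - fst k \<bullet> pQ h) \<in> pat r y \<longleftrightarrow> fst k \<bullet> (y + pQ h) > snd k" for y
        unfolding pat_def using k by (auto simp: inner_add_right)
      then have "fst k \<bullet> (x + pQ h) > snd k \<longleftrightarrow> fst k \<bullet> (x' + pQ h) > snd k" using xx(3) by blast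
      then show "fst k \<bullet> (x + pQ h) \<noteq> snd k \<and> fst k \<bullet> (x' + pQ h) \<noteq> snd k \<and>
          (fst k \<bullet> (x + pQ h) > snd k \<longleftrightarrow> fst k \<bullet> (x' + pQ h) > snd k)"
        using xx(1,2) k hi(1) unfolding Gen_def by blast
    qed
  qed
  define GG where "GG = {g. g \<subseteq> A \<and> inj_on fst g \<and> independent (fst ` g)}"
  have patbound: "finite ((\<lambda>g. local_patch r (pQ g)) ` acc) \<and>
      card ((\<lambda>g. local_patch r (pQ g)) ` acc) \<le> (\<Sum>g\<in>GG. \<Prod>k\<in>g. card (vals r k))"
    if r: "r \<ge> 2 * R" for r
  proof -
    have finv: "finite (vals r k)" for k unfolding vals_def using finRel[OF r] by simp
    have "finite (Pow (SIGMA k:A. vals r k))" using finA finv by auto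
    moreover have "pat r ` Gen r \<subseteq> Pow (SIGMA k:A. vals r k)" unfolding pat_def by auto
    ultimately have finp: "finite (pat r ` Gen r)" by (rule finite_subset[rotated])
    have det': "LP r x = LP r x'" if "x \<in> Gen r" "x' \<in> Gen r" "pat r x = pat r x'" for x x'
      using det[OF that] det[OF that(2,1) that(3)[symmetric]] by blast
    note LPb = card_image_le_if_determined[of "pat r" "Gen r" "LP r", OF finp det']
    have sub: "(\<lambda>g. local_patch r (pQ g)) ` acc \<subseteq> LP r ` Gen r"
      using perturb r local_LP by (intro image_subsetI) simp
    have "card ((\<lambda>g. local_patch r (pQ g)) ` acc) \<le> card (LP r ` Gen r)" by (rule card_mono[OF LPb(1) sub])
    also have "\<dots> \<le> card (pat r ` Gen r)" by (rule LPb(2))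
    also have "\<dots> \<le> (\<Sum>g\<in>GG. \<Prod>k\<in>g. card (vals r k))"
      unfolding pat_def GG_def by (rule card_halfspace_patterns_le[OF finA finv])
    finally have "card ((\<lambda>g. local_patch r (pQ g)) ` acc) \<le> (\<Sum>g\<in>GG. \<Prod>k\<in>g. card (vals r k))" .
    with finite_subset[OF sub LPb(1)] show ?thesis by (rule conjI)
  qed
  have "\<exists>C r0. C > 0 \<and> (\<forall>r\<ge>r0. real (card (vals r k)) \<le> C * r ^ exponent (fst k))" for k
  proof -
    obtain C r0 where C: "C > 0" "\<And>r. r \<ge> r0 \<Longrightarrow>
       real (card ((\<lambda>x. fst k \<bullet> pQ x) ` {x \<in> \<Gamma>. norm x \<le> r \<and> norm (pQ x) \<le> 2 * R})) \<le> C * r ^ exponent (fst k)"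
      using count_values[of "fst k" "2 * R"] by blast
    show ?thesis
    proof (rule exI[of _ "C * (K + 1) ^ exponent (fst k)"], rule exI[of _ "max 0 (max (2 * R) r0)"],
        intro conjI allI impI)
      show "C * (K + 1) ^ exponent (fst k) > 0" using C K by simp
      fix r assume "r \<ge> max 0 (max (2 * R) r0)"
      then have r: "r \<ge> 0" "r \<ge> 2 * R" "r \<ge> r0" by auto
      have "0 \<le> K * r" using r(1) K(1) by simp
      then have Kr: "(K + 1) * r \<ge> r0" using r(3) by (simp add: distrib_right)
      define X where "X = {x \<in> \<Gamma>. norm x \<le> (K + 1) * r \<and> norm (pQ x) \<le> 2 * R}"
      have finX: "finite X" unfolding X_def by (rule finite_subset[OF _ finite_lat_ball[of "(K + 1) * r"]]) blast
      have "vals r k \<subseteq> (\<lambda>v. snd k - v) ` (\<lambda>x. fst k \<bullet> pQ x) ` X"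
        unfolding vals_def X_def image_image using Relsub[OF r(2)] by (rule image_mono)
      then have "card (vals r k) \<le> card ((\<lambda>v. snd k - v) ` (\<lambda>x. fst k \<bullet> pQ x) ` X)"
        by (rule card_mono[rotated]) (intro finite_imageI finX)
      also have "\<dots> \<le> card ((\<lambda>x. fst k \<bullet> pQ x) ` X)" by (intro card_image_le finite_imageI finX)
      finally have "real (card (vals r k)) \<le> real (card ((\<lambda>x. fst k \<bullet> pQ x) ` X))" by (rule of_nat_mono)
      also have "\<dots> \<le> C * ((K + 1) * r) ^ exponent (fst k)" unfolding X_def by (rule C(2)[OF Kr])
      finally show "real (card (vals r k)) \<le> C * (K + 1) ^ exponent (fst k) * r ^ exponent (fst k)"
        by (simp add: power_mult_distrib mult_ac)
    qed
  qed
  then obtain C r0 where C: "\<And>k. C k > 0"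
    "\<And>k r. r \<ge> r0 k \<Longrightarrow> real (card (vals r k)) \<le> C k * r ^ exponent (fst k)" by metis
  define r1 where "r1 = max 1 (2 * R) + (\<Sum>k\<in>A. \<bar>r0 k\<bar>)"
  define C1 where "C1 = (\<Sum>g\<in>GG. \<Prod>k\<in>g. C k) + 1"
  have "(\<Sum>g\<in>GG. \<Prod>k\<in>g. C k) \<ge> 0" using C(1) by (intro sum_nonneg prod_nonneg) (auto intro: less_imp_le)
  then have C1: "C1 > 0" unfolding C1_def by linarith
  have bound: "finite (patch_classes S N r) \<and> real (card (patch_classes S N r)) \<le> C1 * r ^ dim P"
    if r: "r \<ge> r1" for r
  proof -
    have s0: "(\<Sum>k\<in>A. \<bar>r0 k\<bar>) \<ge> 0" by (simp add: sum_nonneg)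
    then have r1: "r \<ge> 1" and rR: "r \<ge> 2 * R" using r unfolding r1_def by linarith+
    have rr0: "r \<ge> r0 k" if "k \<in> A" for k
      using member_le_sum[OF that, of "\<lambda>k. \<bar>r0 k\<bar>"] finA r unfolding r1_def by simp
    have fin: "finite ((\<lambda>g. local_patch r (pQ g)) ` acc)" using patbound[OF rR] by (rule conjunct1)
    have "real (card ((\<lambda>g. local_patch r (pQ g)) ` acc)) \<le> real (\<Sum>g\<in>GG. \<Prod>k\<in>g. card (vals r k))"
      by (rule of_nat_mono[OF patbound[OF rR, THEN conjunct2]])
    also have "\<dots> = (\<Sum>g\<in>GG. \<Prod>k\<in>g. real (card (vals r k)))" by simp
    also have "\<dots> \<le> (\<Sum>g\<in>GG. (\<Prod>k\<in>g. C k) * r ^ dim P)"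
    proof (rule sum_mono)
      fix g assume "g \<in> GG"
      then have g: "g \<subseteq> A" "inj_on fst g" "independent (fst ` g)" unfolding GG_def by auto
      have "(\<Prod>k\<in>g. real (card (vals r k))) \<le> (\<Prod>k\<in>g. C k * r ^ exponent (fst k))"
        using C(2) rr0 g(1) by (intro prod_mono) auto
      also have "\<dots> = (\<Prod>k\<in>g. C k) * r ^ (\<Sum>k\<in>g. exponent (fst k))"
        by (simp add: prod.distrib power_sum)
      also have "(\<Sum>k\<in>g. exponent (fst k)) = (\<Sum>a\<in>fst ` g. exponent a)" by (simp add: sum.reindex[OF g(2)])
      also have "(\<Prod>k\<in>g. C k) * r ^ (\<Sum>a\<in>fst ` g. exponent a) \<le> (\<Prod>k\<in>g. C k) * r ^ dim P"
        using expsum[OF g(1,3)] r1 C(1)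
        by (intro mult_left_mono power_increasing prod_nonneg) (auto intro: less_imp_le)
      finally show "(\<Prod>k\<in>g. real (card (vals r k))) \<le> (\<Prod>k\<in>g. C k) * r ^ dim P" .
    qed
    also have "\<dots> = (\<Sum>g\<in>GG. \<Prod>k\<in>g. C k) * r ^ dim P" by (simp add: sum_distrib_right)
    also have "\<dots> \<le> C1 * r ^ dim P" unfolding C1_def using r1 by (intro mult_right_mono) auto
    finally show ?thesis using fin card_patch_classes by simp
  qed
  show ?thesis unfolding property_C_def
  proof (intro exI[of _ C1] conjI C1)
    show "\<forall>\<^sub>F r in at_top. finite (patch_classes S N r) \<and> real (card (patch_classes S N r)) \<le> C1 * r ^ dim P"
      unfolding eventually_at_top_linorder using bound by blast
  qed
qed

section \<open>Property C forces the rank condition\<close>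

text \<open>Proper support supplies a point \<open>w\<close> around which a cell coincides with a
  half-space. Patches detect the hyperplane direction through this local picture.\<close>

lemma hyperplane0_local:
  assumes "V \<in> hyperplanes0 S"
  shows "\<exists>i a w e. i \<in> labels S \<and> a \<in> Q \<and> V = perp a \<and> w \<in> Q \<and> e > 0 \<and>
    (\<forall>x\<in>Q. dist x w < e \<longrightarrow> (x \<in> cell S i \<longleftrightarrow> a \<bullet> x \<ge> a \<bullet> w))"
proof -
  obtain i H where iH: "i \<in> labels S" "properly_supporting Q (cell S i) H" "V = {x - y |x y. x \<in> H \<and> y \<in> H}"
    using assms unfolding hyperplanes0_def hyperplanes_def by blast
  obtain a b w U where a: "a \<in> Q" "a \<noteq> 0" "H = {x \<in> Q. a \<bullet> x = b}" "w \<in> H"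
    "openin (top_of_set Q) U" "w \<in> U" "cell S i \<inter> U = {x \<in> Q. a \<bullet> x \<ge> b} \<inter> U"
    using iH(2) unfolding properly_supporting_def by blast
  have w: "w \<in> Q" "a \<bullet> w = b" using a by auto
  have "V = perp a" using hyperplane_differences[OF w] iH(3) a(3) unfolding perp_def by simp
  moreover obtain e where e: "e > 0" "\<And>x. x \<in> Q \<Longrightarrow> dist x w < e \<Longrightarrow> x \<in> U"
    using a(5,6) unfolding openin_euclidean_subtopology_iff by blast
  have "x \<in> cell S i \<longleftrightarrow> a \<bullet> x \<ge> a \<bullet> w" if x: "x \<in> Q" "dist x w < e" for x
    using e(2)[OF x] a(7) x(1) w(2) by blast
  ultimately show ?thesis using iH(1) a(1) w(1) e(1) by blast
qed

text \<open>The other normals number fewer than \<open>dim Q\<close>, so some non-zero vector of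
  \<open>Q\<close> is orthogonal to all of them, and totality forces it to pair non-trivially with
  \<open>a V\<close>. Dual vectors allow the coordinates along a flag to be prescribed
  independently.\<close>

lemma dual_family:
  assumes f: "finite f" "card f \<le> dim Q" and aQ: "\<And>V. V \<in> f \<Longrightarrow> a V \<in> Q"
    and total: "\<And>x. x \<in> Q \<Longrightarrow> (\<And>V. V \<in> f \<Longrightarrow> a V \<bullet> x = 0) \<Longrightarrow> x = 0"
    and V: "V \<in> f"
  shows "\<exists>u\<in>Q. a V \<bullet> u = 1 \<and> (\<forall>V'\<in>f. V' \<noteq> V \<longrightarrow> a V' \<bullet> u = 0)"
proof -
  define M where "M = a ` (f - {V})"
  have "dim M \<le> card M" unfolding M_def using f by (intro dim_le_card') simp
  also have "\<dots> \<le> card (f - {V})" unfolding M_def using f by (intro card_image_le) simp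
  also have "\<dots> < dim Q" using card_Diff1_less[OF f(1) V] f(2) by linarith
  finally have dimM: "dim M < dim Q" .
  have "M \<subseteq> Q" unfolding M_def using aQ by blast
  then have "span M \<subseteq> Q" using subspace_Q by (rule span_minimal)
  moreover have "span M \<noteq> Q" using dimM by (metis dim_span less_irrefl)
  ultimately have "span M \<subset> span Q" using span_eq_iff subspace_Q by (metis psubsetI)
  then obtain x where x: "x \<noteq> 0" "x \<in> span Q" "\<And>y. y \<in> span M \<Longrightarrow> orthogonal x y"
    using orthogonal_to_subspace_exists_gen by blast
  have xQ: "x \<in> Q" using x(2) span_eq_iff subspace_Q by metis
  have other: "a V' \<bullet> x = 0" if "V' \<in> f" "V' \<noteq> V" for V'
  proof -
    have "a V' \<in> span M" unfolding M_def using that by (intro span_base) blast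
    then show ?thesis using x(3)[of "a V'"] by (simp add: orthogonal_def inner_commute)
  qed
  have nz: "a V \<bullet> x \<noteq> 0"
  proof
    assume "a V \<bullet> x = 0"
    then have "\<And>V'. V' \<in> f \<Longrightarrow> a V' \<bullet> x = 0" using other by metis
    then show False using total xQ x(1) by blast
  qed
  show ?thesis
  proof (intro bexI[of _ "(1 / (a V \<bullet> x)) *\<^sub>R x"] conjI ballI impI)
    show "(1 / (a V \<bullet> x)) *\<^sub>R x \<in> Q" using xQ subspace_Q by (intro subspace_scale)
  qed (use nz other in auto)
qed

text \<open>Near a common point of the window, suitable translates of the cells look like the half-spaces of
  the flag, so that the patches separate the boxes of the grid cut out by their further translates.\<close>
lemma grid_card_le_patches:
  assumes f: "finite f" "card f \<le> dim Q" and aQ: "\<And>V. V \<in> f \<Longrightarrow> a V \<in> Q"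
    and total: "\<And>x. x \<in> Q \<Longrightarrow> (\<And>V. V \<in> f \<Longrightarrow> a V \<bullet> x = 0) \<Longrightarrow> x = 0"
    and lab: "\<And>V. V \<in> f \<Longrightarrow> lb V \<in> labels S" and wQ: "\<And>V. V \<in> f \<Longrightarrow> w V \<in> Q"
    and e0: "\<And>V. V \<in> f \<Longrightarrow> e V > 0"
    and loc: "\<And>V x. V \<in> f \<Longrightarrow> x \<in> Q \<Longrightarrow> dist x (w V) < e V \<Longrightarrow> (x \<in> cell S (lb V) \<longleftrightarrow> a V \<bullet> x \<ge> a V \<bullet> w V)"
  shows "\<exists>\<epsilon> K \<rho>. \<epsilon> > 0 \<and> K > 0 \<and> (\<forall>r. finite (patch_classes S N (K * r + \<rho>)) \<longrightarrow>
    card (PiE f (\<lambda>V. (\<lambda>x. a V \<bullet> pQ x) ` {x \<in> \<Gamma>. norm x \<le> r \<and> norm (pQ x) \<le> \<epsilon>}))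
      \<le> card (patch_classes S N (K * r + \<rho>)))"
proof -
  have "\<exists>u. V \<in> f \<longrightarrow> (a V \<bullet> u = 1 \<and> (\<forall>V'\<in>f. V' \<noteq> V \<longrightarrow> a V' \<bullet> u = 0)) \<and> u \<in> Q" for V
    using dual_family[of f a V, OF f aQ total] by blast
  then obtain u where u: "\<And>V. V \<in> f \<Longrightarrow> a V \<bullet> u V = 1" "\<And>V. V \<in> f \<Longrightarrow> u V \<in> Q"
    "\<And>V V'. V \<in> f \<Longrightarrow> V' \<in> f \<Longrightarrow> V' \<noteq> V \<Longrightarrow> a V' \<bullet> u V = 0" by metis
  \<comment> \<open>The interior point \<open>q\<close> is the common point to which all local
    half-space pictures are moved; lattice points projecting close to it are centres of
    patches.\<close>
  have "top_of_set Q interior_of (window S) \<noteq> {}"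
    using polytopal_window window_nonempty unfolding polytopal_def by auto
  then obtain q where q: "q \<in> top_of_set Q interior_of (window S)" by blast
  have "openin (top_of_set Q) (top_of_set Q interior_of (window S))" by simp
  then obtain \<epsilon>0 where \<epsilon>0: "\<epsilon>0 > 0" "\<And>x. x \<in> Q \<Longrightarrow> dist x q < \<epsilon>0 \<Longrightarrow> x \<in> top_of_set Q interior_of (window S)"
    and qQ: "q \<in> Q"
    using q unfolding openin_euclidean_subtopology_iff by blast
  have inW: "x \<in> window S" if "x \<in> Q" "dist x q < \<epsilon>0" for x
    using \<epsilon>0(2)[OF that] interior_of_subset[of "top_of_set Q" "window S"] by blast
  define D where "D = insert \<epsilon>0 (e ` f)"
  have D: "finite D" "D \<noteq> {}" "\<forall>d\<in>D. d > 0" unfolding D_def using f(1) \<epsilon>0(1) e0 by auto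
  \<comment> \<open>Three displacements of size at most \<open>\<epsilon>\<close> precede the use of
    \<open>loc\<close>: that of the centre from \<open>q\<close>, the error of
    \<open>pQ (g V)\<close>, and the internal part of \<open>x\<close>.\<close>
  define \<epsilon> where "\<epsilon> = Min D / 3"
  have \<epsilon>: "\<epsilon> > 0" unfolding \<epsilon>_def using D by simp
  have MinD: "Min D \<le> d" if "d \<in> D" for d using D(1) that by simp
  have \<epsilon>0': "\<epsilon> \<le> \<epsilon>0" using MinD[of \<epsilon>0] \<epsilon> unfolding D_def \<epsilon>_def by simp
  have \<epsilon>e: "3 * \<epsilon> \<le> e V" if "V \<in> f" for V using MinD[of "e V"] that unfolding D_def \<epsilon>_def by simp
  define M where "M = (\<Sum>V\<in>f. norm (u V)) + 1"
  define \<alpha> where "\<alpha> = (\<Sum>V\<in>f. norm (a V)) + 1"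
  have M: "M \<ge> 1" unfolding M_def by (simp add: sum_nonneg)
  have \<alpha>: "\<alpha> \<ge> 1" unfolding \<alpha>_def by (simp add: sum_nonneg)
  have norma: "norm (a V) < \<alpha>" if "V \<in> f" for V
    using member_le_sum[OF that, of "\<lambda>V. norm (a V)"] f(1) unfolding \<alpha>_def by simp
  have inner_le: "\<bar>a V \<bullet> x\<bar> \<le> \<alpha> * c" if "V \<in> f" "norm x \<le> c" for V x c
  proof -
    have "\<bar>a V \<bullet> x\<bar> \<le> norm (a V) * norm x" by (rule Cauchy_Schwarz_ineq2)
    also have "\<dots> \<le> \<alpha> * c" using norma[OF that(1)] that(2) \<alpha> by (intro mult_mono) auto
    finally show ?thesis .
  qed
  \<comment> \<open>Chosen so that flag coordinates of size \<open>2 * \<alpha> * \<eta>\<close>,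
    realised through the dual vectors, displace a point by at most
    \<open>\<epsilon> / 2\<close>.\<close>
  define \<eta> where "\<eta> = \<epsilon> / (4 * \<alpha> * M)"
  have aM: "\<alpha> * M \<ge> 1" using mult_mono[OF \<alpha> M] \<alpha> by simp
  have \<eta>: "\<eta> > 0" "\<eta> \<le> \<epsilon>" "2 * \<alpha> * \<eta> * M = \<epsilon> / 2"
  proof -
    show "\<eta> > 0" unfolding \<eta>_def using \<epsilon> \<alpha> M by simp
    show "2 * \<alpha> * \<eta> * M = \<epsilon> / 2" unfolding \<eta>_def using \<alpha> M by simp
    have "\<epsilon> \<le> 4 * (\<alpha> * M) * \<epsilon>" using \<epsilon> aM by simp
    then show "\<eta> \<le> \<epsilon>" unfolding \<eta>_def using \<alpha> M by (simp add: field_simps)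
  qed
  \<comment> \<open>Density provides a lattice vector \<open>g V\<close> whose internal part moves
    \<open>q\<close> almost to \<open>w V\<close>; \<open>s V\<close> below is the remaining error
    measured along \<open>a V\<close>.\<close>
  have "\<exists>g. V \<in> f \<longrightarrow> g \<in> \<Gamma> \<and> dist (pQ g) (w V - q) < \<eta>" for V
    using dense[of "w V - q" \<eta>] wQ qQ subspace_diff[OF subspace_Q] \<eta>(1) by metis
  then obtain g where g: "\<And>V. V \<in> f \<Longrightarrow> g V \<in> \<Gamma>" "\<And>V. V \<in> f \<Longrightarrow> dist (pQ (g V)) (w V - q) < \<eta>" by metis
  obtain K where K: "K > 0" "\<And>x. N (pP x) \<le> K * norm x" "\<And>x. norm x \<le> K * N (pP x) + norm (pQ x)"
    "\<And>x. N (pP x) \<ge> 0"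
    by (rule norm_equiv) (rule that; assumption)
  define \<rho> where "\<rho> = (\<Sum>V\<in>f. N (pP (g V)))"
  have \<rho>: "N (pP (g V)) \<le> \<rho>" if "V \<in> f" for V
    unfolding \<rho>_def using member_le_sum[OF that, of "\<lambda>V. N (pP (g V))"] f(1) K(4) by simp
  define s where "s V = a V \<bullet> (w V - q - pQ (g V))" for V
  have s: "\<bar>s V\<bar> \<le> \<alpha> * \<eta>" if "V \<in> f" for V
    unfolding s_def using g(2)[OF that] by (intro inner_le that) (simp add: dist_norm norm_minus_commute)
  define Y where "Y r = {x \<in> \<Gamma>. norm x \<le> r \<and> norm (pQ x) \<le> \<eta>}" for r
  have finY: "finite (Y r)" for r unfolding Y_def by (rule finite_subset[OF _ finite_lat_ball[of r]]) blast
  \<comment> \<open>Thus a single entry of the patch tells on which side of one grid wall its centre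
    lies.\<close>
  have mem: "(g V + x, lb V) \<in> local_patch (K * r + \<rho>) p \<longleftrightarrow> s V - a V \<bullet> pQ x \<le> a V \<bullet> (p - q)"
    if V: "V \<in> f" and x: "x \<in> Y r" and p: "p \<in> Q" "dist p q < \<epsilon>" for V x p r
  proof -
    have xY: "x \<in> \<Gamma>" "norm x \<le> r" "norm (pQ x) \<le> \<eta>" using x unfolding Y_def by auto
    have "N (pP (g V + x)) \<le> N (pP (g V)) + N (pP x)" by (rule N_triangle)
    moreover have "N (pP x) \<le> K * r" using K(2)[of x] mult_left_mono[OF xY(2), of K] K(1) by linarith
    ultimately have "N (pP (g V + x)) \<le> K * r + \<rho>" using \<rho>[OF V] by linarith
    moreover have "g V + x \<in> \<Gamma>" using g(1)[OF V] xY(1) by (rule lat_add)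
    ultimately have "(g V + x, lb V) \<in> local_patch (K * r + \<rho>) p \<longleftrightarrow> p + pQ (g V + x) \<in> cell S (lb V)"
      unfolding local_patch_def using lab[OF V] by simp
    also have "\<dots> \<longleftrightarrow> a V \<bullet> (p + pQ (g V + x)) \<ge> a V \<bullet> w V"
    proof (rule loc[OF V])
      show "p + pQ (g V + x) \<in> Q" using p(1) pQ_in subspace_Q by (intro subspace_add)
      have "p + pQ (g V + x) - w V = (p - q) + (pQ (g V) - (w V - q)) + pQ x"
        by (simp add: linear_add[OF linear_pQ])
      then have "norm (p + pQ (g V + x) - w V) \<le> norm (p - q) + norm (pQ (g V) - (w V - q)) + norm (pQ x)"
        by (metis norm_triangle_le add_mono norm_triangle_ineq order_refl)
      then show "dist (p + pQ (g V + x)) (w V) < e V"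
        using p(2) g(2)[OF V] xY(3) \<eta>(2) \<epsilon>e[OF V] by (simp add: dist_norm)
    qed
    also have "\<dots> \<longleftrightarrow> s V - a V \<bullet> pQ x \<le> a V \<bullet> (p - q)"
      unfolding s_def by (auto simp: linear_add[OF linear_pQ] inner_add_right inner_diff_right)
    finally show ?thesis .
  qed
  define Z where "Z r V = (\<lambda>x. a V \<bullet> pQ x) ` Y r" for r V
  have "card (PiE f (Z r)) \<le> card (patch_classes S N (K * r + \<rho>))"
    if fin: "finite (patch_classes S N (K * r + \<rho>))" for r
  proof -
    have "finite (\<Union>V\<in>f. Z r V)" unfolding Z_def using f(1) finY by blast
    then obtain \<delta>0 where \<delta>0: "\<delta>0 > 0"
      "\<And>x y. x \<in> (\<Union>V\<in>f. Z r V) \<Longrightarrow> y \<in> (\<Union>V\<in>f. Z r V) \<Longrightarrow> x < y \<Longrightarrow> x + \<delta>0 \<le> y"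
      by (rule finite_real_gap) (rule that; assumption)
    \<comment> \<open>An interval of length at most the gap \<open>\<delta>0\<close> identifies the
      grid value; the second bound keeps the prescribed points within \<open>\<epsilon>\<close> of
      \<open>q\<close>.\<close>
    define \<delta> where "\<delta> = min \<delta>0 (\<epsilon> / (2 * M))"
    have \<delta>: "\<delta> > 0" "\<delta> \<le> \<delta>0" "\<delta> / 2 * M \<le> \<epsilon> / 4"
    proof -
      show "\<delta> > 0" unfolding \<delta>_def using \<delta>0 \<epsilon> M by simp
      have "\<delta> \<le> \<epsilon> / (2 * M)" unfolding \<delta>_def by simp
      then show "\<delta> / 2 * M \<le> \<epsilon> / 4" using M by (simp add: field_simps)
    qed (simp add: \<delta>_def)
    have ex: "\<exists>h\<in>\<Gamma>. dist (pQ h) q < \<epsilon> \<and>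
        (\<forall>V\<in>f. s V - v V < a V \<bullet> (pQ h - q) \<and> a V \<bullet> (pQ h - q) < s V - v V + \<delta>)"
      if v: "v \<in> PiE f (Z r)" for v
    proof -
      \<comment> \<open>The midpoint of the required interval is prescribed, which leaves a margin
        of \<open>\<delta> / 2\<close> for replacing the point by a projected lattice point.\<close>
      define \<tau> where "\<tau> V = s V - v V + \<delta> / 2" for V
      have \<tau>: "\<bar>\<tau> V\<bar> \<le> 2 * \<alpha> * \<eta> + \<delta> / 2" if V: "V \<in> f" for V
      proof -
        obtain x where "x \<in> Y r" "v V = a V \<bullet> pQ x" using PiE_mem[OF v V] unfolding Z_def by blast
        then have "\<bar>v V\<bar> \<le> \<alpha> * \<eta>" using inner_le[OF V, of "pQ x" \<eta>] unfolding Y_def by simp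
        then show ?thesis using s[OF V] \<delta>(1) unfolding \<tau>_def by linarith
      qed
      define t where "t = (\<Sum>V\<in>f. \<tau> V *\<^sub>R u V)"
      have tQ: "t \<in> Q" unfolding t_def using u(2) subspace_Q by (intro subspace_sum subspace_scale)
      have at: "a V \<bullet> t = \<tau> V" if V: "V \<in> f" for V
      proof -
        have "a V \<bullet> t = (\<Sum>V'\<in>f. \<tau> V' * (a V \<bullet> u V'))" unfolding t_def by (simp add: inner_sum_right)
        also have "\<dots> = (\<Sum>V'\<in>f. if V' = V then \<tau> V else 0)"
          using u(1,3) V by (intro sum.cong) auto
        finally show ?thesis using V f(1) by simp
      qed
      have "norm t \<le> (\<Sum>V\<in>f. norm (\<tau> V *\<^sub>R u V))" unfolding t_def by (rule norm_sum)
      also have "\<dots> \<le> (\<Sum>V\<in>f. (2 * \<alpha> * \<eta> + \<delta> / 2) * norm (u V))"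
        using \<tau> by (intro sum_mono) (simp add: mult_right_mono)
      also have "\<dots> = (2 * \<alpha> * \<eta> + \<delta> / 2) * (\<Sum>V\<in>f. norm (u V))" by (simp add: sum_distrib_left)
      also have "\<dots> \<le> (2 * \<alpha> * \<eta> + \<delta> / 2) * M"
        unfolding M_def using \<alpha> \<eta>(1) \<delta>(1) by (intro mult_left_mono) auto
      also have "\<dots> = \<epsilon> / 2 + \<delta> / 2 * M" using \<eta>(3) by (simp add: distrib_right)
      also have "\<dots> < \<epsilon>" using \<delta>(3) \<epsilon> by linarith
      finally have tlt: "norm t < \<epsilon>" .
      define \<mu> where "\<mu> = min (\<epsilon> - norm t) (\<delta> / (2 * \<alpha>))"
      have \<mu>: "\<mu> > 0" unfolding \<mu>_def using tlt \<delta>(1) \<alpha> by simp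
      obtain h where h: "h \<in> \<Gamma>" "dist (pQ h) (q + t) < \<mu>"
        using dense[OF subspace_add[OF subspace_Q qQ tQ] \<mu>] by blast
      have "dist (pQ h) q \<le> dist (pQ h) (q + t) + norm t"
        using dist_triangle[of "pQ h" q "q + t"] by (simp add: dist_norm)
      then have near: "dist (pQ h) q < \<epsilon>" using h(2) unfolding \<mu>_def by simp
      have "s V - v V < a V \<bullet> (pQ h - q) \<and> a V \<bullet> (pQ h - q) < s V - v V + \<delta>" if V: "V \<in> f" for V
      proof -
        define y where "y = pQ h - (q + t)"
        have ny: "norm y < \<mu>" unfolding y_def using h(2) by (simp add: dist_norm)
        have "\<bar>a V \<bullet> y\<bar> \<le> norm (a V) * norm y" by (rule Cauchy_Schwarz_ineq2)
        also have "\<dots> \<le> \<alpha> * norm y" using norma[OF V] by (intro mult_right_mono) auto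
        also have "\<dots> < \<alpha> * \<mu>" using ny \<alpha> by simp
        also have "\<dots> \<le> \<alpha> * (\<delta> / (2 * \<alpha>))" unfolding \<mu>_def using \<alpha> by (intro mult_left_mono) auto
        also have "\<dots> = \<delta> / 2" using \<alpha> by simp
        finally have "\<bar>a V \<bullet> y\<bar> < \<delta> / 2" .
        moreover have "a V \<bullet> (pQ h - q) = a V \<bullet> y + \<tau> V"
          unfolding y_def using at[OF V] by (simp add: inner_diff_right inner_add_right)
        ultimately show ?thesis unfolding \<tau>_def by linarith
      qed
      then show ?thesis using h(1) near by blast
    qed
    have "\<exists>h. v \<in> PiE f (Z r) \<longrightarrow> h \<in> \<Gamma> \<and> dist (pQ h) q < \<epsilon> \<and>
        (\<forall>V\<in>f. s V - v V < a V \<bullet> (pQ h - q) \<and> a V \<bullet> (pQ h - q) < s V - v V + \<delta>)" for v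
      using ex[of v] by blast
    then obtain h where h: "\<And>v. v \<in> PiE f (Z r) \<Longrightarrow> h v \<in> \<Gamma>" "\<And>v. v \<in> PiE f (Z r) \<Longrightarrow> dist (pQ (h v)) q < \<epsilon>"
      "\<And>v V. v \<in> PiE f (Z r) \<Longrightarrow> V \<in> f \<Longrightarrow> s V - v V < a V \<bullet> (pQ (h v) - q)"
      "\<And>v V. v \<in> PiE f (Z r) \<Longrightarrow> V \<in> f \<Longrightarrow> a V \<bullet> (pQ (h v) - q) < s V - v V + \<delta>"
      by metis
    define lp where "lp v = local_patch (K * r + \<rho>) (pQ (h v))" for v
    \<comment> \<open>The entry belonging to an \<open>x\<close> that realises the smaller value
      \<open>v V\<close> is present in the patch for \<open>v\<close> and absent from the patch for
      \<open>v'\<close>.\<close>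
    have sep: "lp v \<noteq> lp v'" if v: "v \<in> PiE f (Z r)" "v' \<in> PiE f (Z r)" and V: "V \<in> f" and lt: "v V < v' V" for v v' V
    proof -
      obtain x where x: "x \<in> Y r" "v V = a V \<bullet> pQ x" using PiE_mem[OF v(1) V] unfolding Z_def by blast
      have "(g V + x, lb V) \<in> lp v"
        unfolding lp_def mem[OF V x(1) pQ_in h(2)[OF v(1)]] using h(3)[OF v(1) V] x(2) by simp
      moreover have "v V + \<delta>0 \<le> v' V"
        using PiE_mem[OF v(1) V] PiE_mem[OF v(2) V] V lt by (intro \<delta>0(2)) auto
      then have "a V \<bullet> (pQ (h v') - q) < s V - v V" using h(4)[OF v(2) V] \<delta>(2) by linarith
      then have "(g V + x, lb V) \<notin> lp v'"
        unfolding lp_def mem[OF V x(1) pQ_in h(2)[OF v(2)]] using x(2) by simp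
      ultimately show ?thesis by blast
    qed
    have "inj_on lp (PiE f (Z r))"
    proof (rule inj_onI, rule ccontr)
      fix v v' assume v: "v \<in> PiE f (Z r)" "v' \<in> PiE f (Z r)" "lp v = lp v'" "v \<noteq> v'"
      then obtain V where V: "V \<in> f" "v V \<noteq> v' V" by (meson PiE_ext)
      then consider "v V < v' V" | "v' V < v V" by linarith
      then show False
      proof cases
        case 1
        then show False using sep[OF v(1,2) V(1)] v(3) by simp
      next
        case 2
        then show False using sep[OF v(2,1) V(1)] v(3) by simp
      qed
    qed
    moreover have "lp ` PiE f (Z r) \<subseteq> (\<lambda>g. local_patch (K * r + \<rho>) (pQ g)) ` acc"
    proof (rule image_subsetI)
      fix v assume v: "v \<in> PiE f (Z r)"
      have "pQ (h v) \<in> window S" using h(2)[OF v] \<epsilon>0' pQ_in by (intro inW) auto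
      then have "h v \<in> acc" unfolding acc_def using h(1)[OF v] by simp
      then show "lp v \<in> (\<lambda>g. local_patch (K * r + \<rho>) (pQ g)) ` acc" unfolding lp_def by blast
    qed
    ultimately show ?thesis unfolding card_patch_classes(2)
      by (rule card_inj_on_le) (use fin card_patch_classes(1) in simp)
  qed
  then show ?thesis unfolding Z_def Y_def using \<eta>(1) K(1) by blast
qed

text \<open>Pigeonhole: the grid positions obtained from \<open>j\<close> times the vector \<open>z\<close> in the component \<open>V0\<close> plus a
  diagonal vector, for \<open>j\<close> up to a large constant, are too numerous to be distinct.\<close>
lemma multiple_decomposes:
  assumes C: "property_C S N" and f: "finite f"
    and total: "\<And>x. x \<in> Q \<Longrightarrow> (\<And>V. V \<in> f \<Longrightarrow> a V \<bullet> x = 0) \<Longrightarrow> x = 0"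
    and \<epsilon>: "\<epsilon> > 0" and K: "K > 0"
    and grid: "\<And>r. finite (patch_classes S N (K * r + \<rho>)) \<Longrightarrow>
      card (PiE f (\<lambda>V. (\<lambda>x. a V \<bullet> pQ x) ` {x \<in> \<Gamma>. norm x \<le> r \<and> norm (pQ x) \<le> \<epsilon>}))
        \<le> card (patch_classes S N (K * r + \<rho>))"
    and V0: "V0 \<in> f"
  shows "\<exists>\<epsilon>'>0. \<forall>z\<in>\<Gamma>. norm (pQ z) < \<epsilon>' \<longrightarrow>
    (\<exists>m \<gamma>. m \<noteq> 0 \<and> \<gamma> \<in> \<Gamma> \<and> of_int m *\<^sub>R z - \<gamma> \<in> stab (a V0) \<and> (\<forall>V\<in>f - {V0}. a V \<bullet> pQ \<gamma> = 0))"
proof -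
  define Y where "Y \<epsilon> r = {x \<in> \<Gamma>. norm x \<le> r \<and> norm (pQ x) \<le> \<epsilon>}" for \<epsilon> r
  have finY: "finite (Y \<epsilon> r)" for \<epsilon> r unfolding Y_def by (rule finite_subset[OF _ finite_lat_ball[of r]]) blast
  obtain C0 r0 where C0: "C0 > 0" "\<And>r. r \<ge> r0 \<Longrightarrow> finite (patch_classes S N r)"
    "\<And>r. r \<ge> r0 \<Longrightarrow> real (card (patch_classes S N r)) \<le> C0 * r ^ dim P"
    using C unfolding property_C_def eventually_at_top_linorder by blast
  have "\<epsilon> / 2 > 0" using \<epsilon> by simp
  then obtain c1 r1 where c1: "c1 > 0" "\<And>r. r \<ge> r1 \<Longrightarrow> c1 * r ^ dim P \<le> real (card (Y (\<epsilon> / 2) r))"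
    using count_lower_small[OF lbasis(1) linear_pQ, of "\<epsilon> / 2"]
    unfolding lbasis(2,3) kernel_pQ Y_def by auto
  \<comment> \<open>\<open>Suc M\<close> multiples times the diagonal count
    \<open>c1 * r ^ dim P\<close> must exceed the bound \<open>C0 * (2 * K * r) ^ dim P\<close> from
    property C.\<close>
  define M where "M = nat \<lceil>C0 * (2 * K) ^ dim P / c1\<rceil>"
  have M: "real (Suc M) * c1 > C0 * (2 * K) ^ dim P"
  proof -
    have "real (Suc M) > C0 * (2 * K) ^ dim P / c1" unfolding M_def by linarith
    then show ?thesis using c1(1) by (simp add: field_simps)
  qed
  \<comment> \<open>The bound on \<open>pQ z\<close> keeps the internal part of each multiple up to
    \<open>M\<close> within \<open>\<epsilon> / 2\<close>; the other half of
    \<open>\<epsilon>\<close> is left to the diagonal vector.\<close>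
  have main: "\<exists>m \<gamma>. m \<noteq> 0 \<and> \<gamma> \<in> \<Gamma> \<and> of_int m *\<^sub>R z - \<gamma> \<in> stab (a V0) \<and> (\<forall>V\<in>f - {V0}. a V \<bullet> pQ \<gamma> = 0)"
    if z: "z \<in> \<Gamma>" "norm (pQ z) < \<epsilon> / (2 * real (Suc M))" for z
  proof -
    \<comment> \<open>The fixed enlargement makes room for the multiples of \<open>z\<close>. Then
      \<open>r\<close> is taken so large that the resulting patch radius stays below
      \<open>2 * K * r\<close>, which keeps \<open>M\<close> independent of
      \<open>z\<close>.\<close>
    define R where "R r = r + real M * norm z" for r
    define r where "r = Max {r1, \<bar>r0\<bar> / K + \<bar>\<rho>\<bar> / K, real M * norm z + \<bar>\<rho>\<bar> / K, 1}"
    have r: "r \<ge> r1" "r \<ge> \<bar>r0\<bar> / K + \<bar>\<rho>\<bar> / K" "r \<ge> real M * norm z + \<bar>\<rho>\<bar> / K" "r \<ge> 1"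
      unfolding r_def by (rule Max_ge; simp)+
    have Kr: "\<bar>r0\<bar> + \<bar>\<rho>\<bar> \<le> K * r" "K * (real M * norm z) + \<bar>\<rho>\<bar> \<le> K * r"
      using mult_left_mono[OF r(2), of K] mult_left_mono[OF r(3), of K] K by (simp_all add: distrib_left)
    have KMz: "K * (real M * norm z) \<ge> 0" using K by simp
    have KR: "K * R r + \<rho> \<ge> r0" "K * R r + \<rho> \<ge> 0" "K * R r + \<rho> \<le> (2 * K) * r"
      unfolding R_def using Kr KMz by (simp_all add: distrib_left)
    define Z where "Z V = (\<lambda>x. a V \<bullet> pQ x) ` Y \<epsilon> (R r)" for V
    define F where "F = (\<lambda>(j, \<gamma>). restrict (\<lambda>V. a V \<bullet> pQ ((if V = V0 then real j *\<^sub>R z else 0) + \<gamma>)) f)"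
    define J where "J = {..M} \<times> Y (\<epsilon> / 2) r"
    have sub: "F ` J \<subseteq> PiE f Z"
    proof (rule image_subsetI)
      fix p assume "p \<in> J"
      then obtain j \<gamma> where p: "p = (j, \<gamma>)" "j \<le> M" "\<gamma> \<in> Y (\<epsilon> / 2) r" unfolding J_def by auto
      have "(if V = V0 then real j *\<^sub>R z else 0) + \<gamma> \<in> Y \<epsilon> (R r)" for V
      proof -
        define y where "y = (if V = V0 then real j *\<^sub>R z else 0)"
        have jz: "real j *\<^sub>R z \<in> \<Gamma>" using lat_scale[OF z(1), of "int j"] by simp
        have "y \<in> \<Gamma>" unfolding y_def using jz lat_0 by simp
        moreover have "norm y \<le> real M * norm z" unfolding y_def using p(2) by (simp add: mult_right_mono)
        moreover have "norm (pQ y) \<le> \<epsilon> / 2"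
        proof -
          have "norm (pQ y) \<le> real M * norm (pQ z)"
            unfolding y_def using p(2)
            by (simp add: linear_cmul[OF linear_pQ] linear_0[OF linear_pQ] mult_right_mono)
          also have "\<dots> \<le> real (Suc M) * (\<epsilon> / (2 * real (Suc M)))" using z(2) by (intro mult_mono) auto
          also have "\<dots> = \<epsilon> / 2" by (simp del: of_nat_Suc)
          finally show ?thesis .
        qed
        ultimately show ?thesis
          using p(3) norm_triangle_ineq[of y \<gamma>] norm_triangle_ineq[of "pQ y" "pQ \<gamma>"] lat_add[of y \<gamma>]
            linear_add[OF linear_pQ, of y \<gamma>]
          unfolding y_def[symmetric] Y_def R_def by auto
      qed
      then show "F p \<in> PiE f Z" unfolding F_def p(1) Z_def by auto
    qed
    have "\<not> inj_on F J"
    proof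
      assume inj: "inj_on F J"
      have "card J \<le> card (PiE f Z)"
        by (rule card_inj_on_le[OF inj sub]) (intro finite_PiE f, simp add: Z_def finY)
      also have "\<dots> \<le> card (patch_classes S N (K * R r + \<rho>))"
        unfolding Z_def Y_def by (rule grid[OF C0(2)[OF KR(1)]])
      finally have "real (card J) \<le> real (card (patch_classes S N (K * R r + \<rho>)))" by (rule of_nat_mono)
      also have "\<dots> \<le> C0 * (K * R r + \<rho>) ^ dim P" by (rule C0(3)[OF KR(1)])
      also have "\<dots> \<le> C0 * ((2 * K) * r) ^ dim P"
        using KR(2,3) C0(1) by (intro mult_left_mono power_mono) auto
      also have "\<dots> = (C0 * (2 * K) ^ dim P) * r ^ dim P" by (simp only: power_mult_distrib mult.assoc)
      finally have le: "real (card J) \<le> (C0 * (2 * K) ^ dim P) * r ^ dim P" .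
      have "real (card J) = real (Suc M) * real (card (Y (\<epsilon> / 2) r))"
        unfolding J_def card_cartesian_product card_atMost of_nat_mult ..
      moreover have "real (Suc M) * (c1 * r ^ dim P) \<le> real (Suc M) * real (card (Y (\<epsilon> / 2) r))"
        by (rule mult_left_mono[OF c1(2)[OF r(1)]]) simp
      ultimately have "(real (Suc M) * c1) * r ^ dim P \<le> (C0 * (2 * K) ^ dim P) * r ^ dim P"
        using le by (simp only: mult.assoc)
      moreover have "r ^ dim P > 0" using r(4) by simp
      ultimately have "real (Suc M) * c1 \<le> C0 * (2 * K) ^ dim P" by (rule mult_right_le_imp_le)
      then show False using M by linarith
    qed
    then obtain p p' where pp: "p \<in> J" "p' \<in> J" "F p = F p'" "p \<noteq> p'" unfolding inj_on_def by blast
    obtain j \<gamma> j' \<gamma>' where p: "p = (j, \<gamma>)" "p' = (j', \<gamma>')" by (cases p, cases p') auto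
    have \<gamma>: "\<gamma> \<in> \<Gamma>" "\<gamma>' \<in> \<Gamma>" using pp(1,2) unfolding p J_def Y_def by auto
    have eq: "a V \<bullet> pQ ((if V = V0 then real j *\<^sub>R z else 0) + \<gamma>) = a V \<bullet> pQ ((if V = V0 then real j' *\<^sub>R z else 0) + \<gamma>')"
      if "V \<in> f" for V
      using fun_cong[OF pp(3), of V] that unfolding F_def p by simp
    define m where "m = int j - int j'"
    have other: "a V \<bullet> pQ (\<gamma>' - \<gamma>) = 0" if "V \<in> f - {V0}" for V
      using eq[of V] that by (simp add: linear_diff[OF linear_pQ] inner_diff_right)
    have at0: "a V0 \<bullet> pQ (of_int m *\<^sub>R z - (\<gamma>' - \<gamma>)) = 0"
      using eq[OF V0] unfolding m_def
      by (simp add: linear_diff[OF linear_pQ] linear_add[OF linear_pQ] linear_cmul[OF linear_pQ]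
        inner_diff_right inner_add_right algebra_simps)
    \<comment> \<open>With equal multiples, the two diagonal vectors would agree in every flag
      coordinate and so coincide, by totality and injectivity of \<open>pQ\<close> on the
      lattice.\<close>
    have "m \<noteq> 0"
    proof
      assume m0: "m = 0"
      then have "a V0 \<bullet> pQ (\<gamma>' - \<gamma>) = 0" using at0 by (simp add: linear_diff[OF linear_pQ] inner_diff_right linear_0[OF linear_pQ])
      then have "a V \<bullet> pQ (\<gamma>' - \<gamma>) = 0" if "V \<in> f" for V using other[of V] that by (cases "V = V0") auto
      then have "pQ (\<gamma>' - \<gamma>) = 0" by (intro total pQ_in)
      then have "\<gamma>' - \<gamma> = 0" using lat_pQ_eq_0 lat_diff \<gamma> by blast
      then show False using pp(4) m0 unfolding p m_def by simp
    qed
    moreover have "of_int m *\<^sub>R z - (\<gamma>' - \<gamma>) \<in> stab (a V0)"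
      unfolding stab_def using at0 lat_scale[OF z(1)] lat_diff[OF \<gamma>(2,1)] by (auto intro: lat_diff)
    ultimately show ?thesis using other lat_diff[OF \<gamma>(2,1)] by blast
  qed
  have "\<epsilon> / (2 * real (Suc M)) > 0" using \<epsilon> by simp
  then show ?thesis using main by blast
qed

text \<open>By density there is a lattice vector y with internal part near that of x divided by m;
  then y and x - m y both have small internal part. Hence such vectors generate the lattice, and a
  result about them extends to the whole space.\<close>

lemma span_eq_UNIV_if_small_subset:
  assumes W: "subspace W" and \<epsilon>: "\<epsilon> > 0" and small: "\<And>z. z \<in> \<Gamma> \<Longrightarrow> norm (pQ z) < \<epsilon> \<Longrightarrow> z \<in> W"
  shows "W = UNIV"
proof -
  have "x \<in> W" if x: "x \<in> \<Gamma>" for x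
  proof -
    define m where "m = nat \<lceil>2 * norm (pQ x) / \<epsilon>\<rceil> + 1"
    have m: "real m > 2 * norm (pQ x) / \<epsilon>" "m > 0" unfolding m_def by linarith+
    then have mx: "norm (pQ x) / real m < \<epsilon> / 2" using \<epsilon> by (simp add: field_simps)
    have "(1 / real m) *\<^sub>R pQ x \<in> Q" using pQ_in subspace_Q by (intro subspace_scale)
    moreover have e: "\<epsilon> / (2 * real m) > 0" using \<epsilon> m by simp
    ultimately obtain y where y: "y \<in> \<Gamma>" "dist (pQ y) ((1 / real m) *\<^sub>R pQ x) < \<epsilon> / (2 * real m)"
      by (rule dense)
    have "\<epsilon> / (2 * real m) \<le> \<epsilon> / 2" using \<epsilon> m by (simp add: field_simps)
    moreover have "norm (pQ y) \<le> dist (pQ y) ((1 / real m) *\<^sub>R pQ x) + norm ((1 / real m) *\<^sub>R pQ x)"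
      by (metis dist_norm norm_triangle_sub add.commute)
    moreover have "norm ((1 / real m) *\<^sub>R pQ x) = norm (pQ x) / real m" by simp
    ultimately have "norm (pQ y) < \<epsilon>" using y(2) mx by linarith
    then have yW: "y \<in> W" by (rule small[OF y(1)])
    have my: "real m *\<^sub>R y \<in> \<Gamma>" using lat_scale[OF y(1), of "int m"] by simp
    have "pQ (x - real m *\<^sub>R y) = - (real m *\<^sub>R (pQ y - (1 / real m) *\<^sub>R pQ x))"
      using m by (simp add: linear_diff[OF linear_pQ] linear_cmul[OF linear_pQ] scaleR_diff_right)
    then have "norm (pQ (x - real m *\<^sub>R y)) = real m * dist (pQ y) ((1 / real m) *\<^sub>R pQ x)"
      by (simp add: dist_norm)
    also have "\<dots> < real m * (\<epsilon> / (2 * real m))" using m(2) by (intro mult_strict_left_mono y(2)) simp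
    also have "\<dots> < \<epsilon>" using \<epsilon> m(2) by simp
    finally have "x - real m *\<^sub>R y \<in> W" using x my lat_diff by (intro small) auto
    then have "(x - real m *\<^sub>R y) + real m *\<^sub>R y \<in> W" using yW W by (intro subspace_add subspace_scale)
    then show ?thesis by simp
  qed
  then have "span \<Gamma> \<subseteq> W" using W by (intro span_minimal) auto
  moreover have "span lbasis \<subseteq> span \<Gamma>" using zmod.span_superset[of lbasis] lbasis(3) by (intro span_mono) simp
  ultimately show ?thesis using lbasis(2) by auto
qed

lemma flags_if_property_C:
  assumes C: "property_C S N" and fl: "f \<in> flags0 S"
  shows "(\<Sum>V\<in>f. rk S V) = DIM('e) * (dim Q - 1)"
proof -
  have f: "f \<subseteq> hyperplanes0 S" "finite f" "card f = dim Q" "\<Inter>f = {0}"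
    using fl unfolding flags0_def by auto
  have "\<exists>i a w e. V \<in> f \<longrightarrow> i \<in> labels S \<and> a \<in> Q \<and> V = perp a \<and> w \<in> Q \<and> e > 0 \<and>
    (\<forall>x\<in>Q. dist x w < e \<longrightarrow> (x \<in> cell S i \<longleftrightarrow> a \<bullet> x \<ge> a \<bullet> w))" for V
    using hyperplane0_local[of V] f(1) by blast
  then obtain lb a w e where
    data: "\<And>V. V \<in> f \<Longrightarrow> lb V \<in> labels S \<and> a V \<in> Q \<and> V = perp (a V) \<and> w V \<in> Q \<and> e V > 0 \<and>
      (\<forall>x\<in>Q. dist x (w V) < e V \<longrightarrow> (x \<in> cell S (lb V) \<longleftrightarrow> a V \<bullet> x \<ge> a V \<bullet> w V))"
    by metis
  have total: "x = 0" if x: "x \<in> Q" "\<And>V. V \<in> f \<Longrightarrow> a V \<bullet> x = 0" for x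
  proof -
    have "x \<in> V" if V: "V \<in> f" for V
    proof -
      have "x \<in> perp (a V)" unfolding perp_def using x V by simp
      then show ?thesis using data[OF V] by metis
    qed
    then have "x \<in> \<Inter>f" by blast
    then show ?thesis using f(4) by simp
  qed
  obtain \<epsilon> K \<rho> where grid: "\<epsilon> > 0" "K > 0" "\<And>r. finite (patch_classes S N (K * r + \<rho>)) \<Longrightarrow>
      card (PiE f (\<lambda>V. (\<lambda>x. a V \<bullet> pQ x) ` {x \<in> \<Gamma>. norm x \<le> r \<and> norm (pQ x) \<le> \<epsilon>}))
        \<le> card (patch_classes S N (K * r + \<rho>))"
  proof -
    have "\<exists>\<epsilon> K \<rho>. \<epsilon> > 0 \<and> K > 0 \<and> (\<forall>r. finite (patch_classes S N (K * r + \<rho>)) \<longrightarrow>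
      card (PiE f (\<lambda>V. (\<lambda>x. a V \<bullet> pQ x) ` {x \<in> \<Gamma>. norm x \<le> r \<and> norm (pQ x) \<le> \<epsilon>}))
        \<le> card (patch_classes S N (K * r + \<rho>)))"
      by (rule grid_card_le_patches[of f a lb w e]) (use f data total in auto)
    then show thesis using that by blast
  qed
  \<comment> \<open>\<open>cap g\<close> is the intersection of the stabilisers for
    \<open>g\<close>; it is the whole lattice for empty \<open>g\<close>, from which the induction
    below starts.\<close>
  define cap where "cap g = {x \<in> \<Gamma>. \<forall>V\<in>g. a V \<bullet> pQ x = 0}" for g
  define L where "L V = span (stab (a V))" for V
  have dimL: "dim (L V) = free_rank (stab (a V))" for V
    unfolding L_def by (simp add: free_rank_eq_dim[OF stab_subgroup stab_subset])
  \<comment> \<open>Every lattice vector with small internal part has a non-zero multiple in the sum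
    of the two groups. Over the reals the multiple can be divided out, so the spans together fill
    the space.\<close>
  have sumL: "{x + y |x y. x \<in> span (cap (f - {V})) \<and> y \<in> L V} = UNIV" if V: "V \<in> f" for V
  proof -
    define W where "W = {x + y |x y. x \<in> span (cap (f - {V})) \<and> y \<in> L V}"
    have W: "subspace W" unfolding W_def L_def by (rule subspace_sums) auto
    have "\<exists>\<epsilon>'>0. \<forall>z\<in>\<Gamma>. norm (pQ z) < \<epsilon>' \<longrightarrow>
      (\<exists>m \<gamma>. m \<noteq> 0 \<and> \<gamma> \<in> \<Gamma> \<and> of_int m *\<^sub>R z - \<gamma> \<in> stab (a V) \<and> (\<forall>V'\<in>f - {V}. a V' \<bullet> pQ \<gamma> = 0))"
      by (rule multiple_decomposes[of f a \<epsilon> K \<rho> V]) (fact C f(2) total grid V)+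
    then obtain \<epsilon>' where \<epsilon>': "\<epsilon>' > 0" "\<forall>z\<in>\<Gamma>. norm (pQ z) < \<epsilon>' \<longrightarrow>
      (\<exists>m \<gamma>. m \<noteq> 0 \<and> \<gamma> \<in> \<Gamma> \<and> of_int m *\<^sub>R z - \<gamma> \<in> stab (a V) \<and> (\<forall>V'\<in>f - {V}. a V' \<bullet> pQ \<gamma> = 0))"
      by (elim exE conjE) (rule that; assumption)
    have "z \<in> W" if z: "z \<in> \<Gamma>" "norm (pQ z) < \<epsilon>'" for z
    proof -
      obtain m \<gamma> where m: "m \<noteq> 0" "\<gamma> \<in> \<Gamma>" "of_int m *\<^sub>R z - \<gamma> \<in> stab (a V)" "\<forall>V'\<in>f - {V}. a V' \<bullet> pQ \<gamma> = 0"
        using \<epsilon>'(2)[rule_format, OF z] by (elim exE conjE) (rule that; assumption)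
      have "\<gamma> \<in> span (cap (f - {V}))" unfolding cap_def using m by (intro span_base) simp
      moreover have "of_int m *\<^sub>R z - \<gamma> \<in> L V" unfolding L_def using m(3) by (rule span_base)
      moreover have "of_int m *\<^sub>R z = \<gamma> + (of_int m *\<^sub>R z - \<gamma>)" by simp
      ultimately have "of_int m *\<^sub>R z \<in> W" unfolding W_def by blast
      then show ?thesis using subspace_scale[OF W, of "of_int m *\<^sub>R z" "1 / of_int m"] m(1) by simp
    qed
    then have "W = UNIV" by (rule span_eq_UNIV_if_small_subset[OF W \<epsilon>'(1)])
    then show ?thesis unfolding W_def .
  qed
  have rle: "free_rank (stab (a V)) \<le> DIM('e)" for V unfolding dimL[symmetric] by (rule dim_subset_UNIV)
  \<comment> \<open>Each new \<open>V\<close> lowers the dimension by at least k - rk V: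
    \<open>cap g\<close> contains \<open>cap (f - {V})\<close>, so its span and \<open>L V\<close>
    still fill the space, and their intersection has dimension dim (span (cap g)) + rk V -
    k.\<close>
  have upper: "dim (span (cap g)) + (\<Sum>V\<in>g. DIM('e) - free_rank (stab (a V))) \<le> DIM('e)"
    if "finite g" "g \<subseteq> f" for g
    using that
  proof (induction g rule: finite_induct)
    case empty
    then show ?case using dim_subset_UNIV[of "cap {}"] by simp
  next
    case (insert V g)
    have V: "V \<in> f" "g \<subseteq> f - {V}" using insert by auto
    have "cap (f - {V}) \<subseteq> cap g" unfolding cap_def using V(2) by blast
    then have "span (cap (f - {V})) \<subseteq> span (cap g)" by (rule span_mono)
    then have U: "{x + y |x y. x \<in> span (cap g) \<and> y \<in> L V} = UNIV" using sumL[OF V(1)] by blast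
    have "dim {x + y |x y. x \<in> span (cap g) \<and> y \<in> L V} + dim (span (cap g) \<inter> L V) = dim (span (cap g)) + dim (L V)"
      unfolding L_def by (rule dim_sums_Int) auto
    then have "DIM('e) + dim (span (cap g) \<inter> L V) = dim (span (cap g)) + free_rank (stab (a V))"
      unfolding U dimL by simp
    moreover have "dim (span (cap (insert V g))) \<le> dim (span (cap g) \<inter> L V)"
    proof (rule dim_subset)
      have "cap (insert V g) \<subseteq> cap g" "cap (insert V g) \<subseteq> stab (a V)" unfolding cap_def stab_def by auto
      then show "span (cap (insert V g)) \<subseteq> span (cap g) \<inter> L V" unfolding L_def using span_mono by blast
    qed
    moreover have "dim (span (cap g)) + (\<Sum>V\<in>g. DIM('e) - free_rank (stab (a V))) \<le> DIM('e)"
      using insert by auto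
    moreover have "(\<Sum>V\<in>insert V g. DIM('e) - free_rank (stab (a V))) =
        DIM('e) - free_rank (stab (a V)) + (\<Sum>V\<in>g. DIM('e) - free_rank (stab (a V)))"
      using insert.hyps by simp
    ultimately show ?case using rle[of V] by linarith
  qed
  \<comment> \<open>With the unconditional reverse inequality the sum of k - rk V is exactly k; as
    \<open>f\<close> has n members, the ranks sum to nk - k.\<close>
  have "(\<Sum>V\<in>f. DIM('e) - free_rank (stab (a V))) \<le> DIM('e)" using upper[OF f(2)] by simp
  moreover have "DIM('e) \<le> (\<Sum>V\<in>f. DIM('e) - free_rank (stab (a V)))" by (rule normal_rank_ge[of f a, OF f(2) total])
  moreover have "(\<Sum>V\<in>f. DIM('e) - free_rank (stab (a V))) + (\<Sum>V\<in>f. free_rank (stab (a V))) = dim Q * DIM('e)"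
    unfolding sum.distrib[symmetric] using rle f(3) by simp
  moreover have "(\<Sum>V\<in>f. rk S V) = (\<Sum>V\<in>f. free_rank (stab (a V)))"
  proof (rule sum.cong[OF refl])
    fix V assume "V \<in> f"
    then have "V = perp (a V)" using data by blast
    then show "rk S V = free_rank (stab (a V))" using rk_hyperplane[of "a V"] unfolding perp_def by metis
  qed
  moreover have "dim Q * DIM('e) = DIM('e) * (dim Q - 1) + DIM('e)"
    using dim_Q_pos by (cases "dim Q") auto
  ultimately show ?thesis by linarith
qed

end

theorem corollary2p11:
  fixes S :: "('e::euclidean_space, 'l) scheme" and N :: "'e \<Rightarrow> real" and k n :: nat
  assumes "polytopal_scheme S"
    and "norm_on (phys S) N"
    and "k = DIM('e)"
    and "n = k - dim (phys S)"
  shows "property_C S N \<longleftrightarrow> (\<forall>f\<in>flags0 S. (\<Sum>V\<in>f. rk S V) = k * (n - 1))"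
proof -
  interpret cut_project S N by standard (fact assms)+
  have "n = dim (intl S)" using dim_plus assms(3,4) by simp
  then show ?thesis using property_C_if_flags flags_if_property_C assms(3) by blast
qed

end
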